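(* Let $(a_n)_{n\in\mathbb N}$ be a strictly positive real sequence with $a_n\to0$ and $\sqrt n\,a_n\to\infty$. Let $\rho_{AB}\in\mathcal S(AB)$ with $V(A:B)_\rho>0$, and put $R_n:=I(A:B)_\rho+a_n$. Then $$\lim_{n\to\infty}-\frac{1}{na_n^2}\log\big(1-\hat\alpha_{n,\rho}(e^{-nR_n})\big)=\frac{1}{2V(A:B)_\rho},$$ and the same holds with $\hat\alpha_{n,\rho}$ replaced by $\hat\alpha^{\mathrm{iid}}_{n,\rho}$.
   Context: All Hilbert spaces are finite-dimensional, $\log$ is natural, $\mathcal S(A)$ is the set of density operators on $A$. $I(A:B)_\rho=H(A)_\rho+H(B)_\rho-H(AB)_\rho$; $V(A:B)_\rho=\operatorname{tr}[\rho_{AB}(\log\rho_{AB}-\log(\rho_A\otimes\rho_B)-I(A:B)_\rho)^2]$. $\mathcal S_{\mathrm{sym}}(A^{\otimes n})$: permutation-invariant states. $\hat\alpha_{n,\rho}(\mu)=\min\{\operatorname{tr}[\rho_{AB}^{\otimes n}(1-T)]:0\le T\le1,\ \max_{\sigma_{A^n}\in\mathcal S_{\mathrm{sym}}(A^{\otimes n}),\tau_{B^n}\in\mathcal S_{\mathrm{sym}}(B^{\otimes n})}\operatorname{tr}[(\sigma_{A^n}\otimes\tau_{B^n})T]\le\mu\}$; $\hat\alpha^{\mathrm{iid}}_{n,\rho}(\mu)=\min\{\operatorname{tr}[\rho_{AB}^{\otimes n}(1-T)]:0\le T\le1,\ \max_{\sigma_A\in\mathcal S(A),\tau_B\in\mathcal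 S(B)}\operatorname{tr}[(\sigma_A^{\otimes n}\otimes\tau_B^{\otimes n})T]\le\mu\}$. *)

theory Defs
  imports "HOL-Analysis.Analysis" "Jordan_Normal_Form.Matrix"
begin

text \<open>A system of dimension d is C^d; operators are d x d complex matrices
  (type complex mat of Jordan_Normal_Form). A bipartite system AB has
  dimension dA * dB with basis index i = a * dB + b (Kronecker convention).\<close>

definition mtrace :: "complex mat \<Rightarrow> complex" where
  "mtrace A = (\<Sum>i<dim_row A. A $$ (i, i))"

definition adj :: "complex mat \<Rightarrow> complex mat" where
  "adj A = mat (dim_col A) (dim_row A) (\<lambda>(i, j). cnj (A $$ (j, i)))"

definition hermitian :: "nat \<Rightarrow> complex mat \<Rightarrow> bool" where
  "hermitian d A \<longleftrightarrow> A \<in> carrier_mat d d \<and> adj A = A"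

definition psd :: "nat \<Rightarrow> complex mat \<Rightarrow> bool" where
  "psd d A \<longleftrightarrow> hermitian d A \<and>
     (\<forall>v \<in> carrier_vec d. 0 \<le> Re (\<Sum>i<d. cnj (v $ i) * (A *\<^sub>v v) $ i))"

definition density :: "nat \<Rightarrow> complex mat \<Rightarrow> bool" where
  "density d \<rho> \<longleftrightarrow> psd d \<rho> \<and> mtrace \<rho> = 1"

definition unitary :: "nat \<Rightarrow> complex mat \<Rightarrow> bool" where
  "unitary d U \<longleftrightarrow> U \<in> carrier_mat d d \<and> U * adj U = 1\<^sub>m d \<and> adj U * U = 1\<^sub>m d"

text \<open>Functional calculus for Hermitian matrices via a spectral decomposition
  A = U D U^*: f(A) = U f(D) U^*.  (Independent of the chosen decomposition.)\<close>
definition matfun :: "(real \<Rightarrow> real) \<Rightarrow> nat \<Rightarrow> complex mat \<Rightarrow> complex mat" where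
  "matfun f d A = (SOME F. \<exists>U D. unitary d U \<and> D \<in> carrier_mat d d \<and> diagonal_mat D
      \<and> (\<forall>i<d. Im (D $$ (i, i)) = 0) \<and> A = U * D * adj U
      \<and> F = U * mat d d (\<lambda>(i, j). if i = j then complex_of_real (f (Re (D $$ (i, i)))) else 0) * adj U)"

text \<open>Matrix logarithm (natural log). With ln 0 = 0 in Isabelle, log is taken on the
  support, which is the standard convention (0 log 0 = 0).\<close>
definition mlog :: "nat \<Rightarrow> complex mat \<Rightarrow> complex mat" where
  "mlog d A = matfun ln d A"

definition kron :: "complex mat \<Rightarrow> complex mat \<Rightarrow> complex mat" where
  "kron A B = mat (dim_row A * dim_row B) (dim_col A * dim_col B)
     (\<lambda>(i, j). A $$ (i div dim_row B, j div dim_col B) * B $$ (i mod dim_row B, j mod dim_col B))"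

text \<open>n-fold tensor power A^{\<otimes>n} (factor 1 is the most significant index).\<close>
fun tpow :: "complex mat \<Rightarrow> nat \<Rightarrow> complex mat" where
  "tpow A 0 = 1\<^sub>m 1"
| "tpow A (Suc n) = kron A (tpow A n)"

definition ptrB :: "nat \<Rightarrow> nat \<Rightarrow> complex mat \<Rightarrow> complex mat" where
  "ptrB dA dB \<rho> = mat dA dA (\<lambda>(i, j). \<Sum>k<dB. \<rho> $$ (i * dB + k, j * dB + k))"

definition ptrA :: "nat \<Rightarrow> nat \<Rightarrow> complex mat \<Rightarrow> complex mat" where
  "ptrA dA dB \<rho> = mat dB dB (\<lambda>(i, j). \<Sum>k<dA. \<rho> $$ (k * dB + i, k * dB + j))"

definition entropy :: "nat \<Rightarrow> complex mat \<Rightarrow> real" where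
  "entropy d \<rho> = - Re (mtrace (\<rho> * mlog d \<rho>))"

definition mutual_info :: "nat \<Rightarrow> nat \<Rightarrow> complex mat \<Rightarrow> real" where
  "mutual_info dA dB \<rho> = entropy dA (ptrB dA dB \<rho>) + entropy dB (ptrA dA dB \<rho>) - entropy (dA * dB) \<rho>"

definition mutual_info_var :: "nat \<Rightarrow> nat \<Rightarrow> complex mat \<Rightarrow> real" where
  "mutual_info_var dA dB \<rho> =
     (let X = mlog (dA * dB) \<rho> - mlog (dA * dB) (kron (ptrB dA dB \<rho>) (ptrA dA dB \<rho>))
              - complex_of_real (mutual_info dA dB \<rho>) \<cdot>\<^sub>m 1\<^sub>m (dA * dB)
      in Re (mtrace (\<rho> * (X * X))))"

text \<open>k-th tensor factor (k < n) of a basis index i of (C^d)^{\<otimes>n}.\<close>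
definition digit :: "nat \<Rightarrow> nat \<Rightarrow> nat \<Rightarrow> nat \<Rightarrow> nat" where
  "digit d n k i = (i div d ^ (n - 1 - k)) mod d"

definition perm_op :: "nat \<Rightarrow> nat \<Rightarrow> (nat \<Rightarrow> nat) \<Rightarrow> complex mat" where
  "perm_op d n \<pi> = mat (d ^ n) (d ^ n)
     (\<lambda>(i, j). if (\<forall>k<n. digit d n k i = digit d n (\<pi> k) j) then 1 else 0)"

definition sym_density :: "nat \<Rightarrow> nat \<Rightarrow> complex mat \<Rightarrow> bool" where
  "sym_density d n \<sigma> \<longleftrightarrow> density (d ^ n) \<sigma> \<and>
     (\<forall>\<pi>. \<pi> permutes {..<n} \<longrightarrow> perm_op d n \<pi> * \<sigma> * adj (perm_op d n \<pi>) = \<sigma>)"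

text \<open>Reordering A^n B^n \<rightarrow> (AB)^n: basis index i of (AB)^{\<otimes>n} corresponds to
  index reorder_idx i of A^{\<otimes>n} \<otimes> B^{\<otimes>n}.\<close>
definition reorder_idx :: "nat \<Rightarrow> nat \<Rightarrow> nat \<Rightarrow> nat \<Rightarrow> nat" where
  "reorder_idx dA dB n i =
     (\<Sum>k<n. (digit (dA * dB) n k i div dB) * dA ^ (n - 1 - k)) * dB ^ n
     + (\<Sum>k<n. (digit (dA * dB) n k i mod dB) * dB ^ (n - 1 - k))"

definition regroup :: "nat \<Rightarrow> nat \<Rightarrow> nat \<Rightarrow> complex mat \<Rightarrow> complex mat" where
  "regroup dA dB n X = mat ((dA * dB) ^ n) ((dA * dB) ^ n)
     (\<lambda>(i, j). X $$ (reorder_idx dA dB n i, reorder_idx dA dB n j))"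

definition test_op :: "nat \<Rightarrow> complex mat \<Rightarrow> bool" where
  "test_op N T \<longleftrightarrow> psd N T \<and> psd N (1\<^sub>m N - T)"

definition alpha_hat :: "nat \<Rightarrow> nat \<Rightarrow> complex mat \<Rightarrow> nat \<Rightarrow> real \<Rightarrow> real" where
  "alpha_hat dA dB \<rho> n \<mu> = Inf {Re (mtrace (tpow \<rho> n * (1\<^sub>m ((dA * dB) ^ n) - T))) | T.
     test_op ((dA * dB) ^ n) T \<and>
     (\<forall>\<sigma> \<tau>. sym_density dA n \<sigma> \<longrightarrow> sym_density dB n \<tau> \<longrightarrow>
        Re (mtrace (regroup dA dB n (kron \<sigma> \<tau>) * T)) \<le> \<mu>)}"

definition alpha_hat_iid :: "nat \<Rightarrow> nat \<Rightarrow> complex mat \<Rightarrow> nat \<Rightarrow> real \<Rightarrow> real" where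
  "alpha_hat_iid dA dB \<rho> n \<mu> = Inf {Re (mtrace (tpow \<rho> n * (1\<^sub>m ((dA * dB) ^ n) - T))) | T.
     test_op ((dA * dB) ^ n) T \<and>
     (\<forall>\<sigma> \<tau>. density dA \<sigma> \<longrightarrow> density dB \<tau> \<longrightarrow>
        Re (mtrace (regroup dA dB n (kron (tpow \<sigma> n) (tpow \<tau> n)) * T)) \<le> \<mu>)}"

end

theory Submission
  imports Defs "Jordan_Normal_Form.Spectral_Radius" "HOL-Real_Asymp.Real_Asymp" "HOL-Combinatorics.Permutations"
begin

text \<open>
  Write \<open>e\<^sub>i, p\<^sub>i\<close> and \<open>f\<^sub>j, q\<^sub>j\<close> for the spectral data of the \<open>n\<close>-fold powers of the state and of the product of its
  marginals. All exponents are governed by the log-likelihood ratio \<open>log p\<^sub>i - log q\<^sub>j\<close> under the Nussbaum-Szkola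
  distribution \<open>p\<^sub>i |<f\<^sub>j, e\<^sub>i>|^2\<close>, a sum of independent terms with mean \<open>n I\<close> and variance \<open>n V\<close>; its moderate
  deviations follow from Chernoff's bound and from exponential tilting with Chebyshev's inequality.

  Converse, already for the i.i.d. alternative: split \<open>e\<^sub>i\<close> into its parts on \<open>q\<^sub>j \<ge> exp (-l) p\<^sub>i\<close> and on the
  complement. The first part costs \<open>exp l\<close> times the error of the second kind times the polynomial number of
  distinct \<open>p\<^sub>i\<close>, the second one is a tail probability.

  Achievability: there is a universal operator of polynomial trace that dominates all symmetric states and commutes with
  the powers of the marginal. By Markov's inequality it exceeds \<open>exp x\<close> times the power of the marginal only on a
  subspace of weight \<open>exp (-x)\<close> up to polynomial factors, which is negligible for \<open>x = \<delta> n a\<^sub>n\<close>. Projecting each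
  \<open>e\<^sub>i\<close> on the complement of that subspace and on \<open>q\<^sub>j \<le> exp (-l) p\<^sub>i\<close>, and orthonormalising in the order of
  increasing \<open>p\<^sub>i\<close>, yields a projection whose success probability is at least the tail probability (K. Li's test).
\<close>

text \<open>The success probability itself vanishes, like exp (- n a_n^2 / (2 V)), so every
  correction has to be small relative to it. A gap of scales makes room: n a_n^2 is of smaller order
  than n a_n, because a_n -> 0, and n a_n >= sqrt n eventually. Hence a polynomial times exp (-
  \<delta> n a_n) is negligible for each fixed \<delta> > 0, while moving the likelihood threshold
  by a multiple of \<delta> n a_n changes the exponent only by a factor that tends to 1 with
  \<delta>. Powers of states are symmetric, so the i.i.d. error is at most the symmetric one; a
  converse for the former and an achievability bound for the latter therefore settle both limits.
  The obstacle is noncommutativity: the state need not commute with the product of its marginals, so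
  the event "likelihood ratio above a threshold" is not a projection. The commutation that is
  available, between the universal operator and the power of a marginal, is what lets the truncation
  combine with the spectral projections of that power into a nested family of projections.\<close>

no_notation Finite_Cartesian_Product.vec_nth (infixl "$" 90)

section \<open>Index arithmetic for composite systems\<close>

lemma sum_lessThan_mult:
  fixes f :: "nat \<Rightarrow> 'a::comm_monoid_add"
  shows "(\<Sum>i<m * n. f i) = (\<Sum>a<m. \<Sum>b<n. f (a * n + b))"
proof -
  have "sum f {a * n..<a * n + n} = (\<Sum>b<n. f (a * n + b))" for a
    using sum.shift_bounds_nat_ivl[of f 0 "a * n" n] by (simp add: add.commute atLeast0LessThan)
  then show ?thesis using sum.nat_group[of f n m] by simp
qed

lemma div_mult_less: "(a::nat) < m * n \<Longrightarrow> a div n < m"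
  by (simp add: less_mult_imp_div_less)

lemma mod_mult_less: "(a::nat) < m * n \<Longrightarrow> a mod n < n"
  by (metis gr_zeroI mod_less_divisor mult_0_right not_less0)

lemma mult_add_less: "a < m \<Longrightarrow> b < n \<Longrightarrow> a * n + b < m * (n::nat)"
proof -
  assume "a < m" "b < n"
  then have "a * n + b < Suc a * n" by simp
  also have "\<dots> \<le> m * n" using \<open>a < m\<close> by (intro mult_le_mono1) simp
  finally show ?thesis .
qed

section \<open>Adjoint, inner product and trace\<close>

lemma mult_mat_index:
  "A \<in> carrier_mat n m \<Longrightarrow> B \<in> carrier_mat m l \<Longrightarrow> i < n \<Longrightarrow> j < l \<Longrightarrow>
    (A * B) $$ (i, j) = (\<Sum>k<m. A $$ (i, k) * B $$ (k, j))"
  by (auto simp: scalar_prod_def atLeast0LessThan)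

lemma mult_mat_vec_nth:
  "A \<in> carrier_mat n m \<Longrightarrow> v \<in> carrier_vec m \<Longrightarrow> i < n \<Longrightarrow>
    (A *\<^sub>v v) $ i = (\<Sum>k<m. A $$ (i, k) * v $ k)"
  by (auto simp: scalar_prod_def atLeast0LessThan)

lemma adj_carrier [simp, intro]: "A \<in> carrier_mat n m \<Longrightarrow> adj A \<in> carrier_mat m n"
  by (auto simp: adj_def)

lemma adj_index [simp]: "i < dim_col A \<Longrightarrow> j < dim_row A \<Longrightarrow> adj A $$ (i, j) = cnj (A $$ (j, i))"
  by (auto simp: adj_def)

lemma adj_dim [simp]: "dim_row (adj A) = dim_col A" "dim_col (adj A) = dim_row A"
  by (auto simp: adj_def)

lemma adj_adj [simp]: "adj (adj A) = A"
  by (rule eq_matI) auto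

lemma adj_mult:
  "A \<in> carrier_mat n m \<Longrightarrow> B \<in> carrier_mat m l \<Longrightarrow> adj (A * B) = adj B * adj A"
  by (rule eq_matI) (auto simp: mult_mat_index[of _ n m _ l] mult_mat_index[of _ l m _ n] mult.commute
      simp del: index_mult_mat(1) intro!: sum.cong)

lemma adj_one [simp]: "adj (1\<^sub>m d) = 1\<^sub>m d"
  by (rule eq_matI) auto

lemma adj_minus: "A \<in> carrier_mat n m \<Longrightarrow> B \<in> carrier_mat n m \<Longrightarrow> adj (A - B) = adj A - adj B"
  by (rule eq_matI) auto

lemma adj_add: "A \<in> carrier_mat n m \<Longrightarrow> B \<in> carrier_mat n m \<Longrightarrow> adj (A + B) = adj A + adj B"
  by (rule eq_matI) auto

lemma adj_smult: "adj (complex_of_real r \<cdot>\<^sub>m A) = complex_of_real r \<cdot>\<^sub>m adj A"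
  by (rule eq_matI) auto

lemma mult_carrier_sq: "A \<in> carrier_mat d d \<Longrightarrow> B \<in> carrier_mat d d \<Longrightarrow> A * B \<in> carrier_mat d d"
  by simp

lemma assoc_sq: "A \<in> carrier_mat d d \<Longrightarrow> B \<in> carrier_mat d d \<Longrightarrow> C \<in> carrier_mat d d \<Longrightarrow>
   A * B * C = A * (B * C)" for A :: "complex mat"
  by (rule assoc_mult_mat)

definition ip :: "complex vec \<Rightarrow> complex vec \<Rightarrow> complex" where
  "ip v w = (\<Sum>i<dim_vec v. cnj (v $ i) * w $ i)"

definition nsq :: "complex vec \<Rightarrow> real" where
  "nsq v = (\<Sum>i<dim_vec v. (cmod (v $ i))\<^sup>2)"

lemma ip_self: "ip v v = complex_of_real (nsq v)"
  unfolding ip_def nsq_def of_real_sum complex_norm_square by (simp add: mult.commute)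

lemma nsq_nonneg [simp]: "0 \<le> nsq v"
  by (simp add: nsq_def sum_nonneg)

lemma nsq_eq_0: "v \<in> carrier_vec d \<Longrightarrow> nsq v = 0 \<longleftrightarrow> v = 0\<^sub>v d"
  by (auto simp: nsq_def sum_nonneg_eq_0_iff intro!: eq_vecI)

lemma ip_commute: "v \<in> carrier_vec d \<Longrightarrow> w \<in> carrier_vec d \<Longrightarrow> ip w v = cnj (ip v w)"
  by (simp add: ip_def mult.commute)

lemma ip_add_left: "u \<in> carrier_vec d \<Longrightarrow> v \<in> carrier_vec d \<Longrightarrow> w \<in> carrier_vec d \<Longrightarrow>
  ip (u + v) w = ip u w + ip v w"
  by (simp add: ip_def algebra_simps sum.distrib)

lemma ip_add_right: "u \<in> carrier_vec d \<Longrightarrow> v \<in> carrier_vec d \<Longrightarrow> w \<in> carrier_vec d \<Longrightarrow>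
  ip u (v + w) = ip u v + ip u w"
  by (simp add: ip_def algebra_simps sum.distrib)

lemma ip_minus_left: "u \<in> carrier_vec d \<Longrightarrow> v \<in> carrier_vec d \<Longrightarrow> w \<in> carrier_vec d \<Longrightarrow>
  ip (u - v) w = ip u w - ip v w"
  by (simp add: ip_def algebra_simps sum_subtractf)

lemma ip_minus_right: "u \<in> carrier_vec d \<Longrightarrow> v \<in> carrier_vec d \<Longrightarrow> w \<in> carrier_vec d \<Longrightarrow>
  ip u (v - w) = ip u v - ip u w"
  by (simp add: ip_def algebra_simps sum_subtractf)

lemma ip_smult_right: "u \<in> carrier_vec d \<Longrightarrow> v \<in> carrier_vec d \<Longrightarrow> ip u (c \<cdot>\<^sub>v v) = c * ip u v"
  by (simp add: ip_def algebra_simps sum_distrib_left)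

lemma ip_smult_left: "u \<in> carrier_vec d \<Longrightarrow> v \<in> carrier_vec d \<Longrightarrow> ip (c \<cdot>\<^sub>v u) v = cnj c * ip u v"
  by (simp add: ip_def algebra_simps sum_distrib_left)

lemma ip_mult_mat:
  assumes "A \<in> carrier_mat n m" "v \<in> carrier_vec n" "w \<in> carrier_vec m"
  shows "ip v (A *\<^sub>v w) = ip (adj A *\<^sub>v v) w"
proof -
  have "ip v (A *\<^sub>v w) = (\<Sum>i<n. \<Sum>k<m. cnj (v $ i) * (A $$ (i, k) * w $ k))"
    using assms by (simp add: ip_def mult_mat_vec_nth[of A n m] sum_distrib_left del: index_mult_mat_vec)
  also have "\<dots> = (\<Sum>k<m. \<Sum>i<n. cnj (v $ i) * (A $$ (i, k) * w $ k))" by (rule sum.swap)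
  also have "\<dots> = ip (adj A *\<^sub>v v) w"
    using assms by (simp add: ip_def mult_mat_vec_nth[of _ m n] sum_distrib_left sum_distrib_right mult_ac
        del: index_mult_mat_vec)
  finally show ?thesis .
qed

lemma Cauchy_Schwarz_ip:
  assumes "v \<in> carrier_vec d" "w \<in> carrier_vec d"
  shows "(cmod (ip v w))\<^sup>2 \<le> nsq v * nsq w"
proof -
  have "cmod (ip v w) \<le> (\<Sum>i<d. \<bar>cmod (v $ i)\<bar> * \<bar>cmod (w $ i)\<bar>)"
    using assms unfolding ip_def by (auto intro!: order_trans[OF norm_sum] simp: norm_mult)
  also have "\<dots> \<le> L2_set (\<lambda>i. cmod (v $ i)) {..<d} * L2_set (\<lambda>i. cmod (w $ i)) {..<d}"
    by (rule L2_set_mult_ineq)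
  finally have "cmod (ip v w) \<le> sqrt (nsq v) * sqrt (nsq w)"
    using assms by (simp add: L2_set_def nsq_def)
  then have "(cmod (ip v w))\<^sup>2 \<le> (sqrt (nsq v) * sqrt (nsq w))\<^sup>2"
    by (intro power_mono) auto
  then show ?thesis by (simp add: power_mult_distrib)
qed

lemma mtrace_mult_eq_sum:
  "A \<in> carrier_mat n m \<Longrightarrow> B \<in> carrier_mat m n \<Longrightarrow> mtrace (A * B) = (\<Sum>i<n. \<Sum>k<m. A $$ (i, k) * B $$ (k, i))"
  unfolding mtrace_def by (auto simp: mult_mat_index[of _ n m _ n] simp del: index_mult_mat intro!: sum.cong)
    (simp_all add: mult_mat_index[of _ n m _ n])

lemma mtrace_comm:
  assumes "A \<in> carrier_mat n m" "B \<in> carrier_mat m n"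
  shows "mtrace (A * B) = mtrace (B * A)"
  unfolding mtrace_mult_eq_sum[OF assms] mtrace_mult_eq_sum[OF assms(2,1)]
  by (subst sum.swap) (simp add: mult.commute)

lemma mtrace_add: "A \<in> carrier_mat d d \<Longrightarrow> B \<in> carrier_mat d d \<Longrightarrow> mtrace (A + B) = mtrace A + mtrace B"
  by (simp add: mtrace_def sum.distrib)

lemma mtrace_minus: "A \<in> carrier_mat d d \<Longrightarrow> B \<in> carrier_mat d d \<Longrightarrow> mtrace (A - B) = mtrace A - mtrace B"
  by (simp add: mtrace_def sum_subtractf)

lemma mtrace_smult: "A \<in> carrier_mat d d \<Longrightarrow> mtrace (c \<cdot>\<^sub>m A) = c * mtrace A"
  by (simp add: mtrace_def sum_distrib_left)

section \<open>Real diagonal matrices\<close>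

definition dg :: "nat \<Rightarrow> (nat \<Rightarrow> real) \<Rightarrow> complex mat" where
  "dg d f = mat d d (\<lambda>(i, j). if i = j then complex_of_real (f i) else 0)"

lemma dg_carrier [simp, intro]: "dg d f \<in> carrier_mat d d"
  by (simp add: dg_def)

lemma dg_index [simp]: "i < d \<Longrightarrow> j < d \<Longrightarrow> dg d f $$ (i, j) = (if i = j then complex_of_real (f i) else 0)"
  by (simp add: dg_def)

lemma dg_dim [simp]: "dim_row (dg d f) = d" "dim_col (dg d f) = d"
  by (simp_all add: dg_def)

lemma dg_cong: "(\<And>i. i < d \<Longrightarrow> f i = g i) \<Longrightarrow> dg d f = dg d g"
  by (rule eq_matI) auto

lemma adj_dg [simp]: "adj (dg d f) = dg d f"
  by (rule eq_matI) auto

lemma dg_one: "dg d (\<lambda>_. 1) = 1\<^sub>m d"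
  by (rule eq_matI) auto

lemma mult_dg_index:
  "A \<in> carrier_mat n d \<Longrightarrow> i < n \<Longrightarrow> j < d \<Longrightarrow> (A * dg d f) $$ (i, j) = A $$ (i, j) * complex_of_real (f j)"
  by (simp add: mult_mat_index[of _ n d _ d] if_distrib[of "\<lambda>x. _ * x"] sum.delta' del: index_mult_mat cong: if_cong)

lemma dg_mult_index:
  "A \<in> carrier_mat d n \<Longrightarrow> i < d \<Longrightarrow> j < n \<Longrightarrow> (dg d f * A) $$ (i, j) = complex_of_real (f i) * A $$ (i, j)"
  by (simp add: mult_mat_index[of _ d d _ n] if_distrib[of "\<lambda>x. x * _"] sum.delta del: index_mult_mat cong: if_cong)

lemma dg_mult_dg: "dg d f * dg d g = dg d (\<lambda>i. f i * g i)"
  by (rule eq_matI) (auto simp: mult_dg_index[of _ d] simp del: index_mult_mat(1))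

lemma dg_minus: "dg d f - dg d g = dg d (\<lambda>i. f i - g i)"
  by (rule eq_matI) auto

lemma dg_smult: "complex_of_real c \<cdot>\<^sub>m dg d f = dg d (\<lambda>i. c * f i)"
  by (rule eq_matI) auto

lemma mtrace_dg: "mtrace (dg d f) = complex_of_real (\<Sum>i<d. f i)"
  by (simp add: mtrace_def)

lemma mtrace_dg_mult: "A \<in> carrier_mat d d \<Longrightarrow> mtrace (dg d f * A) = (\<Sum>i<d. complex_of_real (f i) * A $$ (i, i))"
  by (simp add: mtrace_def dg_mult_index[of _ d d] del: index_mult_mat(1))

section \<open>Unitary matrices and spectral decompositions\<close>

lemma unitary_carrier [simp]: "unitary d U \<Longrightarrow> U \<in> carrier_mat d d"
  by (simp add: unitary_def)

lemma unitary_adj: "unitary d U \<Longrightarrow> unitary d (adj U)"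
  by (simp add: unitary_def)

lemma unitary_one: "unitary d (1\<^sub>m d)"
  by (simp add: unitary_def)

lemma unitary_cancel_left:
  assumes "unitary d U" "A \<in> carrier_mat d d"
  shows "U * (adj U * A) = A" "adj U * (U * A) = A"
  using assms by (simp_all add: unitary_def flip: assoc_mult_mat[of _ d d _ d _ d])

lemma unitary_mult: "unitary d U \<Longrightarrow> unitary d V \<Longrightarrow> unitary d (U * V)"
  unfolding unitary_def
  by (auto simp: adj_mult[of _ d d _ d] assoc_mult_mat[of _ d d _ d _ d] mult_carrier_sq[of _ d])
     (simp_all add: unitary_cancel_left unitary_def adj_mult[of _ d d _ d] flip: assoc_mult_mat[of _ d d _ d _ d])

text \<open>Eigenbasis and eigenvalue function are separate arguments, so that products, differences
  and traces of matrices diagonal in one basis become pointwise identities. The eigenvalues may come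
  in any order and with repetitions.\<close>

definition spec :: "nat \<Rightarrow> complex mat \<Rightarrow> (nat \<Rightarrow> real) \<Rightarrow> complex mat" where
  "spec d U f = U * dg d f * adj U"

lemma spec_carrier [simp, intro]: "unitary d U \<Longrightarrow> spec d U f \<in> carrier_mat d d"
  by (simp add: spec_def mult_carrier_sq[of _ d])

lemma adj_spec: "unitary d U \<Longrightarrow> adj (spec d U f) = spec d U f"
  by (simp add: spec_def adj_mult[of _ d d _ d] assoc_mult_mat[of _ d d _ d _ d] mult_carrier_sq[of _ d])

lemma spec_cong: "(\<And>i. i < d \<Longrightarrow> f i = g i) \<Longrightarrow> spec d U f = spec d U g"
  unfolding spec_def by (simp cong: dg_cong)

lemma spec_mult:
  assumes "unitary d U" shows "spec d U f * spec d U g = spec d U (\<lambda>i. f i * g i)"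
  using assms by (simp add: spec_def assoc_sq[of _ d] mult_carrier_sq[of _ d] unitary_cancel_left flip: dg_mult_dg)

lemma spec_one: "unitary d U \<Longrightarrow> spec d U (\<lambda>_. 1) = 1\<^sub>m d"
  unfolding spec_def dg_one by (simp add: unitary_def right_mult_one_mat[of _ d d])

lemma spec_minus:
  assumes "unitary d U" shows "spec d U f - spec d U g = spec d U (\<lambda>i. f i - g i)"
  using assms unfolding spec_def dg_minus[symmetric]
  by (simp add: minus_mult_distrib_mat[of _ d d _ _ d] mult_minus_distrib_mat[of _ d d _ d]
     mult_carrier_sq[of _ d])

lemma spec_smult:
  assumes "unitary d U" shows "complex_of_real c \<cdot>\<^sub>m spec d U f = spec d U (\<lambda>i. c * f i)"
  using assms unfolding spec_def dg_smult[symmetric]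
  by (simp add: mult_smult_distrib[of _ d d _ d] mult_smult_assoc_mat[of _ d d _ d] mult_carrier_sq[of _ d])

lemma mtrace_spec_mult:
  assumes "unitary d U" "T \<in> carrier_mat d d"
  shows "mtrace (spec d U f * T) = (\<Sum>i<d. complex_of_real (f i) * ip (col U i) (T *\<^sub>v col U i))"
proof -
  have c: "U \<in> carrier_mat d d" using assms by simp
  have "mtrace (spec d U f * T) = mtrace (U * (dg d f * (adj U * T)))"
    using assms by (simp add: spec_def assoc_sq[of _ d] mult_carrier_sq[of _ d])
  also have "\<dots> = mtrace (dg d f * (adj U * T) * U)"
    using assms by (intro mtrace_comm[of _ d d]) (simp_all add: mult_carrier_sq[of _ d])
  also have "\<dots> = mtrace (dg d f * (adj U * (T * U)))"
    using assms by (simp add: assoc_sq[of _ d] mult_carrier_sq[of _ d])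
  also have "\<dots> = (\<Sum>i<d. complex_of_real (f i) * (adj U * (T * U)) $$ (i, i))"
    using assms c by (intro mtrace_dg_mult) (simp add: mult_carrier_sq[of _ d])
  also have "\<dots> = (\<Sum>i<d. complex_of_real (f i) * ip (col U i) (T *\<^sub>v col U i))"
  proof (intro sum.cong refl arg_cong[of _ _ "\<lambda>z. _ * z"])
    fix i assume "i \<in> {..<d}"
    then show "(adj U * (T * U)) $$ (i, i) = ip (col U i) (T *\<^sub>v col U i)"
      using c assms(2) by (simp add: mult_mat_index[of "adj U" d d _ d] mult_mat_index[of T d d _ d]
         mult_mat_vec_nth[of T d d] ip_def del: index_mult_mat index_mult_mat_vec)
  qed
  finally show ?thesis .
qed

lemma mtrace_spec: "unitary d U \<Longrightarrow> mtrace (spec d U f) = complex_of_real (\<Sum>i<d. f i)"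
  unfolding spec_def
  by (subst mtrace_comm[of _ d d]) (auto simp: mult_carrier_sq[of _ d] unitary_cancel_left mtrace_dg)

text \<open>With \<open>B\<close> the identity this shows that \<open>matfun\<close> does not depend on the chosen decomposition; with \<open>U = V\<close> it
  shows that a matrix commuting with \<open>spec d U f\<close> commutes with every function of it.\<close>

lemma spec_intertwine:
  assumes U: "unitary d U" and V: "unitary d V" and B: "B \<in> carrier_mat d d"
    and eq: "spec d U f * B = B * spec d V g"
  shows "spec d U (\<lambda>i. h (f i)) * B = B * spec d V (\<lambda>i. h (g i))"
proof -
  define W where "W = adj U * B * V"
  have W: "W \<in> carrier_mat d d" using U V B by (simp add: W_def mult_carrier_sq[of _ d])
  have B_eq: "B = U * W * adj V"
    using U V B unfolding W_def
    by (simp add: assoc_sq[of _ d] mult_carrier_sq[of _ d] unitary_cancel_left)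
       (simp add: unitary_def)
  have 1: "spec d U f' * B = U * (dg d f' * W) * adj V" for f'
    using U V W by (simp add: B_eq spec_def assoc_sq[of _ d] mult_carrier_sq[of _ d] unitary_cancel_left)
  have 2: "B * spec d V f' = U * (W * dg d f') * adj V" for f'
    using U V W by (simp add: B_eq spec_def assoc_sq[of _ d] mult_carrier_sq[of _ d] unitary_cancel_left)
  have inj: "X = Y" if "U * X * adj V = U * Y * adj V" "X \<in> carrier_mat d d" "Y \<in> carrier_mat d d" for X Y
  proof -
    have "adj U * (U * X * adj V) * V = X" if "X \<in> carrier_mat d d" for X
      using U V that by (simp add: assoc_sq[of _ d] mult_carrier_sq[of _ d] unitary_cancel_left)
         (simp add: unitary_def)
    then show ?thesis using that by metis
  qed
  have "dg d f * W = W * dg d g"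
    using inj[OF eq[unfolded 1 2]] W by (simp add: mult_carrier_sq[of _ d])
  then have e: "complex_of_real (f i) * W $$ (i, j) = W $$ (i, j) * complex_of_real (g j)" if "i < d" "j < d" for i j
    using that W dg_mult_index[of W d d i j f] mult_dg_index[of W d d i j g] by simp
  have "dg d (\<lambda>i. h (f i)) * W = W * dg d (\<lambda>i. h (g i))"
  proof (rule eq_matI)
    fix i j assume "i < dim_row (W * dg d (\<lambda>i. h (g i)))" "j < dim_col (W * dg d (\<lambda>i. h (g i)))"
    then have ij: "i < d" "j < d" using W by auto
    \<comment> \<open>Entrywise the relation reads (f i - g j) W_ij = 0, so a nonzero entry of
      \<open>W\<close> forces equal eigenvalues, and then \<open>h\<close> takes equal values as
      well.\<close>
    have "f i = g j \<or> W $$ (i, j) = 0" using e[OF ij] by auto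
    then show "(dg d (\<lambda>i. h (f i)) * W) $$ (i, j) = (W * dg d (\<lambda>i. h (g i))) $$ (i, j)"
      using ij W by (auto simp: dg_mult_index[of W d d] mult_dg_index[of W d d] simp del: index_mult_mat(1))
  qed (use W in auto)
  then show ?thesis unfolding 1 2 by simp
qed

text \<open>Evaluates the Hilbert choice in \<open>matfun\<close>: the given decomposition is a
  witness, and any other one leads to the same matrix by \<open>spec_intertwine\<close> with the
  identity as intertwiner.\<close>

lemma matfun_spec:
  assumes U: "unitary d U"
  shows "matfun g d (spec d U f) = spec d U (\<lambda>i. g (f i))"
  unfolding matfun_def
proof (rule some_equality)
  show "\<exists>U' D. unitary d U' \<and> D \<in> carrier_mat d d \<and> diagonal_mat D \<and> (\<forall>i<d. Im (D $$ (i, i)) = 0)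
      \<and> spec d U f = U' * D * adj U' \<and> spec d U (\<lambda>i. g (f i)) =
      U' * mat d d (\<lambda>(i, j). if i = j then complex_of_real (g (Re (D $$ (i, i)))) else 0) * adj U'"
    by (rule exI[of _ U], rule exI[of _ "dg d f"])
       (use U in \<open>auto simp: diagonal_mat_def spec_def dg_def intro!: arg_cong[of _ _ "\<lambda>x. U * x * _"] eq_matI\<close>)
next
  fix F assume "\<exists>V D. unitary d V \<and> D \<in> carrier_mat d d \<and> diagonal_mat D \<and> (\<forall>i<d. Im (D $$ (i, i)) = 0)
      \<and> spec d U f = V * D * adj V \<and> F =
      V * mat d d (\<lambda>(i, j). if i = j then complex_of_real (g (Re (D $$ (i, i)))) else 0) * adj V"
  then obtain V D where V: "unitary d V" and D: "D \<in> carrier_mat d d" "diagonal_mat D" "\<And>i. i < d \<Longrightarrow> Im (D $$ (i, i)) = 0"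
    and eq: "spec d U f = V * D * adj V" and
    F: "F = V * mat d d (\<lambda>(i, j). if i = j then complex_of_real (g (Re (D $$ (i, i)))) else 0) * adj V"
    by blast
  define f' where "f' i = Re (D $$ (i, i))" for i
  have "D = dg d f'"
    using D by (intro eq_matI) (auto simp: diagonal_mat_def f'_def complex_eq_iff)
  then have eq': "spec d U f = spec d V f'" using eq by (simp add: spec_def)
  have F': "F = spec d V (\<lambda>i. g (f' i))" unfolding F spec_def dg_def f'_def by simp
  have "spec d V (\<lambda>i. g (f' i)) * 1\<^sub>m d = 1\<^sub>m d * spec d U (\<lambda>i. g (f i))"
    by (rule spec_intertwine) (use U V eq' in \<open>simp_all add: left_mult_one_mat[of _ d d] right_mult_one_mat[of _ d d]\<close>)
  then show "F = spec d U (\<lambda>i. g (f i))" using U V unfolding F'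
    by (simp add: left_mult_one_mat[of _ d d] right_mult_one_mat[of _ d d])
qed

lemma spec_index:
  assumes "unitary d U" "i < d" "j < d"
  shows "spec d U f $$ (i, j) = (\<Sum>k<d. U $$ (i, k) * complex_of_real (f k) * cnj (U $$ (j, k)))"
proof -
  have c: "U \<in> carrier_mat d d" using assms by simp
  have "spec d U f $$ (i, j) = (\<Sum>k<d. (U * dg d f) $$ (i, k) * adj U $$ (k, j))"
    unfolding spec_def using assms c by (intro mult_mat_index) (auto intro: mult_carrier_sq)
  then show ?thesis using assms c by (simp add: mult_dg_index[of U d d] del: index_mult_mat(1))
qed

section \<open>Householder reflections and the spectral theorem\<close>

lemma unitaryI_right:
  assumes "U \<in> carrier_mat d d" "\<And>i j. i < d \<Longrightarrow> j < d \<Longrightarrow> (\<Sum>k<d. U $$ (i, k) * cnj (U $$ (j, k))) = (if i = j then 1 else 0)"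
  shows "unitary d U"
proof -
  have "U * adj U = 1\<^sub>m d"
    using assms by (intro eq_matI) (auto simp: mult_mat_index[of U d d _ d] simp del: index_mult_mat(1))
  then show ?thesis using assms(1) mat_mult_left_right_inverse[of U d "adj U"] unfolding unitary_def by simp
qed

lemma unitary_rows:
  assumes "unitary d U" "i < d" "j < d"
  shows "(\<Sum>k<d. U $$ (i, k) * cnj (U $$ (j, k))) = (if i = j then 1 else 0)"
proof -
  have c: "U \<in> carrier_mat d d" using assms by simp
  have "(U * adj U) $$ (i, j) = (1\<^sub>m d :: complex mat) $$ (i, j)" using assms by (simp add: unitary_def)
  then show ?thesis using assms c by (simp add: mult_mat_index[of U d d _ d] del: index_mult_mat(1))
qed

text \<open>The reflection 1 - 2 w w^* / |w|^2 with w = v - e_0 takes e_0 to the unit vector v when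
  their inner product is real; this is the purpose of the assumption on
  \<open>v $ 0\<close>.\<close>

lemma householder:
  assumes v: "v \<in> carrier_vec (Suc n)" "nsq v = 1" "Im (v $ 0) = 0"
  shows "\<exists>H. unitary (Suc n) H \<and> adj H = H \<and> col H 0 = v"
proof (cases "v = unit_vec (Suc n) 0")
  case True
  then show ?thesis by (intro exI[of _ "1\<^sub>m (Suc n)"]) (auto simp: unitary_one)
next
  case False
  define w where "w = v - unit_vec (Suc n) 0"
  have w: "w \<in> carrier_vec (Suc n)" using v by (simp add: w_def)
  have w_idx: "w $ i = v $ i - (if i = 0 then 1 else 0)" if "i < Suc n" for i
    using v that by (simp add: w_def)
  have "w \<noteq> 0\<^sub>v (Suc n)"
  proof
    assume "w = 0\<^sub>v (Suc n)"
    then have "v $ i = unit_vec (Suc n) 0 $ i" if "i < Suc n" for i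
      using that w_idx[OF that] by auto
    then show False using False v by (auto intro: eq_vecI)
  qed
  then have pos: "nsq w > 0" using nsq_eq_0[OF w] nsq_nonneg[of w] by linarith
  define S where "S = (\<Sum>k<Suc n. cnj (w $ k) * w $ k)"
  have S: "S = complex_of_real (nsq w)" using w ip_self[of w] by (simp add: S_def ip_def del: sum.lessThan_Suc)
  have v00: "v $ 0 = complex_of_real (Re (v $ 0))" using v by (simp add: complex_eq_iff)
  \<comment> \<open>From |v| = 1. As \<open>v $ 0\<close> is real, this equals 2 (1 - v_0), so c
    (v_0 - 1) = -1 and H e_0 = e_0 + w = v.\<close>
  have "nsq w = 2 - 2 * Re (v $ 0)"
  proof -
    have "nsq w = (cmod (v $ 0 - 1))\<^sup>2 + (\<Sum>k<n. (cmod (v $ Suc k))\<^sup>2)"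
      using w w_idx by (simp add: nsq_def sum.lessThan_Suc_shift del: sum.lessThan_Suc)
    moreover have "nsq v = (cmod (v $ 0))\<^sup>2 + (\<Sum>k<n. (cmod (v $ Suc k))\<^sup>2)"
      using v by (simp add: nsq_def sum.lessThan_Suc_shift del: sum.lessThan_Suc)
    moreover have "(cmod (v $ 0 - 1))\<^sup>2 = (cmod (v $ 0))\<^sup>2 - 2 * Re (v $ 0) + 1"
      unfolding cmod_power2 by (simp add: power2_eq_square algebra_simps)
    ultimately show ?thesis using v by simp
  qed
  then have nw: "complex_of_real (nsq w) = 2 - 2 * v $ 0" using v00
    by (metis (no_types, lifting) of_real_diff of_real_mult of_real_numeral)
  define c where "c = 2 / complex_of_real (nsq w)"
  have cS: "c * S = 2" using pos by (simp add: c_def S)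
  have cc: "cnj c = c" by (simp add: c_def)
  define H where "H = mat (Suc n) (Suc n) (\<lambda>(i, j). (if i = j then 1 else 0) - c * w $ i * cnj (w $ j))"
  have H: "H \<in> carrier_mat (Suc n) (Suc n)" by (simp add: H_def)
  have Hi: "H $$ (i, j) = (if i = j then 1 else 0) - c * w $ i * cnj (w $ j)" if "i < Suc n" "j < Suc n" for i j
    using that by (simp add: H_def)
  have adjH: "adj H = H" by (rule eq_matI) (auto simp: H_def cc mult_ac)
  have "unitary (Suc n) H"
  proof (rule unitaryI_right[OF H])
    fix i j assume ij: "i < Suc n" "j < Suc n"
    have "(\<Sum>k<Suc n. H $$ (i, k) * cnj (H $$ (j, k))) =
      (\<Sum>k<Suc n. (if i = k then (if j = k then 1 else 0) else 0) - (if i = k then c * w $ k * cnj (w $ j) else 0)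
        - (if j = k then c * w $ i * cnj (w $ k) else 0) + c * c * w $ i * cnj (w $ j) * (cnj (w $ k) * w $ k))"
      using ij by (intro sum.cong refl) (auto simp: Hi cc algebra_simps)
    also have "\<dots> = (if i = j then 1 else 0) - c * w $ i * cnj (w $ j) - c * w $ i * cnj (w $ j)
        + c * c * w $ i * cnj (w $ j) * S"
      using ij unfolding sum.distrib sum_subtractf S_def sum_distrib_left[symmetric]
      by (simp add: sum.delta del: sum.lessThan_Suc)
    also have "c * c * w $ i * cnj (w $ j) * S = (c * S) * c * w $ i * cnj (w $ j)" by (simp add: mult_ac)
    finally show "(\<Sum>k<Suc n. H $$ (i, k) * cnj (H $$ (j, k))) = (if i = j then 1 else 0)"
      by (simp add: cS)
  qed
  moreover have "col H 0 = v"
  proof (rule eq_vecI)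
    fix i assume "i < dim_vec v"
    then have i: "i < Suc n" using v by simp
    have "c * cnj (w $ 0) = - 1"
      using w_idx[of 0] v pos nw v00 by (auto simp: c_def field_simps complex_eq_iff)
    then have "c * w $ i * cnj (w $ 0) = - (w $ i)" by (metis mult.commute mult.assoc mult_minus1)
    then show "col H 0 $ i = v $ i" using i H by (simp add: Hi w_idx)
  qed (use v H in auto)
  ultimately show ?thesis using adjH by blast
qed

lemma hermitian_index: "hermitian d A \<Longrightarrow> i < d \<Longrightarrow> j < d \<Longrightarrow> cnj (A $$ (i, j)) = A $$ (j, i)"
  unfolding hermitian_def by (metis adj_index carrier_matD)

lemma hermitianI: "A \<in> carrier_mat d d \<Longrightarrow> (\<And>i j. i < d \<Longrightarrow> j < d \<Longrightarrow> cnj (A $$ (j, i)) = A $$ (i, j)) \<Longrightarrow> hermitian d A"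
  unfolding hermitian_def by (auto intro!: eq_matI)

lemma hermitian_sandwich:
  assumes "hermitian d A" "X \<in> carrier_mat d m"
  shows "hermitian m (adj X * A * X)"
proof -
  have A: "A \<in> carrier_mat d d" "adj A = A" using assms unfolding hermitian_def by auto
  have "adj (adj X * A * X) = adj X * (adj A * adj (adj X))"
  proof -
    have "adj (adj X * A * X) = adj X * adj (adj X * A)"
      by (rule adj_mult[of _ m d _ m]) (use A(1) assms(2) in auto)
    also have "adj (adj X * A) = adj A * adj (adj X)"
      by (rule adj_mult[of _ m d _ d]) (use A(1) assms(2) in auto)
    finally show ?thesis .
  qed
  moreover have "adj X * A * X \<in> carrier_mat m m"
    by (rule mult_carrier_mat[of _ m d]) (use A assms(2) in auto)
  ultimately show ?thesis using A assms(2) unfolding hermitian_def by (simp add: assoc_mult_mat[of _ m d _ d _ m])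
qed

text \<open>Deflation: a Householder unitary moves a unit eigenvector to the first basis vector;
  hermiticity then clears the first row along with the first column, and the induction hypothesis
  diagonalises the remaining block.\<close>

theorem spectral_theorem:
  "hermitian d A \<Longrightarrow> \<exists>U f. unitary d U \<and> A = spec d U f"
proof (induction d arbitrary: A)
  case 0
  then show ?case by (intro exI[of _ "1\<^sub>m 0"] exI[of _ "\<lambda>_. 0"]) (auto simp: unitary_one spec_def hermitian_def intro!: eq_matI)
next
  case (Suc n)
  let ?d = "Suc n"
  have A: "A \<in> carrier_mat ?d ?d" and adjA: "adj A = A" using Suc.prems by (auto simp: hermitian_def)
  obtain k where "eigenvalue A k" using spectrum_non_empty[OF A] by (auto simp: spectrum_def)
  then obtain v0 where v0: "v0 \<in> carrier_vec ?d" "v0 \<noteq> 0\<^sub>v ?d" "A *\<^sub>v v0 = k \<cdot>\<^sub>v v0"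
    using A by (auto simp: eigenvalue_def eigenvector_def)
  have pos: "nsq v0 > 0" using nsq_eq_0[OF v0(1)] nsq_nonneg[of v0] v0(2) by linarith
  \<comment> \<open>A phase that turns the first coordinate of the eigenvector into its modulus, as
    \<open>householder\<close> requires a real one; a zero coordinate is left alone.\<close>
  define ph where "ph = (if v0 $ 0 = 0 then 1 else cnj (v0 $ 0) / complex_of_real (cmod (v0 $ 0)))"
  define v where "v = (ph / complex_of_real (sqrt (nsq v0))) \<cdot>\<^sub>v v0"
  have ph: "cmod ph = 1" by (simp add: ph_def norm_divide)
  have v: "v \<in> carrier_vec ?d" using v0 by (simp add: v_def)
  have nv: "nsq v = 1"
    using pos v0 unfolding nsq_def v_def
    by (simp add: norm_mult norm_divide ph power_mult_distrib power_divide flip: sum_divide_distrib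
        del: sum.lessThan_Suc)
  have "ph * v0 $ 0 = complex_of_real (cmod (v0 $ 0))"
    by (auto simp: ph_def mult.commute complex_norm_square[symmetric] power2_eq_square)
  then have "v $ 0 = complex_of_real (cmod (v0 $ 0) / sqrt (nsq v0))"
    using v0 by (simp add: v_def)
  then have im: "Im (v $ 0) = 0" by simp
  have Av: "A *\<^sub>v v = k \<cdot>\<^sub>v v" unfolding v_def using A v0
    by (simp add: mult_mat_vec smult_smult_assoc mult.commute)
  obtain H where H: "unitary ?d H" "adj H = H" "col H 0 = v" using householder[OF v nv im] by blast
  have Hc: "H \<in> carrier_mat ?d ?d" using H by simp
  define B where "B = adj H * A * H"
  have hB: "hermitian ?d B" unfolding B_def by (rule hermitian_sandwich[OF Suc.prems Hc])
  have B: "B \<in> carrier_mat ?d ?d" using hB by (simp add: hermitian_def)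
  have HH: "H * H = 1\<^sub>m ?d" using H unfolding unitary_def by simp
  have A_eq: "A = H * B * adj H"
    using H A Hc unfolding B_def by (simp add: assoc_sq[of _ ?d] mult_carrier_sq[of _ ?d] HH)
       (simp add: HH flip: assoc_mult_mat[of _ ?d ?d _ ?d _ ?d])
  have "col B 0 = k \<cdot>\<^sub>v unit_vec ?d 0"
  proof -
    have "col B 0 = adj H *\<^sub>v (A *\<^sub>v col H 0)"
      unfolding B_def using A Hc by (simp add: assoc_sq[of _ ?d] col_mult2[of _ ?d ?d _ ?d] mult_carrier_sq[of _ ?d])
    also have "\<dots> = k \<cdot>\<^sub>v (adj H *\<^sub>v col H 0)" using H Av v by (simp add: mult_mat_vec[of _ ?d ?d])
    also have "adj H *\<^sub>v col H 0 = col (adj H * H) 0" using Hc by (simp add: col_mult2[of _ ?d ?d _ ?d])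
    also have "\<dots> = unit_vec ?d 0" using HH H by simp
    finally show ?thesis .
  qed
  then have col0: "B $$ (i, 0) = (if i = 0 then k else 0)" if "i < ?d" for i
    using that B index_col[of i B 0] by (auto simp del: index_col)
  have row0: "B $$ (0, i) = (if i = 0 then k else 0)" if "i < ?d" for i
    using that hermitian_index[OF hB that, of 0] col0[of i] col0[of 0] hermitian_index[OF hB, of 0 0]
    by (auto split: if_splits)
  have k: "k = complex_of_real (Re k)"
    using hermitian_index[OF hB, of 0 0] col0[of 0] by (simp add: complex_eq_iff)
  define A' where "A' = mat n n (\<lambda>(i, j). B $$ (Suc i, Suc j))"
  have "hermitian n A'" using hermitian_index[OF hB] by (intro hermitianI) (auto simp: A'_def)
  from Suc.IH[OF this] obtain U' f' where U': "unitary n U'" and A': "A' = spec n U' f'" by blast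
  define W where "W = mat ?d ?d (\<lambda>(i, j). if i = 0 \<or> j = 0 then (if i = j then 1 else 0) else U' $$ (i - 1, j - 1))"
  define f where "f = case_nat (Re k) f'"
  have W: "W \<in> carrier_mat ?d ?d" by (simp add: W_def)
  have Wi: "W $$ (0, 0) = 1" "\<And>j. j < n \<Longrightarrow> W $$ (0, Suc j) = 0" "\<And>i. i < n \<Longrightarrow> W $$ (Suc i, 0) = 0"
    "\<And>i j. i < n \<Longrightarrow> j < n \<Longrightarrow> W $$ (Suc i, Suc j) = U' $$ (i, j)" by (auto simp: W_def)
  have uW: "unitary ?d W"
  proof (rule unitaryI_right[OF W])
    fix i j assume "i < ?d" "j < ?d"
    then show "(\<Sum>k<?d. W $$ (i, k) * cnj (W $$ (j, k))) = (if i = j then 1 else 0)"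
      using unitary_rows[OF U']
      by (cases i; cases j) (simp_all add: sum.lessThan_Suc_shift Wi del: sum.lessThan_Suc)
  qed
  have "B = spec ?d W f"
  proof (rule eq_matI)
    fix i j assume "i < dim_row (spec ?d W f)" "j < dim_col (spec ?d W f)"
    then have ij: "i < ?d" "j < ?d" using spec_carrier[OF uW, of f] by auto
    have "B $$ (Suc i', Suc j') = spec n U' f' $$ (i', j')" if "i' < n" "j' < n" for i' j'
        using that unfolding A'[symmetric] by (simp add: A'_def)
    then show "B $$ (i, j) = spec ?d W f $$ (i, j)"
      using ij k unfolding spec_index[OF uW ij]
      by (cases i; cases j) (simp_all add: sum.lessThan_Suc_shift Wi f_def col0 row0 spec_index[OF U'] del: sum.lessThan_Suc)
  qed (use B spec_carrier[OF uW, of f] in auto)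
  then have "A = spec ?d (H * W) f"
    using A_eq H uW unfolding spec_def
    by (simp add: adj_mult[of _ ?d ?d _ ?d] assoc_sq[of _ ?d] mult_carrier_sq[of _ ?d])
  moreover have "unitary ?d (H * W)" by (rule unitary_mult[OF H(1) uW])
  ultimately show ?case by blast
qed

section \<open>Positive semidefinite matrices\<close>

lemma hermitian_one: "hermitian d (1\<^sub>m d)" unfolding hermitian_def by auto

lemma psd_def_ip:
  "psd d A \<longleftrightarrow> hermitian d A \<and> (\<forall>v\<in>carrier_vec d. 0 \<le> Re (ip v (A *\<^sub>v v)))"
proof -
  have "ip v w = (\<Sum>i<d. cnj (v $ i) * w $ i)" if "v \<in> carrier_vec d" for v w
    using carrier_vecD[OF that] by (simp add: ip_def)
  then show ?thesis unfolding psd_def by (simp cong: ball_cong)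
qed

lemma psd_hermitian: "psd d A \<Longrightarrow> hermitian d A" by (simp add: psd_def)
lemma hermitian_carrier [simp]: "hermitian d A \<Longrightarrow> A \<in> carrier_mat d d" unfolding hermitian_def by blast
lemma hermitian_adj: "hermitian d A \<Longrightarrow> adj A = A" unfolding hermitian_def by blast
lemma psd_carrier [simp]: "psd d A \<Longrightarrow> A \<in> carrier_mat d d" by (rule hermitian_carrier[OF psd_hermitian])

lemma hermitian_spec: "unitary d U \<Longrightarrow> hermitian d (spec d U f)"
  unfolding hermitian_def by (auto simp: adj_spec)

lemma psd_sandwich:
  assumes "psd d A" "X \<in> carrier_mat d m"
  shows "psd m (adj X * A * X)"
  unfolding psd_def_ip
proof (intro conjI ballI)
  have A: "A \<in> carrier_mat d d" using assms by simp
  show "hermitian m (adj X * A * X)" using assms hermitian_sandwich psd_hermitian by blast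
  fix v :: "complex vec" assume v: "v \<in> carrier_vec m"
  have "ip v ((adj X * A * X) *\<^sub>v v) = ip v (adj X *\<^sub>v (A *\<^sub>v (X *\<^sub>v v)))"
    using v A assms(2) by (simp add: assoc_mult_mat_vec[of _ m d _ m] assoc_mult_mat_vec[of _ m d _ d] assoc_mult_mat_vec[of _ d d _ m]
      assoc_mult_mat[of _ m d _ d _ m])
  also have "\<dots> = ip (X *\<^sub>v v) (A *\<^sub>v (X *\<^sub>v v))"
    using v A assms(2) by (subst ip_mult_mat[of _ m d]) auto
  finally show "0 \<le> Re (ip v ((adj X * A * X) *\<^sub>v v))" using assms v unfolding psd_def_ip by auto
qed

lemma psd_one: "psd d (1\<^sub>m d)"
  unfolding psd_def_ip by (auto simp: ip_self hermitian_one)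

lemma psd_adj_mult: "X \<in> carrier_mat d m \<Longrightarrow> psd m (adj X * X)"
  using psd_sandwich[OF psd_one, of X d m] by (simp add: right_mult_one_mat[of _ m d])

lemma psd_mult_adj: "X \<in> carrier_mat d m \<Longrightarrow> psd d (X * adj X)"
  using psd_adj_mult[of "adj X" m d] by simp

lemma psd_add: "psd d A \<Longrightarrow> psd d B \<Longrightarrow> psd d (A + B)"
  unfolding psd_def_ip hermitian_def
  by (auto simp: adj_add[of _ d d] add_mult_distrib_mat_vec[of _ d d] ip_add_right[of _ d])

lemma smult_mat_vec: "A \<in> carrier_mat n m \<Longrightarrow> v \<in> carrier_vec m \<Longrightarrow> (c \<cdot>\<^sub>m A) *\<^sub>v v = c \<cdot>\<^sub>v (A *\<^sub>v v)"
  for c :: complex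
  by (rule eq_vecI) (auto simp: mult_mat_vec_nth[of _ n m] sum_distrib_left mult_ac simp del: index_mult_mat_vec)

lemma mult_vec_sq: "A \<in> carrier_mat d d \<Longrightarrow> v \<in> carrier_vec d \<Longrightarrow> A *\<^sub>v v \<in> carrier_vec d"
  by simp

lemma ip_spec:
  assumes "unitary d U" "v \<in> carrier_vec d"
  shows "ip v (spec d U f *\<^sub>v v) = complex_of_real (\<Sum>i<d. f i * (cmod (ip (col U i) v))\<^sup>2)"
proof -
  have c: "U \<in> carrier_mat d d" using assms by simp
  define w where "w = adj U *\<^sub>v v"
  have w: "w \<in> carrier_vec d" using assms c unfolding w_def by (intro mult_vec_sq) auto
  have wi: "w $ i = ip (col U i) v" if "i < d" for i
    using that c assms by (simp add: w_def mult_mat_vec_nth[of _ d d] ip_def carrier_matD[OF c] del: index_mult_mat_vec)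
  have "ip v (spec d U f *\<^sub>v v) = ip v (U *\<^sub>v (dg d f *\<^sub>v w))"
    unfolding spec_def assoc_mult_mat_vec[OF mult_carrier_sq[OF c dg_carrier] adj_carrier[OF c] assms(2)]
    unfolding w_def[symmetric] assoc_mult_mat_vec[OF c dg_carrier w] ..
  also have "\<dots> = ip w (dg d f *\<^sub>v w)"
    using assms ip_mult_mat[OF c assms(2) mult_vec_sq[OF dg_carrier w]] by (simp add: w_def)
  also have "\<dots> = (\<Sum>i<d. cnj (w $ i) * (complex_of_real (f i) * w $ i))"
    using w by (auto simp: ip_def mult_mat_vec_nth[of _ d d] if_distrib[of "\<lambda>x. x * _"] sum.delta
        simp del: index_mult_mat_vec cong: if_cong intro!: sum.cong)
  also have "\<dots> = complex_of_real (\<Sum>i<d. f i * (cmod (w $ i))\<^sup>2)"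
    unfolding of_real_sum of_real_mult complex_norm_square by (intro sum.cong refl) (simp add: mult_ac)
  finally show ?thesis using wi by simp
qed

lemma parseval: "unitary d U \<Longrightarrow> v \<in> carrier_vec d \<Longrightarrow> nsq v = (\<Sum>i<d. (cmod (ip (col U i) v))\<^sup>2)"
  using ip_spec[of d U v "\<lambda>_. 1"] by (simp add: spec_one ip_self flip: of_real_sum of_real_power)

lemma psd_spec: "unitary d U \<Longrightarrow> (\<And>i. i < d \<Longrightarrow> 0 \<le> f i) \<Longrightarrow> psd d (spec d U f)"
  unfolding psd_def_ip by (auto simp: ip_spec hermitian_spec intro!: sum_nonneg)

lemma unitary_col_ip:
  assumes "unitary d U" "i < d" "j < d"
  shows "ip (col U i) (col U j) = (if i = j then 1 else 0)"
proof -
  have c: "U \<in> carrier_mat d d" using assms by simp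
  have "(adj U * U) $$ (i, j) = (1\<^sub>m d :: complex mat) $$ (i, j)" using assms by (simp add: unitary_def)
  then show ?thesis using c assms
    by (simp add: mult_mat_index[of _ d d _ d] ip_def carrier_matD[OF c] del: index_mult_mat(1))
qed

lemma spec_mult_col:
  assumes "unitary d U" "i < d"
  shows "spec d U f *\<^sub>v col U i = complex_of_real (f i) \<cdot>\<^sub>v col U i"
proof -
  have c: "U \<in> carrier_mat d d" using assms by simp
  have "spec d U f * U = U * dg d f"
    using c assms by (simp add: spec_def assoc_sq[of _ d] mult_carrier_sq[of _ d])
      (simp add: unitary_def right_mult_one_mat[of _ d d])
  then have "spec d U f *\<^sub>v col U i = col (U * dg d f) i"
    using c assms by (simp flip: col_mult2[of _ d d _ d])
  also have "\<dots> = complex_of_real (f i) \<cdot>\<^sub>v col U i"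
    using carrier_matD[OF c] assms
    by (intro eq_vecI) (auto simp: mult_dg_index[OF c] mult.commute simp del: index_mult_mat(1))
  finally show ?thesis .
qed

theorem psd_spectral:
  assumes "psd d A"
  obtains U f where "unitary d U" "\<And>i. i < d \<Longrightarrow> 0 \<le> f i" "A = spec d U f"
proof -
  obtain U f where U: "unitary d U" and A: "A = spec d U f"
    using spectral_theorem psd_hermitian assms by blast
  have "0 \<le> f i" if i: "i < d" for i
  proof -
    have c: "col U i \<in> carrier_vec d" using U i by auto
    have "ip (col U i) (A *\<^sub>v col U i) = complex_of_real (f i)"
      using c U i by (simp add: A spec_mult_col ip_smult_right[of _ d] unitary_col_ip)
    then show ?thesis using assms c unfolding psd_def_ip by force
  qed
  then show ?thesis using that U A by blast
qed

lemma psd_trace_mult_nonneg: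
  assumes "psd d A" "psd d B"
  shows "0 \<le> Re (mtrace (A * B))"
proof -
  obtain U f where U: "unitary d U" "\<And>i. i < d \<Longrightarrow> 0 \<le> f i" "A = spec d U f"
    using psd_spectral[OF assms(1)] by blast
  have c: "col U i \<in> carrier_vec d" if "i < d" for i using U that by auto
  show ?thesis unfolding U(3) using U c assms(2)
    by (auto simp: mtrace_spec_mult psd_def_ip intro!: sum_nonneg mult_nonneg_nonneg)
qed

lemma psd_trace_mono:
  assumes "psd d (B - A)" "psd d T" "A \<in> carrier_mat d d" "B \<in> carrier_mat d d"
  shows "Re (mtrace (A * T)) \<le> Re (mtrace (B * T))"
  using psd_trace_mult_nonneg[OF assms(1,2)] assms
  by (simp add: minus_mult_distrib_mat[of _ d d _ _ d] mtrace_minus[of _ d] mult_carrier_sq[of _ d])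

lemma psd_factor:
  assumes "psd d A" obtains X where "X \<in> carrier_mat d d" "A = X * adj X"
proof -
  obtain U f where U: "unitary d U" "\<And>i. i < d \<Longrightarrow> 0 \<le> f i" "A = spec d U f"
    using psd_spectral[OF assms(1)] by blast
  let ?X = "spec d U (\<lambda>i. sqrt (f i))"
  have "A = ?X * adj ?X" unfolding adj_spec[OF U(1)] spec_mult[OF U(1)] U(3) using U(2) by (intro spec_cong) simp
  then show ?thesis using that U(1) spec_carrier by blast
qed

section \<open>Orthogonal projections\<close>

definition proj :: "nat \<Rightarrow> complex mat \<Rightarrow> bool" where
  "proj d P \<longleftrightarrow> hermitian d P \<and> P * P = P"

lemma proj_carrier [simp]: "proj d P \<Longrightarrow> P \<in> carrier_mat d d" by (simp add: proj_def)
lemma proj_adj: "proj d P \<Longrightarrow> adj P = P" unfolding proj_def using hermitian_adj by blast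

lemma proj_psd: "proj d P \<Longrightarrow> psd d P"
  using psd_adj_mult[of P d d] by (simp add: proj_adj) (simp add: proj_def)

lemma hermitian_minus: "hermitian d A \<Longrightarrow> hermitian d B \<Longrightarrow> hermitian d (A - B)"
  unfolding hermitian_def by (auto simp: adj_minus[of _ d d])


lemma proj_compl: assumes "proj d P" shows "proj d (1\<^sub>m d - P)"
proof -
  have c: "P \<in> carrier_mat d d" "P * P = P" using assms by (auto simp: proj_def)
  have "(1\<^sub>m d - P) * (1\<^sub>m d - P) = 1\<^sub>m d * (1\<^sub>m d - P) - P * (1\<^sub>m d - P)"
    using c(1) by (intro minus_mult_distrib_mat[of _ d d _ _ d]) auto
  also have "P * (1\<^sub>m d - P) = P - P"
    using c by (simp add: mult_minus_distrib_mat[of _ d d _ d] right_mult_one_mat[of _ d d])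
  also have "1\<^sub>m d * (1\<^sub>m d - P) - (P - P) = 1\<^sub>m d - P"
    using c(1) by (subst left_mult_one_mat[of _ d d]) (auto intro!: eq_matI)
  finally have "(1\<^sub>m d - P) * (1\<^sub>m d - P) = 1\<^sub>m d - P" .
  then show ?thesis using assms by (auto simp: proj_def intro!: hermitian_minus hermitian_one)
qed

lemma proj_spec:
  assumes "unitary d U" shows "proj d (spec d U (\<lambda>i. of_bool (Q i)))"
  using assms by (simp add: proj_def hermitian_spec spec_mult flip: of_bool_conj)

lemma test_op_proj: "proj d P \<Longrightarrow> test_op d P"
  by (simp add: test_op_def proj_psd proj_compl)

lemma proj_ip: "proj d P \<Longrightarrow> v \<in> carrier_vec d \<Longrightarrow> ip v (P *\<^sub>v v) = complex_of_real (nsq (P *\<^sub>v v))"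
proof -
  assume P: "proj d P" and v: "v \<in> carrier_vec d"
  then have "ip v (P *\<^sub>v v) = ip v (P *\<^sub>v (P *\<^sub>v v))"
    by (simp flip: assoc_mult_mat_vec[of _ d d _ d]) (simp add: proj_def)
  also have "\<dots> = ip (P *\<^sub>v v) (P *\<^sub>v v)" using P v mult_vec_sq[OF proj_carrier[OF P] v]
    by (subst ip_mult_mat[of P d d]) (auto simp: proj_adj)
  finally show ?thesis by (simp add: ip_self)
qed

section \<open>Kronecker products\<close>

lemma kron_dim [simp]: "dim_row (kron A B) = dim_row A * dim_row B" "dim_col (kron A B) = dim_col A * dim_col B"
  by (simp_all add: kron_def)

lemma kron_carrier [simp, intro]:
  "A \<in> carrier_mat m k \<Longrightarrow> B \<in> carrier_mat n l \<Longrightarrow> kron A B \<in> carrier_mat (m * n) (k * l)"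
  by (auto simp: kron_def)

lemma kron_index:
  "A \<in> carrier_mat m k \<Longrightarrow> B \<in> carrier_mat n l \<Longrightarrow> i < m * n \<Longrightarrow> j < k * l \<Longrightarrow>
    kron A B $$ (i, j) = A $$ (i div n, j div l) * B $$ (i mod n, j mod l)"
  by (auto simp: kron_def)

lemma kron_mult:
  assumes A: "A \<in> carrier_mat m k" and B: "B \<in> carrier_mat n l" and C: "C \<in> carrier_mat k p" and D: "D \<in> carrier_mat l q"
  shows "kron A B * kron C D = kron (A * C) (B * D)"
proof (rule eq_matI)
  have AC: "A * C \<in> carrier_mat m p" "B * D \<in> carrier_mat n q" using assms by auto
  fix i j assume "i < dim_row (kron (A * C) (B * D))" "j < dim_col (kron (A * C) (B * D))"
  then have ij: "i < m * n" "j < p * q" using assms by auto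
  have lts: "i div n < m" "i mod n < n" "j div q < p" "j mod q < q"
    using ij by (auto intro: div_mult_less mod_mult_less)
  have "(kron A B * kron C D) $$ (i, j) = (\<Sum>x<k * l. kron A B $$ (i, x) * kron C D $$ (x, j))"
    by (rule mult_mat_index[OF kron_carrier[OF A B] kron_carrier[OF C D] ij])
  also have "\<dots> = (\<Sum>a<k. \<Sum>b<l. kron A B $$ (i, a * l + b) * kron C D $$ (a * l + b, j))"
    by (rule sum_lessThan_mult)
  also have "\<dots> = (\<Sum>a<k. \<Sum>b<l. (A $$ (i div n, a) * C $$ (a, j div q)) * (B $$ (i mod n, b) * D $$ (b, j mod q)))"
    using ij by (intro sum.cong refl) (simp add: kron_index[OF A B] kron_index[OF C D] mult_add_less mult_ac)
  also have "\<dots> = (A * C) $$ (i div n, j div q) * (B * D) $$ (i mod n, j mod q)"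
    by (simp only: sum_product mult_mat_index[OF A C lts(1,3)] mult_mat_index[OF B D lts(2,4)])
  also have "\<dots> = kron (A * C) (B * D) $$ (i, j)" by (rule kron_index[OF AC ij, symmetric])
  finally show "(kron A B * kron C D) $$ (i, j) = kron (A * C) (B * D) $$ (i, j)" .
qed (use assms in auto)

lemma adj_kron: "adj (kron A B) = kron (adj A) (adj B)"
proof (rule eq_matI)
  fix i j assume "i < dim_row (kron (adj A) (adj B))" "j < dim_col (kron (adj A) (adj B))"
  then show "adj (kron A B) $$ (i, j) = kron (adj A) (adj B) $$ (i, j)"
    by (simp add: kron_def div_mult_less mod_mult_less)
qed auto

lemma kron_dg: "kron (dg m f) (dg n g) = dg (m * n) (\<lambda>i. f (i div n) * g (i mod n))"
proof (rule eq_matI)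
  fix i j assume "i < dim_row (dg (m * n) (\<lambda>i. f (i div n) * g (i mod n)))" "j < dim_col (dg (m * n) (\<lambda>i. f (i div n) * g (i mod n)))"
  then have ij: "i < m * n" "j < m * n" by auto
  have "i = j \<longleftrightarrow> i div n = j div n \<and> i mod n = j mod n" by (metis div_mult_mod_eq)
  then show "kron (dg m f) (dg n g) $$ (i, j) = dg (m * n) (\<lambda>i. f (i div n) * g (i mod n)) $$ (i, j)"
    using ij by (auto simp: kron_index[of _ m m _ n n] div_mult_less mod_mult_less)
qed auto

lemma kron_one: "kron (1\<^sub>m m) (1\<^sub>m n) = 1\<^sub>m (m * n)"
  using kron_dg[of m "\<lambda>_. 1" n "\<lambda>_. 1"] by (simp add: dg_one)

lemma unitary_kron: "unitary m U \<Longrightarrow> unitary n V \<Longrightarrow> unitary (m * n) (kron U V)"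
  unfolding unitary_def by (auto simp: adj_kron kron_mult[of _ m m _ n n _ m _ n] kron_one)

lemma kron_spec:
  assumes "unitary m U" "unitary n V"
  shows "kron (spec m U f) (spec n V g) = spec (m * n) (kron U V) (\<lambda>i. f (i div n) * g (i mod n))"
proof -
  have "spec (m * n) (kron U V) (\<lambda>i. f (i div n) * g (i mod n)) = kron U V * kron (dg m f) (dg n g) * kron (adj U) (adj V)"
    by (simp add: spec_def kron_dg adj_kron)
  also have "kron U V * kron (dg m f) (dg n g) = kron (U * dg m f) (V * dg n g)"
    by (rule kron_mult[of _ m m _ n n _ m _ n]) (use assms in auto)
  also have "\<dots> * kron (adj U) (adj V) = kron (U * dg m f * adj U) (V * dg n g * adj V)"
    by (rule kron_mult[of _ m m _ n n _ m _ n]) (use assms in \<open>auto simp: mult_carrier_sq\<close>)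
  finally show ?thesis by (simp add: spec_def)
qed

lemma mtrace_kron:
  assumes "A \<in> carrier_mat m m" "B \<in> carrier_mat n n"
  shows "mtrace (kron A B) = mtrace A * mtrace B"
proof -
  have "mtrace (kron A B) = (\<Sum>i<m * n. kron A B $$ (i, i))" using assms by (simp add: mtrace_def)
  also have "\<dots> = (\<Sum>a<m. \<Sum>b<n. A $$ (a, a) * B $$ (b, b))"
    unfolding sum_lessThan_mult
    by (intro sum.cong refl) (simp add: kron_index[OF assms] mult_add_less)
  also have "\<dots> = mtrace A * mtrace B" using assms by (simp add: mtrace_def sum_product)
  finally show ?thesis .
qed

lemma kron_minus_left:
  "A \<in> carrier_mat m m \<Longrightarrow> A' \<in> carrier_mat m m \<Longrightarrow> B \<in> carrier_mat n n \<Longrightarrow> kron (A - A') B = kron A B - kron A' B"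
  by (rule eq_matI) (auto simp: kron_def div_mult_less mod_mult_less algebra_simps)

lemma kron_minus_right:
  "A \<in> carrier_mat m m \<Longrightarrow> B' \<in> carrier_mat n n \<Longrightarrow> B \<in> carrier_mat n n \<Longrightarrow> kron A (B - B') = kron A B - kron A B'"
  by (rule eq_matI) (auto simp: kron_def div_mult_less mod_mult_less algebra_simps)

lemma kron_smult_left: "kron (c \<cdot>\<^sub>m A) B = c \<cdot>\<^sub>m kron A B"
  by (rule eq_matI) (auto simp: kron_def div_mult_less mod_mult_less)

lemma kron_smult_right: "kron A (c \<cdot>\<^sub>m B) = c \<cdot>\<^sub>m kron A B"
  by (rule eq_matI) (auto simp: kron_def div_mult_less mod_mult_less)

lemma psd_kron: assumes "psd m A" "psd n B" shows "psd (m * n) (kron A B)"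
proof -
  obtain X Y where X: "X \<in> carrier_mat m m" "A = X * adj X" and Y: "Y \<in> carrier_mat n n" "B = Y * adj Y"
    using psd_factor assms by metis
  have "kron A B = kron X Y * adj (kron X Y)"
    unfolding adj_kron X(2) Y(2) by (rule kron_mult[symmetric]) (use X Y in auto)
  then show ?thesis using psd_mult_adj[OF kron_carrier[OF X(1) Y(1)]] by simp
qed

text \<open>Telescoping: A' (x) B' - A (x) B = (A' - A) (x) B' + A (x) (B' - B), where B' is
  positive because it dominates B.\<close>

lemma psd_kron_mono:
  assumes "psd m A" "psd n B" "psd m (A' - A)" "psd n (B' - B)" "A' \<in> carrier_mat m m" "B' \<in> carrier_mat n n"
  shows "psd (m * n) (kron A' B' - kron A B)"
proof -
  have c: "A \<in> carrier_mat m m" "B \<in> carrier_mat n n" using assms by auto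
  have "B + (B' - B) = B'" using c(2) assms(6) by (intro eq_matI) auto
  then have B': "psd n B'" using psd_add[OF assms(2,4)] by simp
  have "kron A' B' - kron A B = kron (A' - A) B' + kron A (B' - B)"
    unfolding kron_minus_left[OF assms(5) c(1) assms(6)] kron_minus_right[OF c(1,2) assms(6)]
    using c assms(5,6) by (intro eq_matI) auto
  then show ?thesis using psd_add[OF psd_kron[OF assms(3) B'] psd_kron[OF assms(1,4)]] by simp
qed

lemma proj_kron: assumes "proj m P" "proj n Q" shows "proj (m * n) (kron P Q)"
proof -
  have c: "P \<in> carrier_mat m m" "Q \<in> carrier_mat n n" using assms by auto
  have "kron P Q * kron P Q = kron (P * P) (Q * Q)" by (rule kron_mult) (use c in auto)
  then show ?thesis using assms kron_carrier[OF c] unfolding proj_def hermitian_def by (auto simp: adj_kron)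
qed

section \<open>Tensor powers\<close>

lemma tpow_carrier [simp, intro]: "A \<in> carrier_mat d e \<Longrightarrow> tpow A n \<in> carrier_mat (d ^ n) (e ^ n)"
  by (induction n) auto

lemma tpow_mult:
  assumes "A \<in> carrier_mat m k" "B \<in> carrier_mat k l"
  shows "tpow A n * tpow B n = tpow (A * B) n"
proof (induction n)
  case (Suc n)
  have "tpow A (Suc n) * tpow B (Suc n) = kron (A * B) (tpow A n * tpow B n)"
    using kron_mult[OF assms(1) tpow_carrier[OF assms(1), of n] assms(2) tpow_carrier[OF assms(2), of n]] by simp
  then show ?case using Suc by simp
qed simp

lemma adj_tpow: "adj (tpow A n) = tpow (adj A) n"
  by (induction n) (auto simp: adj_kron)

lemma unitary_tpow: "unitary d U \<Longrightarrow> unitary (d ^ n) (tpow U n)"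
  by (induction n) (auto simp: unitary_kron unitary_one)

text \<open>Eigenvalues of a tensor power in the tensor power of an eigenbasis. The recursion
  follows \<open>tpow\<close> and splits off the most significant digit; \<open>pw_digit\<close> is
  the closed form.\<close>

fun pw :: "nat \<Rightarrow> (nat \<Rightarrow> real) \<Rightarrow> nat \<Rightarrow> nat \<Rightarrow> real" where
  "pw d f 0 i = 1"
| "pw d f (Suc n) i = f (i div d ^ n) * pw d f n (i mod d ^ n)"

lemma tpow_spec:
  assumes "unitary d U" shows "tpow (spec d U f) n = spec (d ^ n) (tpow U n) (pw d f n)"
proof (induction n)
  case 0
  have "dg 1 (pw d f 0) = 1\<^sub>m 1" by (rule eq_matI) auto
  then show ?case unfolding spec_def by simp
next
  case (Suc n)
  have "pw d f (Suc n) = (\<lambda>i. f (i div d ^ n) * pw d f n (i mod d ^ n))" by (rule ext) simp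
  then show ?case using assms kron_spec[OF assms unitary_tpow[OF assms]] by (simp add: Suc)
qed

lemma psd_tpow: "psd d A \<Longrightarrow> psd (d ^ n) (tpow A n)"
  by (induction n) (auto simp: psd_kron psd_one)


lemma density_tpow: assumes "density d \<rho>" shows "density (d ^ n) (tpow \<rho> n)"
proof -
  have c: "\<rho> \<in> carrier_mat d d" using assms by (simp add: density_def)
  have "mtrace (tpow \<rho> n) = 1"
  proof (induction n)
    case (Suc n)
    then show ?case using assms mtrace_kron[OF c tpow_carrier[OF c, of n]] by (simp add: density_def)
  qed (simp add: mtrace_def)
  then show ?thesis using assms psd_tpow by (simp add: density_def)
qed

section \<open>Digits\<close>

lemma digit_less: "0 < d \<Longrightarrow> digit d n k i < d"
  by (simp add: digit_def)

lemma digit_less': "i < d ^ n \<Longrightarrow> k < n \<Longrightarrow> digit d n k i < d"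
  by (rule digit_less) (cases "d = 0"; auto simp: power_0_left split: if_splits)

lemma digit_Suc_0: "i < d ^ Suc n \<Longrightarrow> digit d (Suc n) 0 i = i div d ^ n"
  by (simp add: digit_def div_mult_less)

text \<open>The first factor is the leading digit in base \<open>d\<close>, so all later digits only
  see the remainder modulo \<open>d ^ n\<close>.\<close>

lemma digit_Suc_Suc: "k < n \<Longrightarrow> digit d (Suc n) (Suc k) i = digit d n k (i mod d ^ n)"
proof -
  assume k: "k < n"
  define m where "m = d ^ (n - 1 - k)"
  have "n = (n - 1 - k) + Suc k" using k by simp
  then have dn: "d ^ n = m * d ^ Suc k" unfolding m_def by (metis power_add)
  have "i mod d ^ n div m = (i div m) mod (d ^ Suc k)"
  proof (cases "m = 0")
    case False
    then show ?thesis unfolding dn mod_mult2_eq by simp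
  qed (use dn in simp)
  then have "i mod d ^ n div m mod d = i div m mod d" by (simp add: mod_mod_cancel)
  then show ?thesis by (simp add: digit_def m_def)
qed

definition enc :: "nat \<Rightarrow> nat \<Rightarrow> (nat \<Rightarrow> nat) \<Rightarrow> nat" where
  "enc d n g = (\<Sum>k<n. g k * d ^ (n - 1 - k))"

lemma enc_0 [simp]: "enc d 0 g = 0" by (simp add: enc_def)

lemma enc_Suc: "enc d (Suc n) g = g 0 * d ^ n + enc d n (\<lambda>k. g (Suc k))"
  unfolding enc_def by (subst sum.lessThan_Suc_shift) simp

lemma enc_less: "(\<And>k. k < n \<Longrightarrow> g k < d) \<Longrightarrow> enc d n g < d ^ n"
  by (induction n arbitrary: g) (auto simp: enc_Suc intro!: mult_add_less)

lemma enc_cong: "(\<And>k. k < n \<Longrightarrow> g k = h k) \<Longrightarrow> enc d n g = enc d n h"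
  by (simp add: enc_def)

lemma enc_digit: "i < d ^ n \<Longrightarrow> enc d n (\<lambda>k. digit d n k i) = i"
proof (induction n arbitrary: i)
  case (Suc n)
  have lt: "i mod d ^ n < d ^ n" using Suc.prems by (intro mod_mult_less[of _ d]) simp
  have "enc d (Suc n) (\<lambda>k. digit d (Suc n) k i) = i div d ^ n * d ^ n + enc d n (\<lambda>k. digit d n k (i mod d ^ n))"
    unfolding enc_Suc digit_Suc_0[OF Suc.prems] by (simp add: digit_Suc_Suc cong: enc_cong)
  then show ?case unfolding Suc.IH[OF lt] by (simp only: div_mult_mod_eq)
qed simp

lemma digit_enc: "(\<And>k. k < n \<Longrightarrow> g k < d) \<Longrightarrow> k < n \<Longrightarrow> digit d n k (enc d n g) = g k"
proof (induction n arbitrary: g k)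
  case (Suc n)
  have lt: "enc d n (\<lambda>k. g (Suc k)) < d ^ n" using Suc.prems by (intro enc_less) auto
  show ?case
  proof (cases k)
    case 0
    have "enc d (Suc n) g < d ^ Suc n" using Suc.prems by (intro enc_less) auto
    moreover have "d ^ n > 0" using lt by (rule le_less_trans[OF le0])
    ultimately show ?thesis using lt unfolding 0
      by (subst digit_Suc_0) (auto simp: enc_Suc div_mult_self3 simp del: div_mult_self1)
  next
    case (Suc k')
    then show ?thesis using lt Suc.prems Suc.IH[of "\<lambda>k. g (Suc k)" k'] by (simp add: digit_Suc_Suc enc_Suc)
  qed
qed simp

lemma digit_eqI: "i < d ^ n \<Longrightarrow> j < d ^ n \<Longrightarrow> (\<And>k. k < n \<Longrightarrow> digit d n k i = digit d n k j) \<Longrightarrow> i = j"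
proof -
  assume i: "i < d ^ n" and j: "j < d ^ n" and eq: "\<And>k. k < n \<Longrightarrow> digit d n k i = digit d n k j"
  have "i = enc d n (\<lambda>k. digit d n k i)" by (rule enc_digit[OF i, symmetric])
  also have "\<dots> = enc d n (\<lambda>k. digit d n k j)" by (rule enc_cong) (rule eq)
  also have "\<dots> = j" by (rule enc_digit[OF j])
  finally show "i = j" .
qed

lemma bij_betw_enc: "bij_betw (enc d n) ({..<n} \<rightarrow>\<^sub>E {..<d}) {..<d ^ n}"
proof (rule bij_betw_byWitness[where f' = "\<lambda>i. restrict (\<lambda>k. digit d n k i) {..<n}"])
  show "\<forall>g\<in>{..<n} \<rightarrow>\<^sub>E {..<d}. restrict (\<lambda>k. digit d n k (enc d n g)) {..<n} = g"
  proof
    fix g assume g: "g \<in> {..<n} \<rightarrow>\<^sub>E {..<d}"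
    then have "g k < d" if "k < n" for k using that by auto
    then show "restrict (\<lambda>k. digit d n k (enc d n g)) {..<n} = g"
      using g by (auto simp: fun_eq_iff restrict_def digit_enc PiE_def extensional_def)
  qed
  show "\<forall>i\<in>{..<d ^ n}. enc d n (restrict (\<lambda>k. digit d n k i) {..<n}) = i"
    by (auto simp: enc_digit cong: enc_cong)
  show "enc d n ` ({..<n} \<rightarrow>\<^sub>E {..<d}) \<subseteq> {..<d ^ n}" by (auto intro!: enc_less)
  show "(\<lambda>i. restrict (\<lambda>k. digit d n k i) {..<n}) ` {..<d ^ n} \<subseteq> {..<n} \<rightarrow>\<^sub>E {..<d}"
    by (auto intro!: digit_less' simp: PiE_iff extensional_def restrict_def split: if_splits)
qed

text \<open>Digits identify indices with functions from factors to base indices; this is the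
  distributive law transported along that bijection.\<close>

lemma sum_prod_digit:
  fixes f :: "nat \<Rightarrow> nat \<Rightarrow> 'a::comm_semiring_1"
  shows "(\<Sum>i<d ^ n. \<Prod>k<n. f k (digit d n k i)) = (\<Prod>k<n. \<Sum>x<d. f k x)"
proof -
  have "(\<Prod>k<n. \<Sum>x<d. f k x) = (\<Sum>g\<in>{..<n} \<rightarrow>\<^sub>E {..<d}. \<Prod>k<n. f k (g k))"
    by (rule prod_sum_PiE) auto
  also have "\<dots> = (\<Sum>g\<in>{..<n} \<rightarrow>\<^sub>E {..<d}. \<Prod>k<n. f k (digit d n k (enc d n g)))"
    by (intro sum.cong refl prod.cong) (auto simp: digit_enc PiE_iff)
  also have "\<dots> = (\<Sum>i<d ^ n. \<Prod>k<n. f k (digit d n k i))"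
    by (rule sum.reindex_bij_betw[OF bij_betw_enc])
  finally show ?thesis by simp
qed

lemma tpow_index:
  assumes "A \<in> carrier_mat d e" "i < d ^ n" "j < e ^ n"
  shows "tpow A n $$ (i, j) = (\<Prod>k<n. A $$ (digit d n k i, digit e n k j))"
  using assms(2,3)
proof (induction n arbitrary: i j)
  case (Suc n)
  have lt: "i mod d ^ n < d ^ n" "j mod e ^ n < e ^ n"
    using Suc.prems by (auto intro: mod_mult_less[of _ d] mod_mult_less[of _ e])
  have "tpow A (Suc n) $$ (i, j) = A $$ (i div d ^ n, j div e ^ n) * tpow A n $$ (i mod d ^ n, j mod e ^ n)"
    using kron_index[OF assms(1) tpow_carrier[OF assms(1), of n]] Suc.prems by simp
  also have "\<dots> = (\<Prod>k<Suc n. A $$ (digit d (Suc n) k i, digit e (Suc n) k j))"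
    unfolding Suc.IH[OF lt] prod.lessThan_Suc_shift digit_Suc_0[OF Suc.prems(1)] digit_Suc_0[OF Suc.prems(2)]
    by (intro arg_cong2[of _ _ _ _ "(*)"] prod.cong refl) (simp add: digit_Suc_Suc)
  finally show ?case .
qed simp

lemma pw_digit: "i < d ^ n \<Longrightarrow> pw d f n i = (\<Prod>k<n. f (digit d n k i))"
proof (induction n arbitrary: i)
  case (Suc n)
  have lt: "i mod d ^ n < d ^ n" using Suc.prems by (intro mod_mult_less[of _ d]) simp
  show ?case unfolding pw.simps Suc.IH[OF lt] prod.lessThan_Suc_shift digit_Suc_0[OF Suc.prems]
    by (intro arg_cong2[of _ _ _ _ "(*)"] prod.cong refl) (simp add: digit_Suc_Suc)
qed simp

section \<open>Regrouping tensor factors\<close>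

lemma div_mult_add: "b < n \<Longrightarrow> (a * n + b) div n = (a :: nat)"
  by (metis div_mult_self3 div_less add.right_neutral add.commute not_less_zero)

definition idxA :: "nat \<Rightarrow> nat \<Rightarrow> nat \<Rightarrow> nat \<Rightarrow> nat" where
  "idxA dA dB n i = enc dA n (\<lambda>k. digit (dA * dB) n k i div dB)"

definition idxB :: "nat \<Rightarrow> nat \<Rightarrow> nat \<Rightarrow> nat \<Rightarrow> nat" where
  "idxB dA dB n i = enc dB n (\<lambda>k. digit (dA * dB) n k i mod dB)"

lemma reorder_idx_eq: "reorder_idx dA dB n i = idxA dA dB n i * dB ^ n + idxB dA dB n i"
  by (simp add: reorder_idx_def idxA_def idxB_def enc_def)

context
  fixes dA dB n i :: nat
  assumes i: "i < (dA * dB) ^ n"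
begin

lemma idxA_less: "idxA dA dB n i < dA ^ n"
  unfolding idxA_def using i by (intro enc_less div_mult_less digit_less')

lemma idxB_less: "idxB dA dB n i < dB ^ n"
  unfolding idxB_def using i by (intro enc_less mod_mult_less[of _ dA] digit_less')

lemma digit_idxA: "k < n \<Longrightarrow> digit dA n k (idxA dA dB n i) = digit (dA * dB) n k i div dB"
  unfolding idxA_def using i by (intro digit_enc div_mult_less digit_less')

lemma digit_idxB: "k < n \<Longrightarrow> digit dB n k (idxB dA dB n i) = digit (dA * dB) n k i mod dB"
  unfolding idxB_def using i by (intro digit_enc mod_mult_less[of _ dA] digit_less')

lemma reorder_idx_div: "reorder_idx dA dB n i div dB ^ n = idxA dA dB n i"
  using idxB_less by (simp add: reorder_idx_eq div_mult_add)

lemma reorder_idx_mod: "reorder_idx dA dB n i mod dB ^ n = idxB dA dB n i"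
  using idxB_less by (simp add: reorder_idx_eq)

lemma reorder_idx_less: "reorder_idx dA dB n i < dA ^ n * dB ^ n"
  unfolding reorder_idx_eq by (rule mult_add_less[OF idxA_less idxB_less])

lemma digit_reorder: "k < n \<Longrightarrow> digit (dA * dB) n k i =
   digit dA n k (reorder_idx dA dB n i div dB ^ n) * dB + digit dB n k (reorder_idx dA dB n i mod dB ^ n)"
  by (simp add: reorder_idx_div reorder_idx_mod digit_idxA digit_idxB)

end

text \<open>The digits of both halves determine those of the index, which gives injectivity;
  surjectivity follows by counting.\<close>

lemma bij_betw_reorder: "bij_betw (reorder_idx dA dB n) {..<(dA * dB) ^ n} {..<dA ^ n * dB ^ n}"
proof -
  have inj: "inj_on (reorder_idx dA dB n) {..<(dA * dB) ^ n}"
  proof (rule inj_onI)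
    fix i j assume ij: "i \<in> {..<(dA * dB) ^ n}" "j \<in> {..<(dA * dB) ^ n}"
      and eq: "reorder_idx dA dB n i = reorder_idx dA dB n j"
    show "i = j"
      by (rule digit_eqI[of _ "dA * dB" n]) (use ij eq in \<open>simp_all add: digit_reorder\<close>)
  qed
  have "reorder_idx dA dB n ` {..<(dA * dB) ^ n} \<subseteq> {..<dA ^ n * dB ^ n}" by (auto simp: reorder_idx_less)
  moreover have "card (reorder_idx dA dB n ` {..<(dA * dB) ^ n}) = card {..<dA ^ n * dB ^ n}"
    using card_image[OF inj] by (simp add: power_mult_distrib)
  ultimately have "reorder_idx dA dB n ` {..<(dA * dB) ^ n} = {..<dA ^ n * dB ^ n}"
    by (intro card_subset_eq) auto
  then show ?thesis using inj by (simp add: bij_betw_def)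
qed

lemma regroup_carrier [simp, intro]: "regroup dA dB n X \<in> carrier_mat ((dA * dB) ^ n) ((dA * dB) ^ n)"
  by (simp add: regroup_def)

lemma regroup_index: "i < (dA * dB) ^ n \<Longrightarrow> j < (dA * dB) ^ n \<Longrightarrow>
    regroup dA dB n X $$ (i, j) = X $$ (reorder_idx dA dB n i, reorder_idx dA dB n j)"
  by (simp add: regroup_def)

context
  fixes dA dB n M :: nat
  defines "M \<equiv> dA ^ n * dB ^ n"
begin

lemma reorder_lt: "i < (dA * dB) ^ n \<Longrightarrow> reorder_idx dA dB n i < M"
  unfolding M_def by (rule reorder_idx_less)

text \<open>Rows and columns are relabelled by the same bijection, so \<open>regroup\<close> is
  conjugation by a permutation matrix. The lemmas here record its algebraic consequences and,
  through them, that it preserves positivity and projections.\<close>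

lemma regroup_mult:
  assumes "X \<in> carrier_mat M M" "Y \<in> carrier_mat M M"
  shows "regroup dA dB n (X * Y) = regroup dA dB n X * regroup dA dB n Y"
proof (rule eq_matI)
  fix i j assume "i < dim_row (regroup dA dB n X * regroup dA dB n Y)" "j < dim_col (regroup dA dB n X * regroup dA dB n Y)"
  then have ij: "i < (dA * dB) ^ n" "j < (dA * dB) ^ n" by (simp_all add: regroup_def)
  let ?r = "reorder_idx dA dB n"
  have "(regroup dA dB n X * regroup dA dB n Y) $$ (i, j) =
     (\<Sum>k<(dA * dB) ^ n. X $$ (?r i, ?r k) * Y $$ (?r k, ?r j))"
    using ij by (simp add: mult_mat_index[OF regroup_carrier regroup_carrier] regroup_index del: index_mult_mat(1))
  also have "\<dots> = (\<Sum>k<M. X $$ (?r i, k) * Y $$ (k, ?r j))"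
    unfolding M_def by (rule sum.reindex_bij_betw[OF bij_betw_reorder])
  also have "\<dots> = (X * Y) $$ (?r i, ?r j)"
    using ij by (simp add: mult_mat_index[OF assms] reorder_lt del: index_mult_mat(1))
  finally show "regroup dA dB n (X * Y) $$ (i, j) = (regroup dA dB n X * regroup dA dB n Y) $$ (i, j)"
    using ij by (simp add: regroup_index)
qed (auto simp: regroup_def)

lemma adj_regroup: "X \<in> carrier_mat M M \<Longrightarrow> adj (regroup dA dB n X) = regroup dA dB n (adj X)"
  by (rule eq_matI) (auto simp: regroup_def reorder_lt)

lemma regroup_one: "regroup dA dB n (1\<^sub>m M) = 1\<^sub>m ((dA * dB) ^ n)"
  using bij_betw_imp_inj_on[OF bij_betw_reorder, of dA dB n]
  by (intro eq_matI) (auto simp: regroup_def reorder_lt dest: inj_onD)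

lemma regroup_minus: "X \<in> carrier_mat M M \<Longrightarrow> Y \<in> carrier_mat M M \<Longrightarrow>
   regroup dA dB n (X - Y) = regroup dA dB n X - regroup dA dB n Y"
  by (rule eq_matI) (auto simp: regroup_def reorder_lt)

lemma regroup_smult: "X \<in> carrier_mat M M \<Longrightarrow> regroup dA dB n (c \<cdot>\<^sub>m X) = c \<cdot>\<^sub>m regroup dA dB n X"
  by (rule eq_matI) (auto simp: regroup_def reorder_lt)

lemma psd_regroup: "psd M X \<Longrightarrow> psd ((dA * dB) ^ n) (regroup dA dB n X)"
proof -
  assume "psd M X"
  then obtain Y where Y: "Y \<in> carrier_mat M M" "X = Y * adj Y" by (rule psd_factor)
  then have "regroup dA dB n X = regroup dA dB n Y * adj (regroup dA dB n Y)"
    by (simp add: regroup_mult adj_regroup)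
  then show ?thesis using psd_mult_adj[OF regroup_carrier] by simp
qed

lemma proj_regroup: "proj M X \<Longrightarrow> proj ((dA * dB) ^ n) (regroup dA dB n X)"
  using regroup_mult[of X X] psd_regroup[OF proj_psd[of M X]] psd_hermitian
  by (auto simp: proj_def)

end

lemma regroup_kron_index:
  assumes "X \<in> carrier_mat (dA ^ n) (dA ^ n)" "Y \<in> carrier_mat (dB ^ n) (dB ^ n)"
    "i < (dA * dB) ^ n" "j < (dA * dB) ^ n"
  shows "regroup dA dB n (kron X Y) $$ (i, j) =
    X $$ (idxA dA dB n i, idxA dA dB n j) * Y $$ (idxB dA dB n i, idxB dA dB n j)"
  using assms by (simp add: regroup_index kron_index[OF assms(1,2)] reorder_idx_less reorder_idx_div reorder_idx_mod)

lemma regroup_tpow: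
  assumes "A \<in> carrier_mat dA dA" "B \<in> carrier_mat dB dB"
  shows "regroup dA dB n (kron (tpow A n) (tpow B n)) = tpow (kron A B) n"
proof (rule eq_matI)
  have cc: "tpow (kron A B) n \<in> carrier_mat ((dA * dB) ^ n) ((dA * dB) ^ n)"
    using assms by auto
  fix i j assume "i < dim_row (tpow (kron A B) n)" "j < dim_col (tpow (kron A B) n)"
  then have ij: "i < (dA * dB) ^ n" "j < (dA * dB) ^ n" using cc by auto
  have "tpow (kron A B) n $$ (i, j) = (\<Prod>k<n. A $$ (digit (dA * dB) n k i div dB, digit (dA * dB) n k j div dB)
     * B $$ (digit (dA * dB) n k i mod dB, digit (dA * dB) n k j mod dB))"
    unfolding tpow_index[OF kron_carrier[OF assms] ij]
    using ij by (intro prod.cong refl) (simp add: kron_index[OF assms] digit_less')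
  also have "\<dots> = tpow A n $$ (idxA dA dB n i, idxA dA dB n j) * tpow B n $$ (idxB dA dB n i, idxB dA dB n j)"
    using ij by (simp add: tpow_index[OF assms(1)] tpow_index[OF assms(2)] idxA_less idxB_less digit_idxA digit_idxB prod.distrib)
  also have "\<dots> = regroup dA dB n (kron (tpow A n) (tpow B n)) $$ (i, j)"
    by (rule regroup_kron_index[symmetric]) (use assms ij in auto)
  finally show "regroup dA dB n (kron (tpow A n) (tpow B n)) $$ (i, j) = tpow (kron A B) n $$ (i, j)" by simp
qed (use tpow_carrier[OF kron_carrier[OF assms], of n] in \<open>auto simp: regroup_def\<close>)

text \<open>Separates the A strings from the B strings in the trace, so that an identity on one side
  can be summed out.\<close>

lemma tpow_trace_regroup:
  assumes \<rho>: "\<rho> \<in> carrier_mat (dA * dB) (dA * dB)"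
    and X: "X \<in> carrier_mat (dA ^ n) (dA ^ n)" and Y: "Y \<in> carrier_mat (dB ^ n) (dB ^ n)"
  shows "mtrace (tpow \<rho> n * regroup dA dB n (kron X Y)) =
    (\<Sum>a<dA ^ n. \<Sum>b<dB ^ n. \<Sum>a'<dA ^ n. \<Sum>b'<dB ^ n.
      (\<Prod>k<n. \<rho> $$ (digit dA n k a * dB + digit dB n k b, digit dA n k a' * dB + digit dB n k b')) * (X $$ (a', a) * Y $$ (b', b)))"
proof -
  let ?N = "(dA * dB) ^ n" and ?r = "reorder_idx dA dB n" and ?M = "dA ^ n * dB ^ n"
  define G where "G m m' = (\<Prod>k<n. \<rho> $$ (digit dA n k (m div dB ^ n) * dB + digit dB n k (m mod dB ^ n),
     digit dA n k (m' div dB ^ n) * dB + digit dB n k (m' mod dB ^ n))) * kron X Y $$ (m', m)" for m m'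
  have "mtrace (tpow \<rho> n * regroup dA dB n (kron X Y)) = (\<Sum>i<?N. \<Sum>j<?N. tpow \<rho> n $$ (i, j) * regroup dA dB n (kron X Y) $$ (j, i))"
    by (rule mtrace_mult_eq_sum[OF tpow_carrier[OF \<rho>] regroup_carrier])
  also have "\<dots> = (\<Sum>i<?N. \<Sum>j<?N. G (?r i) (?r j))"
    unfolding G_def by (intro sum.cong refl arg_cong2[of _ _ _ _ "(*)"])
      (simp_all add: tpow_index[OF \<rho>] regroup_index digit_reorder)
  also have "\<dots> = (\<Sum>i<?N. \<Sum>m'<?M. G (?r i) m')"
    by (intro sum.cong refl sum.reindex_bij_betw[OF bij_betw_reorder])
  also have "\<dots> = (\<Sum>m<?M. \<Sum>m'<?M. G m m')"
    by (rule sum.reindex_bij_betw[OF bij_betw_reorder, of "\<lambda>m. \<Sum>m'<?M. G m m'"])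
  also have "\<dots> = (\<Sum>a<dA ^ n. \<Sum>b<dB ^ n. \<Sum>a'<dA ^ n. \<Sum>b'<dB ^ n. G (a * dB ^ n + b) (a' * dB ^ n + b'))"
    unfolding sum_lessThan_mult ..
  finally show ?thesis by (simp add: G_def kron_index[OF X Y] mult_add_less div_mult_add)
qed

text \<open>With the identity on the B side only equal B strings survive, and
  \<open>sum_prod_digit\<close> moves their sum inside the product over the factors, where it
  produces the partial trace \<open>ptrB\<close>.\<close>

lemma tpow_trace_regroup_A:
  assumes \<rho>: "\<rho> \<in> carrier_mat (dA * dB) (dA * dB)" and X: "X \<in> carrier_mat (dA ^ n) (dA ^ n)"
  shows "mtrace (tpow \<rho> n * regroup dA dB n (kron X (1\<^sub>m (dB ^ n)))) = mtrace (tpow (ptrB dA dB \<rho>) n * X)"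
proof -
  have c: "ptrB dA dB \<rho> \<in> carrier_mat dA dA" by (simp add: ptrB_def)
  have t: "tpow (ptrB dA dB \<rho>) n $$ (a, a') =
     (\<Sum>b<dB ^ n. \<Prod>k<n. \<rho> $$ (digit dA n k a * dB + digit dB n k b, digit dA n k a' * dB + digit dB n k b))"
    if "a < dA ^ n" "a' < dA ^ n" for a a'
    using that unfolding tpow_index[OF c that] by (subst sum_prod_digit) (simp add: ptrB_def digit_less')
  have "mtrace (tpow \<rho> n * regroup dA dB n (kron X (1\<^sub>m (dB ^ n)))) = (\<Sum>a<dA ^ n. \<Sum>b<dB ^ n. \<Sum>a'<dA ^ n.
      (\<Prod>k<n. \<rho> $$ (digit dA n k a * dB + digit dB n k b, digit dA n k a' * dB + digit dB n k b)) * X $$ (a', a))"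
    unfolding tpow_trace_regroup[OF \<rho> X one_carrier_mat]
    by (intro sum.cong refl) (simp add: if_distrib[of "\<lambda>x. _ * x"] cong: if_cong)
  also have "\<dots> = (\<Sum>a<dA ^ n. \<Sum>a'<dA ^ n. tpow (ptrB dA dB \<rho>) n $$ (a, a') * X $$ (a', a))"
    by (rule sum.cong[OF refl], subst sum.swap) (simp add: t sum_distrib_right)
  also have "\<dots> = mtrace (tpow (ptrB dA dB \<rho>) n * X)"
    by (rule mtrace_mult_eq_sum[symmetric]) (use c X in auto)
  finally show ?thesis .
qed

lemma tpow_trace_regroup_B:
  assumes \<rho>: "\<rho> \<in> carrier_mat (dA * dB) (dA * dB)" and Y: "Y \<in> carrier_mat (dB ^ n) (dB ^ n)"
  shows "mtrace (tpow \<rho> n * regroup dA dB n (kron (1\<^sub>m (dA ^ n)) Y)) = mtrace (tpow (ptrA dA dB \<rho>) n * Y)"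
proof -
  have c: "ptrA dA dB \<rho> \<in> carrier_mat dB dB" by (simp add: ptrA_def)
  have t: "tpow (ptrA dA dB \<rho>) n $$ (b, b') =
     (\<Sum>a<dA ^ n. \<Prod>k<n. \<rho> $$ (digit dA n k a * dB + digit dB n k b, digit dA n k a * dB + digit dB n k b'))"
    if "b < dB ^ n" "b' < dB ^ n" for b b'
    using that unfolding tpow_index[OF c that] by (subst sum_prod_digit) (simp add: ptrA_def digit_less')
  have "mtrace (tpow \<rho> n * regroup dA dB n (kron (1\<^sub>m (dA ^ n)) Y)) = (\<Sum>a<dA ^ n. \<Sum>b<dB ^ n. \<Sum>b'<dB ^ n.
      (\<Prod>k<n. \<rho> $$ (digit dA n k a * dB + digit dB n k b, digit dA n k a * dB + digit dB n k b')) * Y $$ (b', b))"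
    unfolding tpow_trace_regroup[OF \<rho> one_carrier_mat Y]
    by (rule sum.cong[OF refl], rule sum.cong[OF refl], subst sum.swap)
      (simp add: if_distrib[of "\<lambda>x. x * _"] if_distrib[of "\<lambda>x. _ * x"] cong: if_cong)
  also have "\<dots> = (\<Sum>b<dB ^ n. \<Sum>b'<dB ^ n. tpow (ptrA dA dB \<rho>) n $$ (b, b') * Y $$ (b', b))"
    by (subst sum.swap, rule sum.cong[OF refl], subst sum.swap) (simp add: t sum_distrib_right)
  also have "\<dots> = mtrace (tpow (ptrA dA dB \<rho>) n * Y)"
    by (rule mtrace_mult_eq_sum[symmetric]) (use c Y in auto)
  finally show ?thesis .
qed

section \<open>A universal symmetric operator\<close>

text \<open>The permutation of basis indices behind \<open>perm_op\<close>, which sends basis vector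
  \<open>i\<close> to basis vector \<open>act d n \<pi> i\<close>.\<close>

definition act :: "nat \<Rightarrow> nat \<Rightarrow> (nat \<Rightarrow> nat) \<Rightarrow> nat \<Rightarrow> nat" where
  "act d n \<pi> i = enc d n (\<lambda>k. digit d n (\<pi> k) i)"

context
  fixes d n :: nat and \<pi> :: "nat \<Rightarrow> nat"
  assumes \<pi>: "\<pi> permutes {..<n}"
begin

lemma perm_less: "k < n \<Longrightarrow> \<pi> k < n"
  using permutes_in_image[OF \<pi>] by simp

lemma act_less: "i < d ^ n \<Longrightarrow> act d n \<pi> i < d ^ n"
  unfolding act_def by (intro enc_less digit_less' perm_less)

lemma digit_act: "i < d ^ n \<Longrightarrow> k < n \<Longrightarrow> digit d n k (act d n \<pi> i) = digit d n (\<pi> k) i"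
  unfolding act_def by (intro digit_enc digit_less' perm_less)

lemma perm_op_index:
  assumes "i < d ^ n" "j < d ^ n"
  shows "perm_op d n \<pi> $$ (i, j) = (if i = act d n \<pi> j then 1 else 0)"
proof -
  have "(\<forall>k<n. digit d n k i = digit d n (\<pi> k) j) \<longleftrightarrow> i = act d n \<pi> j"
    using assms digit_eqI[of i d n "act d n \<pi> j"] act_less digit_act by auto
  then show ?thesis using assms by (simp add: perm_op_def)
qed

lemma act_inj: "i < d ^ n \<Longrightarrow> j < d ^ n \<Longrightarrow> act d n \<pi> i = act d n \<pi> j \<longleftrightarrow> i = j"
proof
  assume ij: "i < d ^ n" "j < d ^ n" and eq: "act d n \<pi> i = act d n \<pi> j"
  show "i = j"
  proof (rule digit_eqI[OF ij])
    fix k assume k: "k < n"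
    define l where "l = inv_into UNIV \<pi> k"
    have "l < n" "\<pi> l = k"
      using permutes_in_image[OF permutes_inv[OF \<pi>], of k] permutes_inverses[OF \<pi>] k by (auto simp: l_def)
    then show "digit d n k i = digit d n k j" using digit_act[OF ij(1), of l] digit_act[OF ij(2), of l] eq by simp
  qed
qed simp

lemma act_surj: "i < d ^ n \<Longrightarrow> \<exists>j<d ^ n. i = act d n \<pi> j"
proof -
  assume i: "i < d ^ n"
  have "act d n \<pi> ` {..<d ^ n} = {..<d ^ n}"
    by (rule endo_inj_surj) (auto simp: act_less act_inj inj_on_def)
  then show ?thesis using i by (metis imageE lessThan_iff)
qed

lemma perm_op_carrier [simp]: "perm_op d n \<pi> \<in> carrier_mat (d ^ n) (d ^ n)"
  by (simp add: perm_op_def)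

lemma unitary_perm_op: "unitary (d ^ n) (perm_op d n \<pi>)"
proof -
  have "unitary (d ^ n) (adj (perm_op d n \<pi>))"
  proof (rule unitaryI_right)
    fix i j assume ij: "i < d ^ n" "j < d ^ n"
    have "(\<Sum>k<d ^ n. adj (perm_op d n \<pi>) $$ (i, k) * cnj (adj (perm_op d n \<pi>) $$ (j, k))) =
      (\<Sum>k<d ^ n. if k = act d n \<pi> i then (if act d n \<pi> i = act d n \<pi> j then 1 else 0) else 0)"
      using ij by (intro sum.cong refl) (simp add: carrier_matD[OF perm_op_carrier] perm_op_index)
    also have "\<dots> = (if i = j then 1 else 0)" using ij by (simp add: act_less act_inj)
    finally show "(\<Sum>k<d ^ n. adj (perm_op d n \<pi>) $$ (i, k) * cnj (adj (perm_op d n \<pi>) $$ (j, k))) = (if i = j then 1 else 0)" .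
  qed auto
  then show ?thesis using unitary_adj by fastforce
qed

lemma perm_op_mult_index:
  assumes "X \<in> carrier_mat (d ^ n) (d ^ n)" "i < d ^ n" "j < d ^ n"
  shows "(perm_op d n \<pi> * X) $$ (act d n \<pi> i, j) = X $$ (i, j)"
  using assms by (simp add: mult_mat_index[OF perm_op_carrier assms(1)] perm_op_index act_less act_inj
     if_distrib[of "\<lambda>x. x * _"] del: index_mult_mat(1) cong: if_cong)

lemma mult_perm_op_index:
  assumes "X \<in> carrier_mat (d ^ n) (d ^ n)" "i < d ^ n" "j < d ^ n"
  shows "(X * perm_op d n \<pi>) $$ (i, j) = X $$ (i, act d n \<pi> j)"
  using assms by (simp add: mult_mat_index[OF assms(1) perm_op_carrier] perm_op_index act_less
     if_distrib[of "\<lambda>x. _ * x"] del: index_mult_mat(1) cong: if_cong)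

text \<open>Turns invariance into a statement about entries: they are constant along orbits of the
  simultaneous action on index pairs, which the joint types below describe.\<close>

lemma perm_op_commute_iff:
  assumes X: "X \<in> carrier_mat (d ^ n) (d ^ n)"
  shows "perm_op d n \<pi> * X = X * perm_op d n \<pi> \<longleftrightarrow>
    (\<forall>i<d ^ n. \<forall>j<d ^ n. X $$ (act d n \<pi> i, act d n \<pi> j) = X $$ (i, j))"
proof
  assume "perm_op d n \<pi> * X = X * perm_op d n \<pi>"
  then show "\<forall>i<d ^ n. \<forall>j<d ^ n. X $$ (act d n \<pi> i, act d n \<pi> j) = X $$ (i, j)"
    using perm_op_mult_index[OF X] mult_perm_op_index[OF X] act_less by metis
next
  assume r: "\<forall>i<d ^ n. \<forall>j<d ^ n. X $$ (act d n \<pi> i, act d n \<pi> j) = X $$ (i, j)"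
  show "perm_op d n \<pi> * X = X * perm_op d n \<pi>"
  proof (rule eq_matI)
    fix i j assume "i < dim_row (X * perm_op d n \<pi>)" "j < dim_col (X * perm_op d n \<pi>)"
    then have ij: "i < d ^ n" "j < d ^ n" using X by (auto simp: carrier_matD[OF perm_op_carrier])
    obtain i' where i': "i' < d ^ n" "i = act d n \<pi> i'" using act_surj[OF ij(1)] by blast
    show "(perm_op d n \<pi> * X) $$ (i, j) = (X * perm_op d n \<pi>) $$ (i, j)"
      using r i' ij by (simp add: perm_op_mult_index[OF X] mult_perm_op_index[OF X] act_less del: index_mult_mat(1))
  qed (use X in \<open>auto simp: carrier_matD[OF perm_op_carrier]\<close>)
qed

lemma perm_op_tpow:
  assumes U: "U \<in> carrier_mat d d"
  shows "perm_op d n \<pi> * tpow U n = tpow U n * perm_op d n \<pi>"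
  unfolding perm_op_commute_iff[OF tpow_carrier[OF U]]
proof (intro allI impI)
  fix i j assume ij: "i < d ^ n" "j < d ^ n"
  have "tpow U n $$ (act d n \<pi> i, act d n \<pi> j) = (\<Prod>k<n. U $$ (digit d n (\<pi> k) i, digit d n (\<pi> k) j))"
    using ij by (simp add: tpow_index[OF U] act_less digit_act)
  also have "\<dots> = (\<Prod>k<n. U $$ (digit d n k i, digit d n k j))"
    by (rule prod.reindex_bij_betw[OF permutes_imp_bij[OF \<pi>], of "\<lambda>k. U $$ (digit d n k i, digit d n k j)"])
  finally show "tpow U n $$ (act d n \<pi> i, act d n \<pi> j) = tpow U n $$ (i, j)"
    using ij by (simp add: tpow_index[OF U])
qed

end

section \<open>Joint types of index pairs\<close>

definition ty :: "nat \<Rightarrow> nat \<Rightarrow> nat \<Rightarrow> nat \<Rightarrow> (nat \<times> nat) multiset" where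
  "ty d n i j = mset (map (\<lambda>k. (digit d n k i, digit d n k j)) [0..<n])"

definition tys :: "nat \<Rightarrow> nat \<Rightarrow> (nat \<times> nat) multiset set" where
  "tys d n = (\<lambda>(i, j). ty d n i j) ` ({..<d ^ n} \<times> {..<d ^ n})"

lemma ty_in_tys: "i < d ^ n \<Longrightarrow> j < d ^ n \<Longrightarrow> ty d n i j \<in> tys d n"
  by (auto simp: tys_def)

lemma finite_tys: "finite (tys d n)"
  by (simp add: tys_def)

text \<open>A joint type is determined by d^2 multiplicities, each between 0 and n. This count is
  the source of every polynomial factor in the one-shot bounds.\<close>

lemma card_tys: "card (tys d n) \<le> (n + 1) ^ (d * d)"
proof -
  let ?S = "{..<d} \<times> {..<d}"
  let ?f = "\<lambda>t. restrict (count t) ?S"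
  have sub: "set_mset t \<subseteq> ?S" "size t = n" if "t \<in> tys d n" for t
    using that by (auto simp: tys_def ty_def digit_less')
  have "inj_on ?f (tys d n)"
  proof (rule inj_onI, rule multiset_eqI)
    fix t u x assume tu: "t \<in> tys d n" "u \<in> tys d n" "?f t = ?f u"
    show "count t x = count u x"
    proof (cases "x \<in> ?S")
      case True
      then show ?thesis using fun_cong[OF tu(3), of x] by (simp add: restrict_def)
    next
      case False
      then have "x \<notin># t" "x \<notin># u" using sub tu by blast+
      then show ?thesis by (simp add: not_in_iff)
    qed
  qed
  moreover have "?f ` tys d n \<subseteq> ?S \<rightarrow>\<^sub>E {..n}"
    using sub count_le_size by (force simp: PiE_iff)
  ultimately have "card (tys d n) \<le> card (?S \<rightarrow>\<^sub>E {..n})"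
    by (intro card_inj_on_le[of ?f]) (auto intro!: finite_PiE)
  also have "\<dots> = (n + 1) ^ (d * d)" by (simp add: card_PiE card_cartesian_product)
  finally show ?thesis .
qed

text \<open>Equal multisets of digit pairs differ by a permutation of the positions, so index pairs
  of one type lie in one orbit.\<close>

lemma ty_eq_act:
  assumes "i < d ^ n" "j < d ^ n" "i' < d ^ n" "j' < d ^ n" "ty d n i j = ty d n i' j'"
  shows "\<exists>\<pi>. \<pi> permutes {..<n} \<and> i = act d n \<pi> i' \<and> j = act d n \<pi> j'"
proof -
  let ?xs = "map (\<lambda>k. (digit d n k i, digit d n k j)) [0..<n]"
  let ?ys = "map (\<lambda>k. (digit d n k i', digit d n k j')) [0..<n]"
  obtain p where p: "p permutes {..<length ?ys}" "permute_list p ?ys = ?xs"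
    using assms(5) unfolding ty_def by (rule mset_eq_permutation)
  have pn: "p permutes {..<n}" using p by simp
  have "digit d n k i = digit d n (p k) i' \<and> digit d n k j = digit d n (p k) j'" if k: "k < n" for k
  proof -
    have "?xs ! k = ?ys ! p k" using p(2) permute_list_nth[OF p(1), of k] k by simp
    then show ?thesis using k perm_less[OF pn k] by simp
  qed
  then have "i = act d n p i'" "j = act d n p j'"
    using digit_eqI[OF assms(1) act_less[OF pn assms(3)]] digit_eqI[OF assms(2) act_less[OF pn assms(4)]]
      digit_act[OF pn assms(3)] digit_act[OF pn assms(4)] by auto
  then show ?thesis using pn by blast
qed

text \<open>The squared Hilbert-Schmidt norm of the 0-1 indicator matrix of the type.\<close>

definition tyn :: "nat \<Rightarrow> nat \<Rightarrow> (nat \<times> nat) multiset \<Rightarrow> real" where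
  "tyn d n t = (\<Sum>i<d ^ n. \<Sum>j<d ^ n. of_bool (ty d n i j = t))"

lemma tyn_pos: assumes "t \<in> tys d n" shows "tyn d n t > 0"
proof -
  obtain i j where ij: "i < d ^ n" "j < d ^ n" "t = ty d n i j" using assms by (auto simp: tys_def)
  have "(1::real) = of_bool (ty d n i j = t)" using ij by simp
  also have "\<dots> \<le> (\<Sum>j<d ^ n. of_bool (ty d n i j = t))" using ij by (intro member_le_sum) auto
  also have "\<dots> \<le> tyn d n t" unfolding tyn_def
    using ij by (intro member_le_sum[of i _ "\<lambda>i. \<Sum>j<d ^ n. of_bool (ty d n i j = t)"]) (auto intro!: sum_nonneg)
  finally show ?thesis by simp
qed

text \<open>With E_t the 0-1 indicator matrix of the type t and |t| its number of ones, this is the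
  sum over t of E_t^T E_t / |t|. Each summand is positive with trace one, and the weights 1 / |t|
  are those that Cauchy-Schwarz calls for in \<open>usym_dominates\<close>.\<close>

definition usym :: "nat \<Rightarrow> nat \<Rightarrow> complex mat" where
  "usym d n = mat (d ^ n) (d ^ n) (\<lambda>(i, j). complex_of_real
     (\<Sum>k<d ^ n. of_bool (ty d n k i = ty d n k j) / tyn d n (ty d n k i)))"

lemma usym_carrier [simp]: "usym d n \<in> carrier_mat (d ^ n) (d ^ n)"
  by (simp add: usym_def)

lemma hermitian_usym: "hermitian (d ^ n) (usym d n)"
  by (rule hermitianI) (auto simp: usym_def intro!: sum.cong)

lemma sum_of_bool_tys:
  fixes f :: "(nat \<times> nat) multiset \<Rightarrow> 'a::semiring_1"
  assumes "i < d ^ n" "j < d ^ n"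
  shows "(\<Sum>t\<in>tys d n. of_bool (ty d n i j = t) * f t) = f (ty d n i j)"
  using ty_in_tys[OF assms] finite_tys[of d n]
  by (simp add: of_bool_def if_distrib[of "\<lambda>x. x * _"] cong: if_cong)

text \<open>Here \<open>s k t\<close> is the k-th entry of E_t v, so the form is the sum of |E_t
  v|^2 / |t| over the types; this shows positivity and is the shape that Cauchy-Schwarz
  produces.\<close>

lemma usym_quadratic:
  assumes v: "v \<in> carrier_vec (d ^ n)"
  defines "s \<equiv> \<lambda>k t. \<Sum>i<d ^ n. of_bool (ty d n k i = t) * v $ i"
  shows "ip v (usym d n *\<^sub>v v) = complex_of_real (\<Sum>k<d ^ n. \<Sum>t\<in>tys d n. (cmod (s k t))\<^sup>2 / tyn d n t)"
proof -
  let ?N = "d ^ n"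
  have "complex_of_real (\<Sum>k<?N. \<Sum>t\<in>tys d n. (cmod (s k t))\<^sup>2 / tyn d n t) =
    (\<Sum>k<?N. \<Sum>t\<in>tys d n. (cnj (s k t) * s k t) / tyn d n t)"
    unfolding of_real_sum of_real_divide complex_norm_square by (simp add: mult.commute)
  also have "\<dots> = (\<Sum>k<?N. \<Sum>t\<in>tys d n. \<Sum>i<?N. \<Sum>j<?N. cnj (v $ i) * v $ j *
      complex_of_real (of_bool (ty d n k i = t) * (of_bool (ty d n k j = t) / tyn d n t)))"
    unfolding s_def cnj_sum sum_product sum_divide_distrib
    by (intro sum.cong refl) (simp add: mult_ac)
  also have "\<dots> = (\<Sum>k<?N. \<Sum>i<?N. \<Sum>j<?N. \<Sum>t\<in>tys d n. cnj (v $ i) * v $ j *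
      complex_of_real (of_bool (ty d n k i = t) * (of_bool (ty d n k j = t) / tyn d n t)))"
    by (rule sum.cong[OF refl], subst sum.swap, rule sum.cong[OF refl], subst sum.swap) simp
  also have "\<dots> = (\<Sum>k<?N. \<Sum>i<?N. \<Sum>j<?N. cnj (v $ i) * v $ j *
      complex_of_real (of_bool (ty d n k j = ty d n k i) / tyn d n (ty d n k i)))"
  proof (intro sum.cong refl)
    fix k i j assume kij: "k \<in> {..<?N}" "i \<in> {..<?N}" "j \<in> {..<?N}"
    have "(\<Sum>t\<in>tys d n. of_bool (ty d n k i = t) * (of_bool (ty d n k j = t) / tyn d n t)) =
        of_bool (ty d n k j = ty d n k i) / tyn d n (ty d n k i)"
      by (rule sum_of_bool_tys) (use kij in auto)
    then show "(\<Sum>t\<in>tys d n. cnj (v $ i) * v $ j * complex_of_real (of_bool (ty d n k i = t) * (of_bool (ty d n k j = t) / tyn d n t)))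
      = cnj (v $ i) * v $ j * complex_of_real (of_bool (ty d n k j = ty d n k i) / tyn d n (ty d n k i))"
      unfolding sum_distrib_left[symmetric] of_real_sum[symmetric] by (rule arg_cong)
  qed
  also have "\<dots> = (\<Sum>i<?N. \<Sum>j<?N. \<Sum>k<?N. cnj (v $ i) * v $ j *
      complex_of_real (of_bool (ty d n k j = ty d n k i) / tyn d n (ty d n k i)))"
    by (subst sum.swap, rule sum.cong[OF refl], subst sum.swap) simp
  also have "\<dots> = (\<Sum>i<?N. \<Sum>j<?N. cnj (v $ i) * (usym d n $$ (i, j) * v $ j))"
  proof (intro sum.cong refl)
    fix i j assume ij: "i \<in> {..<?N}" "j \<in> {..<?N}"
    have "usym d n $$ (i, j) = (\<Sum>k<?N. complex_of_real (of_bool (ty d n k j = ty d n k i) / tyn d n (ty d n k i)))"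
      using ij unfolding usym_def of_real_sum[symmetric] by (auto intro!: sum.cong)
    then show "(\<Sum>k<?N. cnj (v $ i) * v $ j * complex_of_real (of_bool (ty d n k j = ty d n k i) / tyn d n (ty d n k i))) =
       cnj (v $ i) * (usym d n $$ (i, j) * v $ j)"
      unfolding sum_distrib_left[symmetric] by (simp only: mult_ac)
  qed
  also have "\<dots> = ip v (usym d n *\<^sub>v v)"
    using v by (simp add: ip_def mult_mat_vec_nth[OF usym_carrier v] sum_distrib_left carrier_vecD[OF v] del: index_mult_mat_vec)
  finally show ?thesis by simp
qed

lemma psd_usym: "psd (d ^ n) (usym d n)"
  unfolding psd_def_ip using hermitian_usym
  by (auto simp: usym_quadratic intro!: sum_nonneg divide_nonneg_pos tyn_pos)

lemma mtrace_usym: "mtrace (usym d n) = real (card (tys d n))"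
proof -
  let ?N = "d ^ n"
  have "real (card (tys d n)) = (\<Sum>t\<in>tys d n. tyn d n t * (1 / tyn d n t))"
    using tyn_pos[of _ d n] by (simp add: less_imp_neq[symmetric])
  also have "\<dots> = (\<Sum>t\<in>tys d n. \<Sum>k<?N. \<Sum>i<?N. of_bool (ty d n k i = t) * (1 / tyn d n t))"
    by (intro sum.cong refl) (subst (1) tyn_def, simp only: sum_distrib_right)
  also have "\<dots> = (\<Sum>k<?N. \<Sum>i<?N. \<Sum>t\<in>tys d n. of_bool (ty d n k i = t) * (1 / tyn d n t))"
    by (subst sum.swap, rule sum.cong[OF refl], rule sum.swap)
  also have "\<dots> = (\<Sum>k<?N. \<Sum>i<?N. 1 / tyn d n (ty d n k i))"
    by (intro sum.cong refl sum_of_bool_tys) auto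
  also have "\<dots> = (\<Sum>i<?N. \<Sum>k<?N. 1 / tyn d n (ty d n k i))" by (rule sum.swap)
  finally have "real (card (tys d n)) = (\<Sum>i<?N. \<Sum>k<?N. 1 / tyn d n (ty d n k i))" .
  then show ?thesis by (simp add: mtrace_def usym_def)
qed

lemma pw_ty: "i < d ^ n \<Longrightarrow> pw d f n i = prod_mset (image_mset f (image_mset snd (ty d n k i)))"
  unfolding pw_digit ty_def
  by (simp add: image_mset.compositionality comp_def prod_mset_prod_list prod.list_conv_set_nth
      flip: mset_map) (simp add: atLeast0LessThan)

text \<open>Every eigenvalue can be read off a joint type, here that of the pair (i, i), so the
  count of types bounds the number of distinct values.\<close>

lemma card_pw: "card (pw d f n ` {..<d ^ n}) \<le> (n + 1) ^ (d * d)"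
proof -
  have "pw d f n ` {..<d ^ n} \<subseteq> (\<lambda>t. prod_mset (image_mset f (image_mset snd t))) ` tys d n"
  proof (rule image_subsetI)
    fix i assume "i \<in> {..<d ^ n}"
    then have i: "i < d ^ n" by simp
    show "pw d f n i \<in> (\<lambda>t. prod_mset (image_mset f (image_mset snd t))) ` tys d n"
      unfolding pw_ty[OF i, of f i] by (rule imageI[OF ty_in_tys[OF i i]])
  qed
  then have "card (pw d f n ` {..<d ^ n}) \<le> card (tys d n)"
    using finite_tys by (rule surj_card_le[rotated])
  then show ?thesis using card_tys[of d n] by simp
qed

text \<open>A nonzero entry at (i, j) requires some k for which (k, i) and (k, j) have equal joint
  types; then i and j carry the same multiset of digits, hence the same eigenvalue.\<close>

lemma usym_commute_pw: "usym d n * dg (d ^ n) (pw d f n) = dg (d ^ n) (pw d f n) * usym d n"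
proof (rule eq_matI)
  fix i j assume "i < dim_row (dg (d ^ n) (pw d f n) * usym d n)" "j < dim_col (dg (d ^ n) (pw d f n) * usym d n)"
  then have ij: "i < d ^ n" "j < d ^ n" by (auto simp: usym_def)

  have "pw d f n i = pw d f n j" if "usym d n $$ (i, j) \<noteq> 0"
  proof -
    have "\<exists>k. ty d n k i = ty d n k j"
    proof (rule ccontr)
      assume "\<nexists>k. ty d n k i = ty d n k j"
      then show False using that ij by (simp add: usym_def)
    qed
    then show ?thesis using pw_ty[OF ij(1)] pw_ty[OF ij(2)] by metis
  qed
  then have "usym d n $$ (i, j) = 0 \<or> pw d f n i = pw d f n j" by blast
  then show "(usym d n * dg (d ^ n) (pw d f n)) $$ (i, j) = (dg (d ^ n) (pw d f n) * usym d n) $$ (i, j)"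
    unfolding mult_dg_index[OF usym_carrier ij] dg_mult_index[OF usym_carrier ij] by auto
qed (auto simp: usym_def)

text \<open>Write the invariant X as the sum of c_t E_t. Then tr X^2 = 1 says that the sum of |t|
  |c_t|^2 is 1, and Cauchy-Schwarz in each coordinate of X v leaves the sum of |E_t v|^2 / |t|. It
  is applied to the square root of a state.\<close>

lemma usym_dominates:
  assumes X: "hermitian (d ^ n) X" and tr: "mtrace (X * X) = 1"
    and inv: "\<And>\<pi>. \<pi> permutes {..<n} \<Longrightarrow> perm_op d n \<pi> * X = X * perm_op d n \<pi>"
    and v: "v \<in> carrier_vec (d ^ n)"
  shows "nsq (X *\<^sub>v v) \<le> Re (ip v (usym d n *\<^sub>v v))"
proof -
  let ?N = "d ^ n"
  have Xc: "X \<in> carrier_mat ?N ?N" using X by simp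
  \<comment> \<open>A representative index pair for each type; by invariance the entry of
    \<open>X\<close> there is the common value on the whole class.\<close>
  define pick where "pick t = (SOME p. fst p < ?N \<and> snd p < ?N \<and> ty d n (fst p) (snd p) = t)" for t
  define c where "c t = X $$ pick t" for t
  have X_eq: "X $$ (i, j) = c (ty d n i j)" if ij: "i < ?N" "j < ?N" for i j
  proof -
    have "fst (pick (ty d n i j)) < ?N \<and> snd (pick (ty d n i j)) < ?N \<and>
      ty d n (fst (pick (ty d n i j))) (snd (pick (ty d n i j))) = ty d n i j"
      unfolding pick_def by (rule someI[of _ "(i, j)"]) (use ij in auto)
    then obtain i' j' where p: "pick (ty d n i j) = (i', j')" "i' < ?N" "j' < ?N" "ty d n i j = ty d n i' j'"
      by (metis prod.collapse)
    obtain \<pi> where \<pi>: "\<pi> permutes {..<n}" "i = act d n \<pi> i'" "j = act d n \<pi> j'"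
      using ty_eq_act[OF ij p(2,3,4)] by blast
    show ?thesis using inv[OF \<pi>(1)] p \<pi> by (simp add: c_def perm_op_commute_iff[OF \<pi>(1) Xc])
  qed
  define s where "s k t = (\<Sum>i<d ^ n. of_bool (ty d n k i = t) * v $ i)" for k t
  have pos: "tyn d n t > 0" if "t \<in> tys d n" for t using that by (rule tyn_pos)
  have "complex_of_real (\<Sum>i<?N. \<Sum>j<?N. (cmod (X $$ (i, j)))\<^sup>2) = mtrace (X * X)"
    unfolding mtrace_mult_eq_sum[OF Xc Xc] of_real_sum complex_norm_square
    by (intro sum.cong refl) (simp add: hermitian_index[OF X])
  then have "complex_of_real (\<Sum>i<?N. \<Sum>j<?N. (cmod (X $$ (i, j)))\<^sup>2) = complex_of_real 1" using tr by simp
  then have "1 = (\<Sum>i<?N. \<Sum>j<?N. (cmod (X $$ (i, j)))\<^sup>2)" by (metis of_real_eq_iff)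
  also have "\<dots> = (\<Sum>i<?N. \<Sum>j<?N. \<Sum>t\<in>tys d n. of_bool (ty d n i j = t) * (cmod (c t))\<^sup>2)"
    by (intro sum.cong refl) (simp add: sum_of_bool_tys X_eq)
  also have "\<dots> = (\<Sum>t\<in>tys d n. \<Sum>i<?N. \<Sum>j<?N. of_bool (ty d n i j = t) * (cmod (c t))\<^sup>2)"
    by (subst (2) sum.swap, subst sum.swap) simp
  also have "\<dots> = (\<Sum>t\<in>tys d n. tyn d n t * (cmod (c t))\<^sup>2)"
    by (simp add: tyn_def sum_distrib_right)
  finally have norm1: "(\<Sum>t\<in>tys d n. tyn d n t * (cmod (c t))\<^sup>2) = 1" by simp
  have "(cmod ((X *\<^sub>v v) $ k))\<^sup>2 \<le> (\<Sum>t\<in>tys d n. (cmod (s k t))\<^sup>2 / tyn d n t)" if k: "k < ?N" for k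
  proof -
    have "(X *\<^sub>v v) $ k = (\<Sum>i<?N. \<Sum>t\<in>tys d n. of_bool (ty d n k i = t) * (c t * v $ i))"
      using k by (simp add: mult_mat_vec_nth[OF Xc v] sum_of_bool_tys X_eq del: index_mult_mat_vec)
    also have "\<dots> = (\<Sum>t\<in>tys d n. c t * s k t)"
      by (subst sum.swap) (simp add: s_def sum_distrib_left mult_ac del: sum_of_bool_mult_eq sum_mult_of_bool_eq)
    finally have "cmod ((X *\<^sub>v v) $ k) \<le> (\<Sum>t\<in>tys d n. cmod (c t) * cmod (s k t))"
      by (simp add: norm_mult order_trans[OF norm_sum])
    \<comment> \<open>A factor sqrt |t| is shifted between the two sides so that the first one has
      norm 1.\<close>
    also have "\<dots> = (\<Sum>t\<in>tys d n. \<bar>sqrt (tyn d n t) * cmod (c t)\<bar> * \<bar>cmod (s k t) / sqrt (tyn d n t)\<bar>)"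
      using pos by (intro sum.cong refl) (auto simp: abs_mult less_imp_neq[symmetric])
    also have "\<dots> \<le> L2_set (\<lambda>t. sqrt (tyn d n t) * cmod (c t)) (tys d n) * L2_set (\<lambda>t. cmod (s k t) / sqrt (tyn d n t)) (tys d n)"
      by (rule L2_set_mult_ineq)
    also have "L2_set (\<lambda>t. sqrt (tyn d n t) * cmod (c t)) (tys d n) = 1"
      using norm1 pos by (simp add: L2_set_def power_mult_distrib less_imp_le)
    also have "L2_set (\<lambda>t. cmod (s k t) / sqrt (tyn d n t)) (tys d n) = sqrt (\<Sum>t\<in>tys d n. (cmod (s k t))\<^sup>2 / tyn d n t)"
      using pos by (simp add: L2_set_def power_divide less_imp_le)
    finally have "(cmod ((X *\<^sub>v v) $ k))\<^sup>2 \<le> (sqrt (\<Sum>t\<in>tys d n. (cmod (s k t))\<^sup>2 / tyn d n t))\<^sup>2"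
      by (intro power_mono) auto
    also have "\<dots> = (\<Sum>t\<in>tys d n. (cmod (s k t))\<^sup>2 / tyn d n t)"
      using pos by (intro real_sqrt_pow2 sum_nonneg divide_nonneg_pos) auto
    finally show ?thesis .
  qed
  then have "nsq (X *\<^sub>v v) \<le> (\<Sum>k<?N. \<Sum>t\<in>tys d n. (cmod (s k t))\<^sup>2 / tyn d n t)"
    using Xc unfolding nsq_def by (auto intro!: sum_mono)
  then show ?thesis unfolding usym_quadratic[OF v] s_def by simp
qed

lemma psd_minusI:
  assumes "hermitian d A" "hermitian d B" "\<And>v. v \<in> carrier_vec d \<Longrightarrow> Re (ip v (A *\<^sub>v v)) \<le> Re (ip v (B *\<^sub>v v))"
  shows "psd d (B - A)"
  unfolding psd_def_ip
proof (intro conjI ballI)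
  have c: "A \<in> carrier_mat d d" "B \<in> carrier_mat d d" using assms by auto
  fix v :: "complex vec" assume v: "v \<in> carrier_vec d"
  have "ip v ((B - A) *\<^sub>v v) = ip v (B *\<^sub>v v) - ip v (A *\<^sub>v v)"
    unfolding minus_mult_distrib_mat_vec[OF c(2,1) v]
    by (rule ip_minus_right[OF v mult_vec_sq[OF c(2) v] mult_vec_sq[OF c(1) v]])
  then show "0 \<le> Re (ip v ((B - A) *\<^sub>v v))" using assms(3)[OF v] by simp
qed (use assms hermitian_minus in auto)

lemma adj_sandwich_sq:
  assumes "unitary d V" "A \<in> carrier_mat d d" "B \<in> carrier_mat d d"
  shows "V * A * adj V * (V * B * adj V) = V * (A * B) * adj V"
  using assms by (simp add: assoc_sq[of _ d] mult_carrier_sq[of _ d] unitary_cancel_left)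

text \<open>The square root of a symmetric state is again permutation invariant, hence a combination of the
  joint type indicators; Cauchy-Schwarz over the types gives the domination.\<close>

theorem universal_symmetric_operator:
  assumes U: "unitary d U"
  shows "\<exists>\<Omega>. psd (d ^ n) \<Omega> \<and> \<Omega> * tpow (spec d U f) n = tpow (spec d U f) n * \<Omega>
    \<and> Re (mtrace \<Omega>) \<le> real ((n + 1) ^ (d * d)) \<and> (\<forall>\<sigma>. sym_density d n \<sigma> \<longrightarrow> psd (d ^ n) (\<Omega> - \<sigma>))"
proof -
  let ?N = "d ^ n"
  \<comment> \<open>\<open>usym\<close> commutes with powers that are diagonal in the standard
    basis, so it is rotated into the given eigenbasis. Tensor powers commute with all permutations,
    hence the rotation preserves symmetric states and with them the domination.\<close>
  define V where "V = tpow U n"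
  have V: "unitary ?N V" unfolding V_def by (rule unitary_tpow[OF U])
  have Vc: "V \<in> carrier_mat ?N ?N" using V by simp
  define \<Omega> where "\<Omega> = V * usym d n * adj V"
  have "psd ?N (adj (adj V) * usym d n * adj V)" by (rule psd_sandwich[OF psd_usym]) (use Vc in auto)
  then have psd: "psd ?N \<Omega>" by (simp add: \<Omega>_def)
  have tp: "tpow (spec d U f) n = V * dg ?N (pw d f n) * adj V"
    unfolding tpow_spec[OF U] by (simp add: spec_def V_def)
  have com: "\<Omega> * tpow (spec d U f) n = tpow (spec d U f) n * \<Omega>"
    unfolding tp \<Omega>_def by (simp add: adj_sandwich_sq[OF V] usym_commute_pw)
  have "mtrace \<Omega> = mtrace (adj V * (V * usym d n))"
    unfolding \<Omega>_def by (rule mtrace_comm[of _ ?N ?N]) (use Vc in \<open>auto simp: mult_carrier_sq\<close>)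
  also have "\<dots> = real (card (tys d n))" by (simp add: unitary_cancel_left[OF V usym_carrier] mtrace_usym)
  finally have tr: "Re (mtrace \<Omega>) \<le> real ((n + 1) ^ (d * d))" using card_tys[of d n] by (metis Re_complex_of_real of_nat_le_iff)
  have "psd ?N (\<Omega> - \<sigma>)" if s: "sym_density d n \<sigma>" for \<sigma>
  proof -
    have d: "psd ?N \<sigma>" "mtrace \<sigma> = 1" using s by (auto simp: sym_density_def density_def)
    have \<sigma>c: "\<sigma> \<in> carrier_mat ?N ?N" using d by simp
    define \<tau> where "\<tau> = adj V * \<sigma> * V"
    have \<tau>: "psd ?N \<tau>" unfolding \<tau>_def by (rule psd_sandwich[OF d(1) Vc])
    have \<tau>c: "\<tau> \<in> carrier_mat ?N ?N" using \<tau> by simp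
    have \<sigma>_eq: "\<sigma> = V * \<tau> * adj V"
      using V Vc \<sigma>c unfolding \<tau>_def by (simp add: assoc_sq[of _ ?N] mult_carrier_sq[of _ ?N] unitary_cancel_left)
        (simp add: unitary_def)
    have "mtrace \<tau> = mtrace (V * (adj V * \<sigma>))" unfolding \<tau>_def
      by (rule mtrace_comm[of _ ?N ?N]) (use Vc \<sigma>c in \<open>auto simp: mult_carrier_sq\<close>)
    then have tr\<tau>: "mtrace \<tau> = 1" using d by (simp add: unitary_cancel_left[OF V \<sigma>c])
    obtain W g where W: "unitary ?N W" "\<And>i. i < ?N \<Longrightarrow> 0 \<le> g i" "\<tau> = spec ?N W g"
      using psd_spectral[OF \<tau>] by blast
    define X where "X = spec ?N W (\<lambda>i. sqrt (g i))"
    have XX: "X * X = \<tau>" unfolding X_def spec_mult[OF W(1)] W(3) using W(2) by (intro spec_cong) simp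
    have X: "hermitian ?N X" unfolding X_def by (rule hermitian_spec[OF W(1)])
    have Xc: "X \<in> carrier_mat ?N ?N" using X by simp
    have inv: "perm_op d n \<pi> * X = X * perm_op d n \<pi>" if \<pi>: "\<pi> permutes {..<n}" for \<pi>
    proof -
      let ?P = "perm_op d n \<pi>"
      have Pc: "?P \<in> carrier_mat ?N ?N" using \<pi> by simp
      have P: "unitary ?N ?P" by (rule unitary_perm_op[OF \<pi>])
      have "?P * \<sigma> * adj ?P * ?P = \<sigma> * ?P" using s \<pi> by (simp add: sym_density_def)
      then have P\<sigma>: "?P * \<sigma> = \<sigma> * ?P"
        using P Pc \<sigma>c by (simp add: assoc_sq[of _ ?N] mult_carrier_sq[of _ ?N]) (simp add: unitary_def)
      have PV: "?P * V = V * ?P" unfolding V_def by (rule perm_op_tpow[OF \<pi>]) (use U in simp)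
      have PV': "?P * adj V = adj V * ?P"
      proof -
        have "?P * adj V = adj V * (V * (?P * adj V))" using V Pc Vc by (simp add: unitary_cancel_left mult_carrier_sq[of _ ?N])
        also have "V * (?P * adj V) = ?P * V * adj V" unfolding PV using Vc Pc by (simp add: assoc_sq[of _ ?N])
        also have "\<dots> = ?P" using V Vc Pc by (simp add: assoc_sq[of _ ?N]) (simp add: unitary_def)
        finally show ?thesis .
      qed
      have "?P * \<tau> = ?P * adj V * (\<sigma> * V)" unfolding \<tau>_def using Vc Pc \<sigma>c by (simp add: assoc_sq[of _ ?N] mult_carrier_sq[of _ ?N])
      also have "\<dots> = adj V * (?P * \<sigma> * V)" unfolding PV' using Vc Pc \<sigma>c by (simp add: assoc_sq[of _ ?N] mult_carrier_sq[of _ ?N])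
      also have "\<dots> = adj V * (\<sigma> * (?P * V))" unfolding P\<sigma> using Vc Pc \<sigma>c by (simp add: assoc_sq[of _ ?N] mult_carrier_sq[of _ ?N])
      also have "\<dots> = \<tau> * ?P" unfolding PV \<tau>_def using Vc Pc \<sigma>c by (simp add: assoc_sq[of _ ?N] mult_carrier_sq[of _ ?N])
      finally have "spec ?N W g * ?P = ?P * spec ?N W g" using W(3) by simp
      then have "spec ?N W (\<lambda>i. sqrt (g i)) * ?P = ?P * spec ?N W (\<lambda>i. sqrt (g i))"
        by (rule spec_intertwine[OF W(1) W(1) Pc])
      then show ?thesis by (simp add: X_def)
    qed
    have "psd ?N (usym d n - \<tau>)"
    proof (rule psd_minusI[OF psd_hermitian[OF \<tau>] hermitian_usym])
      fix v :: "complex vec" assume v: "v \<in> carrier_vec ?N"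
      have "ip v (\<tau> *\<^sub>v v) = ip (X *\<^sub>v v) (X *\<^sub>v v)"
        unfolding XX[symmetric] assoc_mult_mat_vec[OF Xc Xc v]
        using ip_mult_mat[OF Xc v mult_vec_sq[OF Xc v]] hermitian_adj[OF X] by simp
      then show "Re (ip v (\<tau> *\<^sub>v v)) \<le> Re (ip v (usym d n *\<^sub>v v))"
        using usym_dominates[OF X _ inv v] XX tr\<tau> by (simp add: ip_self)
    qed
    then have "psd ?N (adj (adj V) * (usym d n - \<tau>) * adj V)" by (rule psd_sandwich) (use Vc in auto)
    moreover have "V * (usym d n - \<tau>) * adj V = \<Omega> - \<sigma>"
      unfolding \<Omega>_def \<sigma>_eq using Vc \<tau>c
      by (simp add: mult_minus_distrib_mat[of _ ?N ?N _ ?N] minus_mult_distrib_mat[of _ ?N ?N _ _ ?N] mult_carrier_sq[of _ ?N])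
    ultimately show ?thesis by simp
  qed
  then show ?thesis using psd com tr by blast
qed

text \<open>\<open>K\<close> is the spectral projection of \<Omega> - c S onto its nonpositive part
  and commutes with S because \<Omega> does. On the complement \<Omega> - c S is positive, so c tr
  (S (1 - K)) <= tr (\<Omega> (1 - K)) <= tr \<Omega>, which is Markov's inequality.\<close>

lemma threshold_projection:
  assumes \<Omega>: "psd d \<Omega>" and S: "psd d S" and com: "\<Omega> * S = S * \<Omega>"
  shows "\<exists>K. proj d K \<and> K * S = S * K \<and> psd d (complex_of_real c \<cdot>\<^sub>m (K * S * K) - K * \<Omega> * K)
     \<and> c * Re (mtrace (S * (1\<^sub>m d - K))) \<le> Re (mtrace \<Omega>)"
proof -
  have c: "\<Omega> \<in> carrier_mat d d" "S \<in> carrier_mat d d" using assms by auto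
  define H where "H = \<Omega> - complex_of_real c \<cdot>\<^sub>m S"
  have Hc: "H \<in> carrier_mat d d" unfolding H_def by (rule minus_carrier_mat) (use c in auto)
  have "hermitian d H" unfolding H_def
    by (intro hermitian_minus psd_hermitian[OF \<Omega>]) (use psd_hermitian[OF S] in \<open>auto simp: hermitian_def adj_smult\<close>)
  then obtain U h where U: "unitary d U" and H: "H = spec d U h" using spectral_theorem by blast
  define K where "K = spec d U (\<lambda>i. of_bool (h i \<le> 0))"
  have K: "proj d K" unfolding K_def by (rule proj_spec[OF U])
  have Kc: "K \<in> carrier_mat d d" using K by simp
  have K': "psd d (1\<^sub>m d - K)" "1\<^sub>m d - K \<in> carrier_mat d d" using proj_psd[OF proj_compl[OF K]] Kc by auto
  have "H * S = S * H" unfolding H_def using c com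
    by (simp add: mult_minus_distrib_mat[of _ d d _ d] minus_mult_distrib_mat[of _ d d _ _ d]
       mult_smult_distrib[of _ d d _ d] mult_smult_assoc_mat[of _ d d _ d])
  then have KS: "K * S = S * K"
    unfolding H K_def using spec_intertwine[OF U U c(2), of h h "\<lambda>x. of_bool (x \<le> 0)"] by simp
  have "complex_of_real c \<cdot>\<^sub>m (K * S * K) - K * \<Omega> * K = K * (complex_of_real c \<cdot>\<^sub>m S - \<Omega>) * K"
    using c Kc by (simp add: mult_minus_distrib_mat[of _ d d _ d] minus_mult_distrib_mat[of _ d d _ _ d]
       mult_smult_distrib[of _ d d _ d] mult_smult_assoc_mat[of _ d d _ d] mult_carrier_sq[of _ d])
  also have "complex_of_real c \<cdot>\<^sub>m S - \<Omega> = complex_of_real (-1) \<cdot>\<^sub>m H"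
    unfolding H_def using c by (intro eq_matI) auto
  also have "\<dots> = spec d U (\<lambda>i. - 1 * h i)" unfolding H by (rule spec_smult[OF U])
  also have "K * \<dots> * K = spec d U (\<lambda>i. of_bool (h i \<le> 0) * (- 1 * h i) * of_bool (h i \<le> 0))"
    unfolding K_def by (simp only: spec_mult[OF U])
  finally have 1: "psd d (complex_of_real c \<cdot>\<^sub>m (K * S * K) - K * \<Omega> * K)"
    using psd_spec[OF U, of "\<lambda>i. of_bool (h i \<le> 0) * (- 1 * h i) * of_bool (h i \<le> 0)"] by simp
  have "1\<^sub>m d - K = spec d U (\<lambda>i. 1 - of_bool (h i \<le> 0))" unfolding K_def
    using spec_minus[OF U, of "\<lambda>_. 1"] by (simp add: spec_one[OF U])
  then have "mtrace (H * (1\<^sub>m d - K)) = complex_of_real (\<Sum>i<d. h i * (1 - of_bool (h i \<le> 0)))"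
    unfolding H by (simp add: spec_mult[OF U] mtrace_spec[OF U])
  moreover have "0 \<le> (\<Sum>i<d. h i * (1 - of_bool (h i \<le> 0)))" by (intro sum_nonneg) auto
  ultimately have "0 \<le> Re (mtrace (H * (1\<^sub>m d - K)))" by simp
  moreover have "mtrace (H * (1\<^sub>m d - K)) = mtrace (\<Omega> * (1\<^sub>m d - K)) - complex_of_real c * mtrace (S * (1\<^sub>m d - K))"
    unfolding H_def using c K'(2)
    by (simp add: minus_mult_distrib_mat[of _ d d _ _ d] mult_smult_assoc_mat[of _ d d _ d]
        mtrace_minus[of _ d] mtrace_smult[of _ d] mult_carrier_sq[of _ d])
  moreover have "0 \<le> Re (mtrace (\<Omega> * K))" by (rule psd_trace_mult_nonneg[OF \<Omega> proj_psd[OF K]])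
  moreover have "mtrace (\<Omega> * (1\<^sub>m d - K)) = mtrace \<Omega> - mtrace (\<Omega> * K)"
    using c Kc by (simp add: mult_minus_distrib_mat[of _ d d _ d] mtrace_minus[of _ d] mult_carrier_sq[of _ d] right_mult_one_mat[of _ d d])
  ultimately have "c * Re (mtrace (S * (1\<^sub>m d - K))) \<le> Re (mtrace \<Omega>)" by simp
  then show ?thesis using K KS 1 by blast
qed

section \<open>One-shot tests\<close>

lemma mat_eq_by_vec:
  assumes A: "A \<in> carrier_mat d d" and B: "B \<in> carrier_mat d d"
    and eq: "\<And>v. v \<in> carrier_vec d \<Longrightarrow> A *\<^sub>v v = B *\<^sub>v v"
  shows "A = (B :: complex mat)"
proof (rule eq_matI)
  fix i j assume "i < dim_row B" "j < dim_col B"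
  then have ij: "i < d" "j < d" using B by auto
  have e: "(M *\<^sub>v unit_vec d j) $ i = M $$ (i, j)" if "M \<in> carrier_mat d d" for M :: "complex mat"
    unfolding mult_mat_vec_nth[OF that unit_vec_carrier ij(1)]
    using ij by (simp add: if_distrib[of "\<lambda>x. _ * x"] cong: if_cong)
  show "A $$ (i, j) = B $$ (i, j)" using e[OF A] e[OF B] eq[of "unit_vec d j"] by simp
qed (use A B in auto)

definition rk1 :: "nat \<Rightarrow> complex vec \<Rightarrow> complex mat" where
  "rk1 d r = mat d d (\<lambda>(i, j). r $ i * cnj (r $ j))"

lemma rk1_carrier [simp]: "rk1 d r \<in> carrier_mat d d"
  by (simp add: rk1_def)

lemma rk1_mult_vec: "r \<in> carrier_vec d \<Longrightarrow> v \<in> carrier_vec d \<Longrightarrow> rk1 d r *\<^sub>v v = ip r v \<cdot>\<^sub>v r"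
proof (rule eq_vecI)
  assume r: "r \<in> carrier_vec d" and v: "v \<in> carrier_vec d"
  fix i assume "i < dim_vec (ip r v \<cdot>\<^sub>v r)"
  then have i: "i < d" using r by simp
  show "(rk1 d r *\<^sub>v v) $ i = (ip r v \<cdot>\<^sub>v r) $ i"
    unfolding mult_mat_vec_nth[OF rk1_carrier v i]
    using i r by (simp add: rk1_def ip_def sum_distrib_left sum_distrib_right mult_ac)
qed (auto simp: rk1_def)

lemma mtrace_mult_rk1:
  assumes "A \<in> carrier_mat d d" "r \<in> carrier_vec d"
  shows "mtrace (A * rk1 d r) = ip r (A *\<^sub>v r)"
  using assms(2) unfolding mtrace_mult_eq_sum[OF assms(1) rk1_carrier]
  by (simp add: ip_def mult_mat_vec_nth[OF assms] rk1_def sum_distrib_left mult_ac carrier_vecD[OF assms(2)] del: index_mult_mat_vec)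

lemma smult_vec_closed': "v \<in> carrier_vec d \<Longrightarrow> c \<cdot>\<^sub>v v \<in> carrier_vec d"
  by simp

text \<open>Since \<open>T0\<close> annihilates \<open>r\<close>, adding the normalised rank-one
  projection on \<open>r\<close> enlarges the range by one orthogonal direction.\<close>

lemma proj_extend:
  assumes T0: "proj d T0" and r: "r \<in> carrier_vec d" and T0r: "T0 *\<^sub>v r = 0\<^sub>v d" and nz: "nsq r \<noteq> 0"
  defines "T \<equiv> T0 + complex_of_real (1 / nsq r) \<cdot>\<^sub>m rk1 d r"
  shows "proj d T" "\<And>v. v \<in> carrier_vec d \<Longrightarrow> T *\<^sub>v v = T0 *\<^sub>v v + (ip r v / nsq r) \<cdot>\<^sub>v r"
    "\<And>v. v \<in> carrier_vec d \<Longrightarrow> ip r (T0 *\<^sub>v v) = 0"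
proof -
  have T0c: "T0 \<in> carrier_mat d d" using T0 by simp
  have Rc: "complex_of_real (1 / nsq r) \<cdot>\<^sub>m rk1 d r \<in> carrier_mat d d" by simp
  have Tc: "T \<in> carrier_mat d d" unfolding T_def by (rule add_carrier_mat[OF Rc])
  show 1: "T *\<^sub>v v = T0 *\<^sub>v v + (ip r v / nsq r) \<cdot>\<^sub>v r" if v: "v \<in> carrier_vec d" for v
    unfolding T_def add_mult_distrib_mat_vec[OF T0c Rc v] smult_mat_vec[OF rk1_carrier v] rk1_mult_vec[OF r v]
    by (simp add: smult_smult_assoc)
  show 2: "ip r (T0 *\<^sub>v v) = 0" if v: "v \<in> carrier_vec d" for v
    using ip_mult_mat[OF T0c r v] proj_adj[OF T0] T0r by (simp add: ip_def)
  have "T * T = T"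
  proof (rule mat_eq_by_vec)
    fix v :: "complex vec" assume v: "v \<in> carrier_vec d"
    let ?c = "ip r v / nsq r"
    have t0v: "T0 *\<^sub>v v \<in> carrier_vec d" by (rule mult_vec_sq[OF T0c v])
    have cr: "?c \<cdot>\<^sub>v r \<in> carrier_vec d" using r by simp
    have Tv: "T *\<^sub>v v \<in> carrier_vec d" by (rule mult_vec_sq[OF Tc v])
    have "T0 *\<^sub>v (T *\<^sub>v v) = T0 *\<^sub>v (T0 *\<^sub>v v)"
      unfolding 1[OF v] mult_add_distrib_mat_vec[OF T0c t0v cr] mult_mat_vec[OF T0c r] T0r
      using t0v T0c by auto
    also have "\<dots> = T0 *\<^sub>v v" using T0 unfolding assoc_mult_mat_vec[OF T0c T0c v, symmetric] by (simp add: proj_def)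
    finally have a: "T0 *\<^sub>v (T *\<^sub>v v) = T0 *\<^sub>v v" .
    have "ip r (T *\<^sub>v v) = ip r v"
      unfolding 1[OF v] ip_add_right[OF r t0v cr] ip_smult_right[OF r r] 2[OF v] ip_self using nz by simp
    then have "T *\<^sub>v (T *\<^sub>v v) = T *\<^sub>v v" unfolding 1[OF Tv] a using 1[OF v] by simp
    then show "(T * T) *\<^sub>v v = T *\<^sub>v v" by (simp add: assoc_mult_mat_vec[OF Tc Tc v])
  qed (use Tc in \<open>auto simp: mult_carrier_sq\<close>)
  moreover have "adj T = T"
  proof -
    have "adj (rk1 d r) = rk1 d r" by (rule eq_matI) (auto simp: rk1_def)
    then show ?thesis unfolding T_def adj_add[OF T0c Rc] adj_smult proj_adj[OF T0] by simp
  qed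
  ultimately show "proj d T" using Tc unfolding proj_def hermitian_def by blast
qed

text \<open>Gram-Schmidt along the increasing chain of ranges: the vector added at an index stays in the range of its
  projection, where the quadratic form of the traced matrix is bounded by assumption.\<close>

lemma nested_test:
  fixes w :: "nat \<Rightarrow> complex vec" and b p :: "nat \<Rightarrow> real"
  assumes \<omega>: "\<omega> \<in> carrier_mat N N"
    and Qc: "\<And>i. i < N \<Longrightarrow> Q i \<in> carrier_mat N N"
    and nested: "\<And>i m. i < N \<Longrightarrow> m < N \<Longrightarrow> p i \<le> p m \<Longrightarrow> Q m * Q i = Q i"
    and w: "\<And>i. i < N \<Longrightarrow> w i \<in> carrier_vec N" "\<And>i. i < N \<Longrightarrow> Q i *\<^sub>v w i = w i"
    and b: "\<And>i. i < N \<Longrightarrow> 0 \<le> b i"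
    and bound: "\<And>i v. i < N \<Longrightarrow> v \<in> carrier_vec N \<Longrightarrow> Q i *\<^sub>v v = v \<Longrightarrow> Re (ip v (\<omega> *\<^sub>v v)) \<le> b i * nsq v"
  shows "\<exists>T. proj N T \<and> (\<forall>i<N. T *\<^sub>v w i = w i) \<and> Re (mtrace (\<omega> * T)) \<le> (\<Sum>i<N. b i)"
proof -
  \<comment> \<open>The last conjunct carries the induction: the range of \<open>T\<close> lies in
    the range of \<open>Q m\<close> for every \<open>m\<close> ranked at or above all treated
    indices, so the next residual vector lies there too.\<close>
  define P where "P I \<longleftrightarrow> (I \<subseteq> {..<N} \<longrightarrow> (\<exists>T. proj N T \<and> (\<forall>i\<in>I. T *\<^sub>v w i = w i) \<and> Re (mtrace (\<omega> * T)) \<le> (\<Sum>i\<in>I. b i)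
     \<and> (\<forall>m<N. (\<forall>i\<in>I. p i \<le> p m) \<longrightarrow> Q m * T = T)))" for I
  have "P {..<N}"
  \<comment> \<open>This rule inserts the indices in order of increasing \<open>p\<close>, the order
    in which \<open>nested\<close> makes the ranges grow.\<close>
  proof (rule finite_ranking_induct[where f = p])
    have "proj N (0\<^sub>m N N)" by (auto simp: proj_def hermitian_def intro!: eq_matI)
    moreover have "\<omega> * 0\<^sub>m N N = 0\<^sub>m N N" using \<omega> by simp
    moreover have "Q m * 0\<^sub>m N N = 0\<^sub>m N N" if "m < N" for m using Qc[OF that] by simp
    ultimately show "P {}" unfolding P_def by (auto intro!: exI[of _ "0\<^sub>m N N"] simp: mtrace_def carrier_matD[OF \<omega>])
  next
    fix x I assume fin: "finite I" and mx: "\<And>y. y \<in> I \<Longrightarrow> p y \<le> p x" and IH: "P I"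
    show "P (insert x I)"
    proof (cases "x \<in> I")
      case True
      then show ?thesis using IH by (simp add: insert_absorb)
    next
      case xI: False
      show ?thesis unfolding P_def
      proof
        assume sub: "insert x I \<subseteq> {..<N}"
        then have x: "x < N" and I: "I \<subseteq> {..<N}" by auto
        from IH I obtain T0 where T0: "proj N T0" "\<And>i. i \<in> I \<Longrightarrow> T0 *\<^sub>v w i = w i"
          "Re (mtrace (\<omega> * T0)) \<le> (\<Sum>i\<in>I. b i)" and QT0: "\<And>m. m < N \<Longrightarrow> (\<And>i. i \<in> I \<Longrightarrow> p i \<le> p m) \<Longrightarrow> Q m * T0 = T0"
          unfolding P_def by blast
        have T0c: "T0 \<in> carrier_mat N N" using T0 by simp
        \<comment> \<open>The component of \<open>w x\<close> orthogonal to the range built so far;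
          if it vanishes, the test is left unchanged.\<close>
        define r where "r = w x - T0 *\<^sub>v w x"
        have t0w: "T0 *\<^sub>v w x \<in> carrier_vec N" by (rule mult_vec_sq[OF T0c w(1)[OF x]])
        have r: "r \<in> carrier_vec N" unfolding r_def using w(1)[OF x] t0w by simp
        have wx: "w x = T0 *\<^sub>v w x + r" unfolding r_def using w(1)[OF x] by (intro eq_vecI) (auto simp: carrier_matD[OF T0c])
        have T0T0: "T0 *\<^sub>v (T0 *\<^sub>v w x) = T0 *\<^sub>v w x"
          using T0(1) unfolding assoc_mult_mat_vec[OF T0c T0c w(1)[OF x], symmetric] by (simp add: proj_def)
        have T0r: "T0 *\<^sub>v r = 0\<^sub>v N"
          unfolding r_def mult_minus_distrib_mat_vec[OF T0c w(1)[OF x] t0w] T0T0 by (rule minus_cancel_vec[OF t0w])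
        have Qr: "Q m *\<^sub>v r = r" if m: "m < N" and le: "\<And>i. i \<in> insert x I \<Longrightarrow> p i \<le> p m" for m
        proof -
          have "Q m *\<^sub>v w x = Q m *\<^sub>v (Q x *\<^sub>v w x)" using w(2)[OF x] by simp
          also have "\<dots> = w x" using nested[OF x m] le w(2)[OF x]
            unfolding assoc_mult_mat_vec[OF Qc[OF m] Qc[OF x] w(1)[OF x], symmetric] by simp
          finally have a: "Q m *\<^sub>v w x = w x" .
          have b: "Q m *\<^sub>v (T0 *\<^sub>v w x) = T0 *\<^sub>v w x"
            unfolding assoc_mult_mat_vec[OF Qc[OF m] T0c w(1)[OF x], symmetric] using QT0[OF m] le by simp
          show ?thesis unfolding r_def mult_minus_distrib_mat_vec[OF Qc[OF m] w(1)[OF x] t0w] a b ..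
        qed
        show "\<exists>T. proj N T \<and> (\<forall>i\<in>insert x I. T *\<^sub>v w i = w i) \<and> Re (mtrace (\<omega> * T)) \<le> (\<Sum>i\<in>insert x I. b i)
            \<and> (\<forall>m<N. (\<forall>i\<in>insert x I. p i \<le> p m) \<longrightarrow> Q m * T = T)"
        proof (cases "nsq r = 0")
          case True
          then have "r = 0\<^sub>v N" using nsq_eq_0[OF r] by simp
          then have "T0 *\<^sub>v w x = w x" using wx t0w by simp
          moreover have "(\<Sum>i\<in>I. b i) \<le> (\<Sum>i\<in>insert x I. b i)" using fin xI b[OF x] by simp
          ultimately show ?thesis using T0 QT0 by (intro exI[of _ T0]) auto
        next
          case nz: False
          define T where "T = T0 + complex_of_real (1 / nsq r) \<cdot>\<^sub>m rk1 N r"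
          note ext = proj_extend[OF T0(1) r T0r nz, folded T_def]
          have Tc: "T \<in> carrier_mat N N" using ext(1) by simp
          have "T *\<^sub>v w i = w i" if i: "i \<in> insert x I" for i
          proof (cases "i = x")
            case True
            have "ip r (w x) = nsq r"
              by (subst wx) (simp add: ip_add_right[OF r t0w r] ext(3)[OF w(1)[OF x]] ip_self)
            then show ?thesis using True ext(2)[OF w(1)[OF x]] nz wx by simp
          next
            case False
            then have iI: "i \<in> I" and iN: "i < N" using i I by auto
            have "ip r (w i) = 0" using ext(3)[OF w(1)[OF iN]] T0(2)[OF iI] by simp
            then have "T *\<^sub>v w i = T0 *\<^sub>v w i + 0 \<cdot>\<^sub>v r" using ext(2)[OF w(1)[OF iN]] by simp
            also have "\<dots> = w i" unfolding T0(2)[OF iI] using r w(1)[OF iN] by (intro eq_vecI) auto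
            finally show ?thesis .
          qed
          moreover have "Re (mtrace (\<omega> * T)) \<le> (\<Sum>i\<in>insert x I. b i)"
          proof -
            have "mtrace (\<omega> * T) = mtrace (\<omega> * T0) + complex_of_real (1 / nsq r) * ip r (\<omega> *\<^sub>v r)"
              unfolding T_def mult_add_distrib_mat[OF \<omega> T0c smult_carrier_mat[OF rk1_carrier]]
                mult_smult_distrib[OF \<omega> rk1_carrier]
              by (simp add: mtrace_add[of _ N] mtrace_smult[of _ N] mult_carrier_sq[OF \<omega>] T0c mtrace_mult_rk1[OF \<omega> r])
            then have "Re (mtrace (\<omega> * T)) = Re (mtrace (\<omega> * T0)) + Re (ip r (\<omega> *\<^sub>v r)) / nsq r"
              by simp
            \<comment> \<open>The new direction raises the trace by the Rayleigh quotient of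
              \<omega> at \<open>r\<close>, which \<open>bound\<close> controls because
              \<open>Q x\<close> fixes \<open>r\<close>.\<close>
            moreover have "Re (ip r (\<omega> *\<^sub>v r)) / nsq r \<le> b x"
            proof -
              have "Q x *\<^sub>v r = r" by (rule Qr[OF x]) (use mx in auto)
              moreover have "0 < nsq r" using nz nsq_nonneg[of r] by linarith
              ultimately show ?thesis using bound[OF x r] by (simp add: divide_le_eq)
            qed
            ultimately show ?thesis using T0(3) fin xI by simp
          qed
          moreover have "Q m * T = T" if m: "m < N" and le: "\<forall>i\<in>insert x I. p i \<le> p m" for m
          proof (rule mat_eq_by_vec)
            fix v :: "complex vec" assume v: "v \<in> carrier_vec N"
            have a: "Q m *\<^sub>v (T0 *\<^sub>v v) = T0 *\<^sub>v v"
              unfolding assoc_mult_mat_vec[OF Qc[OF m] T0c v, symmetric] using QT0[OF m] le by simp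
            have b: "Q m *\<^sub>v r = r" using Qr[OF m] le by blast
            have "Q m *\<^sub>v (T *\<^sub>v v) = T *\<^sub>v v"
              unfolding ext(2)[OF v] mult_add_distrib_mat_vec[OF Qc[OF m] mult_vec_sq[OF T0c v] smult_vec_closed'[OF r]]
                mult_mat_vec[OF Qc[OF m] r] a b ..
            then show "(Q m * T) *\<^sub>v v = T *\<^sub>v v" by (simp add: assoc_mult_mat_vec[OF Qc[OF m] Tc v])
          qed (use Qc[OF m] Tc in \<open>auto simp: mult_carrier_sq\<close>)
          ultimately show ?thesis using ext(1) by blast
        qed
      qed
    qed
  qed simp
  then show ?thesis unfolding P_def by auto
qed

lemma proj_pythagoras:
  assumes P: "proj d P" and v: "v \<in> carrier_vec d"
  shows "nsq v = nsq (P *\<^sub>v v) + nsq ((1\<^sub>m d - P) *\<^sub>v v)"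
proof -
  have c: "P \<in> carrier_mat d d" using P by simp
  have "(1\<^sub>m d - P) *\<^sub>v v = v - P *\<^sub>v v"
    using minus_mult_distrib_mat_vec[OF one_carrier_mat c v] v by simp
  then have "ip v ((1\<^sub>m d - P) *\<^sub>v v) = ip v v - ip v (P *\<^sub>v v)"
    using ip_minus_right[OF v v mult_vec_sq[OF c v]] by simp
  then have "complex_of_real (nsq v) = complex_of_real (nsq (P *\<^sub>v v) + nsq ((1\<^sub>m d - P) *\<^sub>v v))"
    by (simp add: proj_ip[OF P v] proj_ip[OF proj_compl[OF P] v] ip_self)
  then show ?thesis by (metis of_real_eq_iff)
qed

lemma proj_nsq_le: "proj d P \<Longrightarrow> v \<in> carrier_vec d \<Longrightarrow> nsq (P *\<^sub>v v) \<le> nsq v"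
  using proj_pythagoras nsq_nonneg by fastforce

lemma proj_spec_nsq:
  assumes "unitary d F" "v \<in> carrier_vec d"
  shows "nsq (spec d F (\<lambda>j. of_bool (Q j)) *\<^sub>v v) = (\<Sum>j<d. of_bool (Q j) * (cmod (ip (col F j) v))\<^sup>2)"
proof -
  have "complex_of_real (nsq (spec d F (\<lambda>j. of_bool (Q j)) *\<^sub>v v)) = complex_of_real (\<Sum>j<d. of_bool (Q j) * (cmod (ip (col F j) v))\<^sup>2)"
    unfolding proj_ip[OF proj_spec[OF assms(1)] assms(2), symmetric] by (rule ip_spec[OF assms])
  then show ?thesis by (metis of_real_eq_iff)
qed

lemma unitary_col_carrier: "unitary d U \<Longrightarrow> i < d \<Longrightarrow> col U i \<in> carrier_vec d"
  using unitary_carrier[of d U] by auto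

text \<open>On the range of \<open>Q i\<close>, the vectors fixed by \<open>K\<close> and supported
  on eigenvalues \<open>q j \<le> L * p i\<close>, the form of \<omega> is at most c times that of
  \<open>spec N F q\<close>, hence at most \<open>c * L * p i\<close>; these bounds add up to the
  error. As for success, \<open>T\<close> fixes the projection of each eigenvector to that range,
  and restricting to \<open>K\<close> costs no more than the weight of its complement.\<close>

lemma test_achievability:
  assumes U: "unitary N U" and F: "unitary N F" and p: "\<And>i. i < N \<Longrightarrow> 0 \<le> p i"
    and \<omega>: "\<omega> \<in> carrier_mat N N" and K: "proj N K" and KS: "K * spec N F q = spec N F q * K"
    and le: "psd N (complex_of_real c \<cdot>\<^sub>m (K * spec N F q * K) - K * \<omega> * K)"
    and c: "0 \<le> c" and L: "0 \<le> L"
  shows "\<exists>T. proj N T \<and> Re (mtrace (\<omega> * T)) \<le> c * L * (\<Sum>i<N. p i) \<and>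
    (\<Sum>i<N. \<Sum>j<N. p i * (cmod (ip (col F j) (col U i)))\<^sup>2 * of_bool (q j \<le> L * p i))
      - Re (mtrace (spec N U p * (1\<^sub>m N - K))) \<le> Re (mtrace (spec N U p * T))"
proof -
  define S where "S = spec N F q"
  define Pi where "Pi i = spec N F (\<lambda>j. of_bool (q j \<le> L * p i))" for i
  define Q where "Q i = K * Pi i" for i
  have Kc: "K \<in> carrier_mat N N" using K by simp
  have KK: "K * K = K" using K by (simp add: proj_def)
  have Sc: "S \<in> carrier_mat N N" unfolding S_def using F by auto
  have Pi: "proj N (Pi i)" for i unfolding Pi_def by (rule proj_spec[OF F])
  have Pic: "Pi i \<in> carrier_mat N N" for i using Pi by simp
  have Qc: "Q i \<in> carrier_mat N N" for i unfolding Q_def by (rule mult_carrier_sq[OF Kc Pic])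
  have comm: "Pi i * K = K * Pi i" for i
    unfolding Pi_def using spec_intertwine[OF F F Kc KS[symmetric], of "\<lambda>x. of_bool (x \<le> L * p i)"] by simp
  have PiPi: "Pi m * Pi i = Pi i" if "p i \<le> p m" for i m
  proof -
    have "q j \<le> L * p m" if "q j \<le> L * p i" for j
      using that mult_left_mono[OF \<open>p i \<le> p m\<close> L] by linarith
    then show ?thesis unfolding Pi_def spec_mult[OF F] by (intro spec_cong) auto
  qed
  have QQ: "Q m * Q i = Q i" if "p i \<le> p m" for i m
  proof -
    have "Q m * Q i = K * (Pi m * K) * Pi i" unfolding Q_def using Kc Pic by (simp add: assoc_sq[of _ N] mult_carrier_sq[of _ N])
    also have "\<dots> = (K * K) * (Pi m * Pi i)" unfolding comm using Kc Pic by (simp add: assoc_sq[of _ N] mult_carrier_sq[of _ N])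
    finally show ?thesis by (simp add: KK PiPi[OF that] Q_def)
  qed
  have KQ: "K * Q i = Q i" for i
  proof -
    have "K * Q i = K * K * Pi i" unfolding Q_def by (rule assoc_sq[symmetric, OF Kc Kc Pic])
    then show ?thesis by (simp add: KK Q_def)
  qed
  have PQ: "Pi i * Q i = Q i" for i
  proof -
    have "Pi i * Q i = Pi i * (Pi i * K)" by (simp add: Q_def comm)
    also have "\<dots> = Pi i * Pi i * K" by (rule assoc_sq[symmetric, OF Pic Pic Kc])
    finally show ?thesis by (simp add: PiPi comm Q_def)
  qed
  define e where "e i = col U i" for i
  have e: "e i \<in> carrier_vec N" if "i < N" for i unfolding e_def by (rule unitary_col_carrier[OF U that])
  define w where "w i = Q i *\<^sub>v e i" for i
  have w: "w i \<in> carrier_vec N" if "i < N" for i unfolding w_def by (rule mult_vec_sq[OF Qc e[OF that]])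
  have Qproj: "proj N (Q i)" for i
  proof -
    have "adj (Q i) = Pi i * K" unfolding Q_def adj_mult[OF Kc Pic] by (simp add: proj_adj[OF K] proj_adj[OF Pi])
    then have "adj (Q i) = Q i" by (simp add: comm Q_def)
    then show ?thesis using QQ[of i i] Qc unfolding proj_def hermitian_def by blast
  qed
  have bound: "Re (ip v (\<omega> *\<^sub>v v)) \<le> (c * L * p i) * nsq v"
    if i: "i < N" and v: "v \<in> carrier_vec N" and Qv: "Q i *\<^sub>v v = v" for i v
  proof -
    have Kv: "K *\<^sub>v v = v" using KQ[of i] Qv assoc_mult_mat_vec[OF Kc Qc v, of i] by simp
    have Pv: "Pi i *\<^sub>v v = v" using PQ[of i] Qv assoc_mult_mat_vec[OF Pic Qc v, of i i] by simp
    have sw: "ip v ((K * A * K) *\<^sub>v v) = ip v (A *\<^sub>v v)" if A: "A \<in> carrier_mat N N" for A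
      unfolding assoc_mult_mat_vec[OF mult_carrier_sq[OF Kc A] Kc v] Kv assoc_mult_mat_vec[OF Kc A v]
        ip_mult_mat[OF Kc v mult_vec_sq[OF A v]] proj_adj[OF K] Kv ..
    have KAK: "K * A * K \<in> carrier_mat N N" if "A \<in> carrier_mat N N" for A
      by (intro mult_carrier_sq Kc that)
    have sK: "complex_of_real c \<cdot>\<^sub>m (K * S * K) \<in> carrier_mat N N" using KAK[OF Sc] by simp
    have "0 \<le> Re (ip v ((complex_of_real c \<cdot>\<^sub>m (K * S * K) - K * \<omega> * K) *\<^sub>v v))"
      using le v unfolding psd_def_ip S_def by blast
    also have "ip v ((complex_of_real c \<cdot>\<^sub>m (K * S * K) - K * \<omega> * K) *\<^sub>v v) = complex_of_real c * ip v (S *\<^sub>v v) - ip v (\<omega> *\<^sub>v v)"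
      unfolding minus_mult_distrib_mat_vec[OF sK KAK[OF \<omega>] v] ip_minus_right[OF v mult_vec_sq[OF sK v] mult_vec_sq[OF KAK[OF \<omega>] v]]
      unfolding smult_mat_vec[OF KAK[OF Sc] v] ip_smult_right[OF v mult_vec_sq[OF KAK[OF Sc] v]] sw[OF Sc] sw[OF \<omega>] ..
    finally have 1: "Re (ip v (\<omega> *\<^sub>v v)) \<le> c * Re (ip v (S *\<^sub>v v))" by simp
    have "ip v (S *\<^sub>v v) = ip v ((S * Pi i) *\<^sub>v v)" unfolding assoc_mult_mat_vec[OF Sc Pic v] Pv ..
    also have "\<dots> = complex_of_real (\<Sum>j<N. q j * of_bool (q j \<le> L * p i) * (cmod (ip (col F j) v))\<^sup>2)"
      unfolding S_def Pi_def spec_mult[OF F] by (rule ip_spec[OF F v])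
    finally have "Re (ip v (S *\<^sub>v v)) = (\<Sum>j<N. q j * of_bool (q j \<le> L * p i) * (cmod (ip (col F j) v))\<^sup>2)" by simp
    also have "\<dots> \<le> (\<Sum>j<N. (L * p i) * (cmod (ip (col F j) v))\<^sup>2)"
      using L p[OF i] by (intro sum_mono mult_right_mono) auto
    also have "\<dots> = L * p i * nsq v" by (simp add: parseval[OF F v] sum_distrib_left)
    finally show ?thesis using 1 mult_left_mono[OF _ c, of "Re (ip v (S *\<^sub>v v))" "L * p i * nsq v"] by (simp add: mult_ac)
  qed
  have "\<exists>T. proj N T \<and> (\<forall>i<N. T *\<^sub>v w i = w i) \<and> Re (mtrace (\<omega> * T)) \<le> (\<Sum>i<N. c * L * p i)"
  proof (rule nested_test[where Q = Q and p = p])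
    show "Q i *\<^sub>v w i = w i" if "i < N" for i
      unfolding w_def assoc_mult_mat_vec[OF Qc Qc e[OF that], symmetric] by (simp add: QQ)
    show "0 \<le> c * L * p i" if "i < N" for i using c L p[OF that] by simp
  qed (use \<omega> Qc QQ w bound in auto)
  then obtain T where T: "proj N T" "\<And>i. i < N \<Longrightarrow> T *\<^sub>v w i = w i" "Re (mtrace (\<omega> * T)) \<le> (\<Sum>i<N. c * L * p i)" by blast
  have Tc: "T \<in> carrier_mat N N" using T by simp
  have ineq: "(\<Sum>j<N. (cmod (ip (col F j) (e i)))\<^sup>2 * of_bool (q j \<le> L * p i)) - nsq ((1\<^sub>m N - K) *\<^sub>v e i) \<le> nsq (T *\<^sub>v e i)"
    if i: "i < N" for i
  proof -
    have ei: "e i \<in> carrier_vec N" by (rule e[OF i])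
    \<comment> \<open>As \<open>Q i\<close> is a projection and \<open>T\<close> fixes w_i, |w_i|^2
      = <e_i, w_i> = <T e_i, w_i>; Cauchy-Schwarz and cancellation give |w_i|^2 <= |T
      e_i|^2.\<close>
    have "complex_of_real (nsq (w i)) = ip (e i) (w i)" unfolding w_def by (rule proj_ip[OF Qproj ei, symmetric])
    also have "\<dots> = ip (e i) (T *\<^sub>v w i)" using T(2)[OF i] by simp
    also have "\<dots> = ip (T *\<^sub>v e i) (w i)" using ip_mult_mat[OF Tc ei w[OF i]] proj_adj[OF T(1)] by simp
    finally have "(nsq (w i))\<^sup>2 = (cmod (ip (T *\<^sub>v e i) (w i)))\<^sup>2" by (metis norm_of_real power2_abs)
    also have "\<dots> \<le> nsq (T *\<^sub>v e i) * nsq (w i)" by (rule Cauchy_Schwarz_ip[OF mult_vec_sq[OF Tc ei] w[OF i]])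
    finally have "nsq (w i) * nsq (w i) \<le> nsq (T *\<^sub>v e i) * nsq (w i)" by (simp add: power2_eq_square)
    then have 1: "nsq (w i) \<le> nsq (T *\<^sub>v e i)"
      using nsq_nonneg[of "w i"] nsq_nonneg[of "T *\<^sub>v e i"] by (metis mult_right_le_imp_le order_le_less)
    have K1c: "1\<^sub>m N - K \<in> carrier_mat N N" using proj_compl[OF K] by simp
    have comm': "(1\<^sub>m N - K) * Pi i = Pi i * (1\<^sub>m N - K)"
      using Kc Pic[of i] comm[of i] by (simp add: mult_minus_distrib_mat[of _ N N _ N] minus_mult_distrib_mat[of _ N N _ _ N]
         left_mult_one_mat[of _ N N] right_mult_one_mat[of _ N N])
    \<comment> \<open>Pythagoras for \<open>K\<close> at the vector Pi_i e_i: the part outside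
      \<open>K\<close> is, by commutation, no larger than the part of e_i outside
      \<open>K\<close>.\<close>
    have "nsq (Pi i *\<^sub>v e i) = nsq (K *\<^sub>v (Pi i *\<^sub>v e i)) + nsq ((1\<^sub>m N - K) *\<^sub>v (Pi i *\<^sub>v e i))"
      by (rule proj_pythagoras[OF K mult_vec_sq[OF Pic ei]])
    also have "K *\<^sub>v (Pi i *\<^sub>v e i) = w i" unfolding w_def Q_def by (rule assoc_mult_mat_vec[symmetric, OF Kc Pic ei])
    also have "(1\<^sub>m N - K) *\<^sub>v (Pi i *\<^sub>v e i) = Pi i *\<^sub>v ((1\<^sub>m N - K) *\<^sub>v e i)"
      unfolding assoc_mult_mat_vec[OF K1c Pic ei, symmetric] comm' by (rule assoc_mult_mat_vec[OF Pic K1c ei])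
    finally have "nsq (Pi i *\<^sub>v e i) \<le> nsq (w i) + nsq ((1\<^sub>m N - K) *\<^sub>v e i)"
      using proj_nsq_le[OF Pi mult_vec_sq[OF K1c ei], of i] by simp
    moreover have "nsq (Pi i *\<^sub>v e i) = (\<Sum>j<N. (cmod (ip (col F j) (e i)))\<^sup>2 * of_bool (q j \<le> L * p i))"
      unfolding Pi_def proj_spec_nsq[OF F ei] by (simp add: mult.commute)
    ultimately show ?thesis using 1 by simp
  qed
  have tr: "Re (mtrace (spec N U p * P)) = (\<Sum>i<N. p i * nsq (P *\<^sub>v e i))" if P: "proj N P" for P
    unfolding mtrace_spec_mult[OF U proj_carrier[OF P]] Re_sum
    by (intro sum.cong refl) (simp add: proj_ip[OF P e] flip: e_def)
  have "(\<Sum>i<N. \<Sum>j<N. p i * (cmod (ip (col F j) (col U i)))\<^sup>2 * of_bool (q j \<le> L * p i))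
      - Re (mtrace (spec N U p * (1\<^sub>m N - K))) =
    (\<Sum>i<N. p i * ((\<Sum>j<N. (cmod (ip (col F j) (e i)))\<^sup>2 * of_bool (q j \<le> L * p i)) - nsq ((1\<^sub>m N - K) *\<^sub>v e i)))"
    unfolding tr[OF proj_compl[OF K]] by (simp add: right_diff_distrib sum_subtractf sum_distrib_left mult_ac e_def
        del: sum_mult_of_bool_eq sum_of_bool_mult_eq)
  also have "\<dots> \<le> (\<Sum>i<N. p i * nsq (T *\<^sub>v e i))"
    by (intro sum_mono mult_left_mono ineq p) auto
  also have "\<dots> = Re (mtrace (spec N U p * T))" by (rule tr[OF T(1), symmetric])
  finally show ?thesis using T(1,3) by (auto simp: sum_distrib_left)
qed

text \<open>For a projection P one has T <= 2 P T P + 2 (1 - P) T (1 - P), the origin of both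
  factors 2. The projection used for e_i depends on i only through its eigenvalue, so the first
  parts are summed one eigenvalue at a time and the number of distinct values enters in place of the
  dimension.\<close>

lemma test_converse:
  assumes U: "unitary N U" and F: "unitary N F" and p: "\<And>i. i < N \<Longrightarrow> 0 \<le> p i" and q: "\<And>j. j < N \<Longrightarrow> 0 \<le> q j"
    and T: "test_op N T" and L: "0 < L"
  shows "Re (mtrace (spec N U p * T)) \<le> 2 * real (card (p ` {..<N})) / L * Re (mtrace (spec N F q * T))
    + 2 * (\<Sum>i<N. \<Sum>j<N. p i * (cmod (ip (col F j) (col U i)))\<^sup>2 * of_bool (q j < L * p i))"
proof -
  have Tp: "psd N T" and T1: "psd N (1\<^sub>m N - T)" using T by (auto simp: test_op_def)
  have Tc: "T \<in> carrier_mat N N" using Tp by simp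
  define e where "e i = col U i" for i
  have e: "e i \<in> carrier_vec N" if "i < N" for i unfolding e_def by (rule unitary_col_carrier[OF U that])
  define Pi where "Pi s = spec N F (\<lambda>j. of_bool (L * s \<le> q j))" for s
  have Pi: "proj N (Pi s)" for s unfolding Pi_def by (rule proj_spec[OF F])
  have Pic: "Pi s \<in> carrier_mat N N" for s using Pi by simp
  have P1c: "1\<^sub>m N - Pi s \<in> carrier_mat N N" for s using proj_compl[OF Pi] by simp
  have Pi': "1\<^sub>m N - Pi s = spec N F (\<lambda>j. of_bool (q j < L * s))" for s
    using spec_minus[OF F, of "\<lambda>_. 1" "\<lambda>j. of_bool (L * s \<le> q j)"]
    by (simp add: Pi_def spec_one[OF F] not_le of_bool_not_iff flip: of_bool_not_iff)
  define g where "g s i = Re (ip (e i) ((Pi s * T * Pi s) *\<^sub>v e i))" for s i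
  have psdPTP: "psd N (Pi s * T * Pi s)" for s
    using psd_sandwich[OF Tp Pic[of s]] by (simp add: proj_adj[OF Pi])
  have g_nonneg: "0 \<le> g s i" if "i < N" for s i
    using psdPTP e[OF that] unfolding g_def psd_def_ip by blast
  have step: "Re (ip (e i) (T *\<^sub>v e i)) \<le> 2 * g (p i) i + 2 * (\<Sum>j<N. (cmod (ip (col F j) (e i)))\<^sup>2 * of_bool (q j < L * p i))"
    if i: "i < N" for i
  proof -
    have ei: "e i \<in> carrier_vec N" by (rule e[OF i])
    define a where "a = Pi (p i) *\<^sub>v e i"
    define b where "b = (1\<^sub>m N - Pi (p i)) *\<^sub>v e i"
    have ac: "a \<in> carrier_vec N" unfolding a_def by (rule mult_vec_sq[OF Pic ei])
    have bc: "b \<in> carrier_vec N" unfolding b_def by (rule mult_vec_sq[OF P1c ei])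
    have b_eq: "b = e i - a" unfolding a_def b_def
      using minus_mult_distrib_mat_vec[OF one_carrier_mat Pic ei] ei by simp
    have eab: "e i = a + b" unfolding b_eq using ac ei by (intro eq_vecI) auto
    have Ta: "T *\<^sub>v a \<in> carrier_vec N" "T *\<^sub>v b \<in> carrier_vec N" using mult_vec_sq[OF Tc] ac bc by auto
    \<comment> \<open>Positivity of \<open>T\<close> at \<open>a - b\<close> controls the cross
      terms: the forms at \<open>a + b\<close> and \<open>a - b\<close> add up to twice those at
      \<open>a\<close> and \<open>b\<close>.\<close>
    have "0 \<le> Re (ip (a - b) (T *\<^sub>v (a - b)))" using Tp ac bc unfolding psd_def_ip by simp
    also have "ip (a - b) (T *\<^sub>v (a - b)) = 2 * ip a (T *\<^sub>v a) + 2 * ip b (T *\<^sub>v b) - ip (e i) (T *\<^sub>v e i)"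
      unfolding eab mult_minus_distrib_mat_vec[OF Tc ac bc] mult_add_distrib_mat_vec[OF Tc ac bc]
      using ac bc Ta by (simp add: ip_minus_left[of _ N] ip_minus_right[of _ N] ip_add_left[of _ N] ip_add_right[of _ N])
    finally have 1: "Re (ip (e i) (T *\<^sub>v e i)) \<le> 2 * Re (ip a (T *\<^sub>v a)) + 2 * Re (ip b (T *\<^sub>v b))" by simp
    have "0 \<le> Re (ip b ((1\<^sub>m N - T) *\<^sub>v b))" using T1 bc unfolding psd_def_ip by blast
    also have "(1\<^sub>m N - T) *\<^sub>v b = b - T *\<^sub>v b" using minus_mult_distrib_mat_vec[OF one_carrier_mat Tc bc] bc by simp
    also have "ip b \<dots> = complex_of_real (nsq b) - ip b (T *\<^sub>v b)" using ip_minus_right[OF bc bc Ta(2)] by (simp add: ip_self)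
    finally have 2: "Re (ip b (T *\<^sub>v b)) \<le> nsq b" by simp
    have 3: "nsq b = (\<Sum>j<N. (cmod (ip (col F j) (e i)))\<^sup>2 * of_bool (q j < L * p i))"
      unfolding b_def Pi' proj_spec_nsq[OF F ei] by (simp add: mult.commute)
    have "g (p i) i = Re (ip a (T *\<^sub>v a))"
      unfolding g_def a_def assoc_mult_mat_vec[OF mult_carrier_sq[OF Pic Tc] Pic ei] assoc_mult_mat_vec[OF Pic Tc mult_vec_sq[OF Pic ei]]
        ip_mult_mat[OF Pic ei mult_vec_sq[OF Tc mult_vec_sq[OF Pic ei]]] proj_adj[OF Pi] ..
    then show ?thesis using 1 2 3 by simp
  qed
  \<comment> \<open>For a single threshold the forms add up to a trace, and \<open>s\<close> times
    the projection onto \<open>L * s \<le> q j\<close> is at most \<open>spec N F q\<close> divided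
    by \<open>L\<close>.\<close>
  have level: "s * (\<Sum>i<N. g s i) \<le> Re (mtrace (spec N F q * T)) / L" if s: "0 \<le> s" for s
  proof -
    have "complex_of_real 1 * mtrace (Pi s * T * Pi s) = mtrace (spec N U (\<lambda>_. 1) * (Pi s * T * Pi s))"
      using Pic[of s] Tc by (simp add: spec_one[OF U] left_mult_one_mat[of _ N N] mult_carrier_sq[of _ N])
    then have "(\<Sum>i<N. g s i) = Re (mtrace (Pi s * T * Pi s))"
      using mtrace_spec_mult[OF U psd_carrier[OF psdPTP[of s]], of "\<lambda>_. 1"] by (simp add: g_def e_def)
    also have "mtrace (Pi s * T * Pi s) = mtrace (Pi s * (Pi s * T))"
      by (rule mtrace_comm) (use Pic[of s] Tc in \<open>auto simp: mult_carrier_sq\<close>)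
    also have "Pi s * (Pi s * T) = Pi s * T"
      using Pi[of s] unfolding assoc_sq[OF Pic Pic Tc, symmetric] by (simp add: proj_def)
    also have "s * Re (mtrace (Pi s * T)) = (\<Sum>j<N. s * of_bool (L * s \<le> q j) * Re (ip (col F j) (T *\<^sub>v col F j)))"
      unfolding Pi_def mtrace_spec_mult[OF F Tc] by (simp add: sum_distrib_left mult_ac del: sum_mult_of_bool_eq sum_of_bool_mult_eq)
    also have "\<dots> \<le> (\<Sum>j<N. (q j / L) * Re (ip (col F j) (T *\<^sub>v col F j)))"
    proof (intro sum_mono mult_right_mono)
      fix j assume "j \<in> {..<N}"
      then show "s * of_bool (L * s \<le> q j) \<le> q j / L" using q L by (auto simp: field_simps)
      show "0 \<le> Re (ip (col F j) (T *\<^sub>v col F j))"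
        using Tp unitary_col_carrier[OF F, of j] \<open>j \<in> {..<N}\<close> unfolding psd_def_ip by blast
    qed
    also have "\<dots> = Re (mtrace (spec N F q * T)) / L"
      unfolding mtrace_spec_mult[OF F Tc] by (simp add: sum_divide_distrib)
    finally show ?thesis by simp
  qed
  have "(\<Sum>i<N. p i * g (p i) i) = (\<Sum>s\<in>p ` {..<N}. \<Sum>i\<in>{i \<in> {..<N}. p i = s}. p i * g (p i) i)"
    by (rule sum.image_gen) simp
  also have "\<dots> \<le> (\<Sum>s\<in>p ` {..<N}. Re (mtrace (spec N F q * T)) / L)"
  proof (rule sum_mono)
    fix s assume "s \<in> p ` {..<N}"
    then have s: "0 \<le> s" using p by auto
    have "(\<Sum>i\<in>{i \<in> {..<N}. p i = s}. p i * g (p i) i) = (\<Sum>i\<in>{i \<in> {..<N}. p i = s}. s * g s i)" by (rule sum.cong) auto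
    also have "\<dots> \<le> (\<Sum>i<N. s * g s i)" by (rule sum_mono2) (use s g_nonneg in auto)
    also have "\<dots> \<le> Re (mtrace (spec N F q * T)) / L" using level[OF s] by (simp add: sum_distrib_left)
    finally show "(\<Sum>i\<in>{i \<in> {..<N}. p i = s}. p i * g (p i) i) \<le> Re (mtrace (spec N F q * T)) / L" .
  qed
  finally have sum_g: "(\<Sum>i<N. p i * g (p i) i) \<le> real (card (p ` {..<N})) / L * Re (mtrace (spec N F q * T))" by simp
  have "Re (mtrace (spec N U p * T)) = (\<Sum>i<N. p i * Re (ip (e i) (T *\<^sub>v e i)))"
    unfolding mtrace_spec_mult[OF U Tc] by (simp add: e_def)
  also have "\<dots> \<le> (\<Sum>i<N. p i * (2 * g (p i) i + 2 * (\<Sum>j<N. (cmod (ip (col F j) (e i)))\<^sup>2 * of_bool (q j < L * p i))))"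
    by (intro sum_mono mult_left_mono step p) auto
  also have "\<dots> = 2 * (\<Sum>i<N. p i * g (p i) i) + 2 * (\<Sum>i<N. \<Sum>j<N. p i * (cmod (ip (col F j) (col U i)))\<^sup>2 * of_bool (q j < L * p i))"
    by (simp add: distrib_left sum.distrib sum_distrib_left mult_ac e_def del: sum_mult_of_bool_eq sum_of_bool_mult_eq)
  finally show ?thesis using sum_g by simp
qed

section \<open>Reduction of the information quantities to a classical pair of distributions\<close>

lemma kron_one_right: "A \<in> carrier_mat n m \<Longrightarrow> kron A (1\<^sub>m 1) = A"
  by (rule eq_matI) (auto simp: kron_def)

lemma tpow_1: "A \<in> carrier_mat n m \<Longrightarrow> tpow A 1 = A"
  using kron_one_right[of A n m] by simp

lemma regroup_1: "X \<in> carrier_mat (dA * dB) (dA * dB) \<Longrightarrow> regroup dA dB 1 X = X"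
proof (rule eq_matI)
  assume X: "X \<in> carrier_mat (dA * dB) (dA * dB)"
  have r: "reorder_idx dA dB 1 i = i" if "i < dA * dB" for i
    using that by (simp add: reorder_idx_def digit_def)
  fix i j assume "i < dim_row X" "j < dim_col X"
  then have "i < dA * dB" "j < dA * dB" using X by auto
  then show "regroup dA dB 1 X $$ (i, j) = X $$ (i, j)"
    using r[of i] r[of j] by (simp add: regroup_def)
qed (auto simp: regroup_def)

text \<open>The case n = 1 of \<open>tpow_trace_regroup_A\<close>, where \<open>regroup\<close> is
  the identity.\<close>

lemma trace_ptrB:
  assumes "\<rho> \<in> carrier_mat (dA * dB) (dA * dB)" "X \<in> carrier_mat dA dA"
  shows "mtrace (\<rho> * kron X (1\<^sub>m dB)) = mtrace (ptrB dA dB \<rho> * X)"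
proof -
  have "ptrB dA dB \<rho> \<in> carrier_mat dA dA" by (simp add: ptrB_def)
  then show ?thesis
    using tpow_trace_regroup_A[of \<rho> dA dB X 1] assms
    by (simp only: power_one_right tpow_1 regroup_1 kron_carrier one_carrier_mat)
qed

lemma trace_ptrA:
  assumes "\<rho> \<in> carrier_mat (dA * dB) (dA * dB)" "Y \<in> carrier_mat dB dB"
  shows "mtrace (\<rho> * kron (1\<^sub>m dA) Y) = mtrace (ptrA dA dB \<rho> * Y)"
proof -
  have "ptrA dA dB \<rho> \<in> carrier_mat dB dB" by (simp add: ptrA_def)
  then show ?thesis
    using tpow_trace_regroup_B[of \<rho> dA dB Y 1] assms
    by (simp only: power_one_right tpow_1 regroup_1 kron_carrier one_carrier_mat)
qed

lemma hermitian_ptrB: "hermitian (dA * dB) \<rho> \<Longrightarrow> hermitian dA (ptrB dA dB \<rho>)"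
  by (rule hermitianI) (auto simp: ptrB_def mult_add_less hermitian_index[of "dA * dB"] intro!: sum.cong)

lemma hermitian_ptrA: "hermitian (dA * dB) \<rho> \<Longrightarrow> hermitian dB (ptrA dA dB \<rho>)"
  by (rule hermitianI) (auto simp: ptrA_def mult_add_less hermitian_index[of "dA * dB"] intro!: sum.cong)

text \<open>Transition probabilities between two orthonormal bases; \<open>sum_overlap\<close> and
  \<open>overlap_commute\<close> make them doubly stochastic.\<close>

definition overlap :: "complex mat \<Rightarrow> complex mat \<Rightarrow> nat \<Rightarrow> nat \<Rightarrow> real" where
  "overlap U F i j = (cmod (ip (col F j) (col U i)))\<^sup>2"

lemma overlap_nonneg: "0 \<le> overlap U F i j" by (simp add: overlap_def)

lemma overlap_commute:
  assumes "unitary d U" "unitary d F" "i < d" "j < d"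
  shows "overlap U F i j = overlap F U j i"
  unfolding overlap_def
  using ip_commute[OF unitary_col_carrier[OF assms(1,3)] unitary_col_carrier[OF assms(2,4)]] by simp

lemma sum_overlap: "unitary d U \<Longrightarrow> unitary d F \<Longrightarrow> i < d \<Longrightarrow> (\<Sum>j<d. overlap U F i j) = 1"
  unfolding overlap_def
  using parseval[of d F "col U i"] unitary_col_carrier[of d U i] ip_self[of "col U i"] unitary_col_ip[of d U i i]
  by (metis of_real_eq_1_iff)

lemma entropy_spec: "unitary d U \<Longrightarrow> entropy d (spec d U f) = - (\<Sum>i<d. f i * ln (f i))"
  unfolding entropy_def mlog_def matfun_spec
  by (simp only: spec_mult mtrace_spec Re_complex_of_real)

text \<open>In eigenbases of the joint state and of the product of its marginals, the mutual information and its variance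
  become the mean and variance of the log-likelihood ratio of the two Nussbaum-Szkola distributions
  \<open>p i * overlap U F i j\<close> and \<open>q j * overlap U F i j\<close>.\<close>

theorem information_spectral_data:
  assumes \<rho>: "density (dA * dB) \<rho>"
  defines "d \<equiv> dA * dB"
  obtains U p F q UA UB \<alpha> \<beta> where
    "unitary d U" "\<And>i. i < d \<Longrightarrow> 0 \<le> p i" "(\<Sum>i<d. p i) = 1" "\<rho> = spec d U p"
    "unitary d F" "\<And>j. j < d \<Longrightarrow> 0 \<le> q j" "kron (ptrB dA dB \<rho>) (ptrA dA dB \<rho>) = spec d F q"
    "unitary dA UA" "ptrB dA dB \<rho> = spec dA UA \<alpha>" "density dA (ptrB dA dB \<rho>)"
    "unitary dB UB" "ptrA dA dB \<rho> = spec dB UB \<beta>" "density dB (ptrA dA dB \<rho>)"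
    "\<And>i j. i < d \<Longrightarrow> j < d \<Longrightarrow> p i * overlap U F i j \<noteq> 0 \<Longrightarrow> 0 < p i \<and> 0 < q j"
    "mutual_info dA dB \<rho> = (\<Sum>i<d. \<Sum>j<d. p i * overlap U F i j * (ln (p i) - ln (q j)))"
    "mutual_info_var dA dB \<rho> = (\<Sum>i<d. \<Sum>j<d. p i * overlap U F i j * (ln (p i) - ln (q j) - mutual_info dA dB \<rho>)\<^sup>2)"
proof -
  have \<rho>p: "psd d \<rho>" "mtrace \<rho> = 1" using \<rho> by (auto simp: density_def d_def)
  have \<rho>c: "\<rho> \<in> carrier_mat d d" using \<rho>p by simp
  obtain U p where U: "unitary d U" and p: "\<And>i. i < d \<Longrightarrow> 0 \<le> p i" and \<rho>s: "\<rho> = spec d U p"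
    using psd_spectral[OF \<rho>p(1)] by blast
  have p1: "(\<Sum>i<d. p i) = 1" using \<rho>p(2) unfolding \<rho>s mtrace_spec[OF U] by (metis of_real_eq_1_iff)
  define A where "A = ptrB dA dB \<rho>"
  define B where "B = ptrA dA dB \<rho>"
  obtain UA \<alpha> where UA: "unitary dA UA" and A: "A = spec dA UA \<alpha>"
    using spectral_theorem hermitian_ptrB psd_hermitian[OF \<rho>p(1)] unfolding A_def d_def by blast
  obtain UB \<beta> where UB: "unitary dB UB" and B: "B = spec dB UB \<beta>"
    using spectral_theorem hermitian_ptrA psd_hermitian[OF \<rho>p(1)] unfolding B_def d_def by blast
  \<comment> \<open>A product eigenbasis is chosen, so that the eigenvalues factor and their
    logarithms lead back to the two marginal entropies.\<close>
  define F where "F = kron UA UB"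
  define q where "q = (\<lambda>j. \<alpha> (j div dB) * \<beta> (j mod dB))"
  have F: "unitary d F" unfolding F_def d_def by (rule unitary_kron[OF UA UB])
  have AB: "kron A B = spec d F q" unfolding A B F_def d_def q_def by (rule kron_spec[OF UA UB])
  define P where "P i j = p i * overlap U F i j" for i j
  have P0: "0 \<le> P i j" if "i < d" for i j using p[OF that] by (simp add: P_def overlap_nonneg)
  \<comment> \<open>The law of the second index, which is the diagonal of \<rho> in the product
    eigenbasis.\<close>
  define r where "r j = (\<Sum>i<d. P i j)" for j
  have r0: "0 \<le> r j" for j unfolding r_def using P0 by (intro sum_nonneg) auto
  have rowP: "(\<Sum>j<d. P i j) = p i" if "i < d" for i
    unfolding P_def sum_distrib_left[symmetric] sum_overlap[OF U F that] by simp
  have trF: "mtrace (\<rho> * spec d F g) = complex_of_real (\<Sum>j<d. g j * r j)" for g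
  proof -
    have "mtrace (\<rho> * spec d F g) = mtrace (spec d F g * \<rho>)" by (rule mtrace_comm[OF \<rho>c]) (use F in auto)
    also have "\<dots> = (\<Sum>j<d. complex_of_real (g j) * complex_of_real (r j))"
      unfolding mtrace_spec_mult[OF F \<rho>c]
    proof (intro sum.cong refl arg_cong2[of _ _ _ _ "(*)"])
      fix j assume "j \<in> {..<d}"
      then have j: "j < d" by simp
      show "ip (col F j) (\<rho> *\<^sub>v col F j) = complex_of_real (r j)"
        unfolding \<rho>s ip_spec[OF U unitary_col_carrier[OF F j]] r_def P_def
        using overlap_commute[OF U F _ j] by (simp add: overlap_def)
    qed
    finally show ?thesis by simp
  qed
  \<comment> \<open>Tracing against a function of the A marginal identifies \<alpha> as the first
    marginal of \<open>r\<close>. Indicator functions then give positivity and the support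
    condition, the logarithm gives the entropy.\<close>
  have sumA: "(\<Sum>a<dA. \<alpha> a * h a) = (\<Sum>j<d. h (j div dB) * r j)" for h
  proof -
    have X: "spec dA UA h \<in> carrier_mat dA dA" using UA by auto
    have "complex_of_real (\<Sum>a<dA. \<alpha> a * h a) = mtrace (A * spec dA UA h)"
      unfolding A spec_mult[OF UA] mtrace_spec[OF UA] ..
    also have "\<dots> = mtrace (\<rho> * kron (spec dA UA h) (spec dB UB (\<lambda>_. 1)))"
      unfolding spec_one[OF UB] A_def using trace_ptrB[OF \<rho>c[unfolded d_def] X] by simp
    also have "\<dots> = complex_of_real (\<Sum>j<d. h (j div dB) * r j)"
      unfolding kron_spec[OF UA UB] using trF by (simp add: F_def d_def)
    finally show ?thesis by (metis of_real_eq_iff)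
  qed
  have sumB: "(\<Sum>b<dB. \<beta> b * h b) = (\<Sum>j<d. h (j mod dB) * r j)" for h
  proof -
    have X: "spec dB UB h \<in> carrier_mat dB dB" using UB by auto
    have "complex_of_real (\<Sum>b<dB. \<beta> b * h b) = mtrace (B * spec dB UB h)"
      unfolding B spec_mult[OF UB] mtrace_spec[OF UB] ..
    also have "\<dots> = mtrace (\<rho> * kron (spec dA UA (\<lambda>_. 1)) (spec dB UB h))"
      unfolding spec_one[OF UA] B_def using trace_ptrA[OF \<rho>c[unfolded d_def] X] by simp
    also have "\<dots> = complex_of_real (\<Sum>j<d. h (j mod dB) * r j)"
      unfolding kron_spec[OF UA UB] using trF by (simp add: F_def d_def)
    finally show ?thesis by (metis of_real_eq_iff)
  qed
  have \<alpha>_eq: "\<alpha> a = (\<Sum>j<d. of_bool (j div dB = a) * r j)" if "a < dA" for a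
    using sumA[of "\<lambda>x. of_bool (x = a)"] that by simp
  have \<beta>_eq: "\<beta> b = (\<Sum>j<d. of_bool (j mod dB = b) * r j)" if "b < dB" for b
    using sumB[of "\<lambda>x. of_bool (x = b)"] that by simp
  have \<alpha>0: "0 \<le> \<alpha> a" if "a < dA" for a unfolding \<alpha>_eq[OF that] by (intro sum_nonneg mult_nonneg_nonneg r0) auto
  have \<beta>0: "0 \<le> \<beta> b" if "b < dB" for b unfolding \<beta>_eq[OF that] by (intro sum_nonneg mult_nonneg_nonneg r0) auto
  have lts: "j div dB < dA" "j mod dB < dB" if "j < d" for j
    using that by (auto simp: d_def div_mult_less intro: mod_mult_less)
  have \<alpha>r: "r j \<le> \<alpha> (j div dB)" if "j < d" for j
  proof -
    have "of_bool (j div dB = j div dB) * r j \<le> (\<Sum>j'<d. of_bool (j' div dB = j div dB) * r j')"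
      by (rule member_le_sum[of j _ "\<lambda>j'. of_bool (j' div dB = j div dB) * r j'"]) (use that r0 in auto)
    then show ?thesis using \<alpha>_eq[OF lts(1)[OF that]] by simp
  qed
  have \<beta>r: "r j \<le> \<beta> (j mod dB)" if "j < d" for j
  proof -
    have "of_bool (j mod dB = j mod dB) * r j \<le> (\<Sum>j'<d. of_bool (j' mod dB = j mod dB) * r j')"
      by (rule member_le_sum[of j _ "\<lambda>j'. of_bool (j' mod dB = j mod dB) * r j'"]) (use that r0 in auto)
    then show ?thesis using \<beta>_eq[OF lts(2)[OF that]] by simp
  qed
  \<comment> \<open>A pair of nonzero weight has positive eigenvalues on both sides. The splitting
    of ln (\<alpha> \<beta>) is confined to such pairs, since with \<open>ln 0 = 0\<close> the
    product rule fails at 0.\<close>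
  have supp: "0 < p i \<and> 0 < \<alpha> (j div dB) \<and> 0 < \<beta> (j mod dB)" if ij: "i < d" "j < d" "P i j \<noteq> 0" for i j
  proof -
    have "0 < P i j" using P0[OF ij(1), of j] ij(3) by linarith
    also have "P i j \<le> r j" unfolding r_def by (rule member_le_sum) (use ij P0 in auto)
    finally have "0 < r j" .
    moreover have "0 < p i" using p[OF ij(1)] ij(3) by (cases "p i = 0") (auto simp: P_def)
    ultimately show ?thesis using \<alpha>r[OF ij(2)] \<beta>r[OF ij(2)] by linarith
  qed
  have sum_r: "(\<Sum>j<d. r j) = 1" unfolding r_def by (subst sum.swap) (simp add: rowP p1)
  have "density dA A" unfolding density_def
    using psd_spec[OF UA \<alpha>0] sumA[of "\<lambda>_. 1"] sum_r by (simp add: A mtrace_spec[OF UA])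
  moreover have "density dB B" unfolding density_def
    using psd_spec[OF UB \<beta>0] sumB[of "\<lambda>_. 1"] sum_r by (simp add: B mtrace_spec[OF UB])
  moreover have q0: "0 \<le> q j" if "j < d" for j using lts[OF that] by (simp add: q_def \<alpha>0 \<beta>0)
  moreover have I: "mutual_info dA dB \<rho> = (\<Sum>i<d. \<Sum>j<d. P i j * (ln (p i) - ln (q j)))"
  proof -
    have "mutual_info dA dB \<rho> = (\<Sum>i<d. p i * ln (p i)) - (\<Sum>a<dA. \<alpha> a * ln (\<alpha> a)) - (\<Sum>b<dB. \<beta> b * ln (\<beta> b))"
      unfolding mutual_info_def using entropy_spec[OF U, of p] entropy_spec[OF UA, of \<alpha>] entropy_spec[OF UB, of \<beta>]
      by (simp add: A[symmetric] B[symmetric] \<rho>s[symmetric] A_def B_def flip: d_def)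
    also have "\<dots> = (\<Sum>i<d. p i * ln (p i)) - (\<Sum>j<d. ln (\<alpha> (j div dB)) * r j) - (\<Sum>j<d. ln (\<beta> (j mod dB)) * r j)"
      using sumA[of "\<lambda>a. ln (\<alpha> a)"] sumB[of "\<lambda>a. ln (\<beta> a)"] by simp
    also have "(\<Sum>i<d. p i * ln (p i)) = (\<Sum>i<d. \<Sum>j<d. P i j * ln (p i))"
      using rowP by (simp flip: sum_distrib_right)
    also have "(\<Sum>j<d. ln (\<alpha> (j div dB)) * r j) = (\<Sum>i<d. \<Sum>j<d. P i j * ln (\<alpha> (j div dB)))"
      by (subst sum.swap) (simp add: r_def sum_distrib_left mult.commute)
    also have "(\<Sum>j<d. ln (\<beta> (j mod dB)) * r j) = (\<Sum>i<d. \<Sum>j<d. P i j * ln (\<beta> (j mod dB)))"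
      by (subst sum.swap) (simp add: r_def sum_distrib_left mult.commute)
    also have "(\<Sum>i<d. \<Sum>j<d. P i j * ln (p i)) - (\<Sum>i<d. \<Sum>j<d. P i j * ln (\<alpha> (j div dB)))
        - (\<Sum>i<d. \<Sum>j<d. P i j * ln (\<beta> (j mod dB)))
      = (\<Sum>i<d. \<Sum>j<d. P i j * (ln (p i) - ln (q j)))"
      unfolding sum_subtractf[symmetric]
    proof (intro sum.cong refl)
      fix i j assume "i \<in> {..<d}" "j \<in> {..<d}"
      then show "P i j * ln (p i) - P i j * ln (\<alpha> (j div dB)) - P i j * ln (\<beta> (j mod dB)) = P i j * (ln (p i) - ln (q j))"
        using supp[of i j] by (cases "P i j = 0") (auto simp: q_def ln_mult algebra_simps)
    qed
    finally show ?thesis .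
  qed
  moreover have "mutual_info_var dA dB \<rho> = (\<Sum>i<d. \<Sum>j<d. P i j * (ln (p i) - ln (q j) - mutual_info dA dB \<rho>)\<^sup>2)"
  proof -
    let ?I = "mutual_info dA dB \<rho>"
    define L where "L = spec d U (\<lambda>i. ln (p i))"
    define M where "M = spec d F (\<lambda>j. ln (q j))"
    define C where "C = complex_of_real ?I \<cdot>\<^sub>m 1\<^sub>m d"
    define X where "X = L - M - C"
    have c: "L \<in> carrier_mat d d" "M \<in> carrier_mat d d" "C \<in> carrier_mat d d" using U F by (auto simp: L_def M_def C_def)
    have X: "X \<in> carrier_mat d d" unfolding X_def by (intro minus_carrier_mat c)
    have "mlog d \<rho> = L" unfolding \<rho>s mlog_def L_def by (rule matfun_spec[OF U])
    moreover have "mlog d (kron (ptrB dA dB \<rho>) (ptrA dA dB \<rho>)) = M"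
      using matfun_spec[OF F, of ln q] AB unfolding A_def B_def mlog_def M_def by simp
    ultimately have "mutual_info_var dA dB \<rho> = Re (mtrace (\<rho> * (X * X)))"
      unfolding mutual_info_var_def Let_def X_def C_def d_def by simp
    also have "mtrace (\<rho> * (X * X)) = (\<Sum>i<d. complex_of_real (p i) * ip (col U i) ((X * X) *\<^sub>v col U i))"
      unfolding \<rho>s by (rule mtrace_spec_mult[OF U mult_carrier_sq[OF X X]])
    also have "\<dots> = (\<Sum>i<d. complex_of_real (\<Sum>j<d. P i j * (ln (p i) - ln (q j) - ?I)\<^sup>2))"
    proof (intro sum.cong refl)
      fix i assume "i \<in> {..<d}"
      then have i: "i < d" by simp
      define e where "e = col U i"
      have e: "e \<in> carrier_vec d" unfolding e_def by (rule unitary_col_carrier[OF U i])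
      have Xe: "X *\<^sub>v e \<in> carrier_vec d" by (rule mult_vec_sq[OF X e])
      have adjX: "adj X = X"
        unfolding X_def adj_minus[OF minus_carrier_mat[OF c(2)] c(3)] adj_minus[OF c(1,2)]
        by (simp add: adj_smult[of ?I] C_def adj_spec[OF U] adj_spec[OF F] L_def M_def)
      \<comment> \<open>\<open>L\<close> and \<open>M\<close> need not commute, but \<open>L\<close>
        acts on its eigenvector on the right and \<open>M\<close> on its eigenvector on the left, so
        the matrix element is scaled by a number. Parseval then yields the variance.\<close>
      have fX: "ip (col F j) (X *\<^sub>v e) = complex_of_real (ln (p i) - ln (q j) - ?I) * ip (col F j) e" if j: "j < d" for j
      proof -
        let ?f = "col F j"
        have f: "?f \<in> carrier_vec d" by (rule unitary_col_carrier[OF F j])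
        have Le: "L *\<^sub>v e = complex_of_real (ln (p i)) \<cdot>\<^sub>v e" unfolding L_def e_def by (rule spec_mult_col[OF U i])
        have Mf: "M *\<^sub>v ?f = complex_of_real (ln (q j)) \<cdot>\<^sub>v ?f" unfolding M_def by (rule spec_mult_col[OF F j])
        have Me: "ip ?f (M *\<^sub>v e) = complex_of_real (ln (q j)) * ip ?f e"
          unfolding ip_mult_mat[OF c(2) f e] using Mf adj_spec[OF F] f e by (simp add: M_def ip_smult_left[of _ d])
        have Ce: "C *\<^sub>v e = complex_of_real ?I \<cdot>\<^sub>v e" unfolding C_def smult_mat_vec[OF one_carrier_mat e] using e by simp
        have LM: "L - M \<in> carrier_mat d d" by (rule minus_carrier_mat[OF c(2)])
        have "ip ?f (X *\<^sub>v e) = ip ?f (L *\<^sub>v e) - ip ?f (M *\<^sub>v e) - ip ?f (C *\<^sub>v e)"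
          unfolding X_def minus_mult_distrib_mat_vec[OF LM c(3) e]
            ip_minus_right[OF f mult_vec_sq[OF LM e] mult_vec_sq[OF c(3) e]]
          unfolding minus_mult_distrib_mat_vec[OF c(1,2) e]
            ip_minus_right[OF f mult_vec_sq[OF c(1) e] mult_vec_sq[OF c(2) e]] ..
        then show ?thesis unfolding Me Le Ce by (simp add: ip_smult_right[OF f e] algebra_simps)
      qed
      have "ip e ((X * X) *\<^sub>v e) = complex_of_real (nsq (X *\<^sub>v e))"
        unfolding assoc_mult_mat_vec[OF X X e] ip_mult_mat[OF X e Xe] adjX ip_self ..
      also have "nsq (X *\<^sub>v e) = (\<Sum>j<d. (ln (p i) - ln (q j) - ?I)\<^sup>2 * overlap U F i j)"
        unfolding parseval[OF F Xe] by (intro sum.cong refl)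
            (simp only: lessThan_iff fX norm_mult norm_of_real power_mult_distrib power2_abs overlap_def e_def[symmetric])
      finally show "complex_of_real (p i) * ip (col U i) ((X * X) *\<^sub>v col U i) = complex_of_real (\<Sum>j<d. P i j * (ln (p i) - ln (q j) - ?I)\<^sup>2)"
        unfolding e_def of_real_mult[symmetric] by (simp add: P_def sum_distrib_left mult_ac)
    qed
    finally show ?thesis by simp
  qed
  moreover have "\<And>i j. i < d \<Longrightarrow> j < d \<Longrightarrow> p i * overlap U F i j \<noteq> 0 \<Longrightarrow> 0 < p i \<and> 0 < q j"
    using supp by (auto simp: P_def q_def)
  ultimately show ?thesis
    using that[OF U p p1 \<rho>s F, of q UA \<alpha> UB \<beta>] AB UA UB A B unfolding A_def B_def P_def by blast
qed

section \<open>Expectations of functions of independent sums\<close>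

text \<open>Expectation of h (X_1 + ... + X_n) for independent copies, written as an iterated finite
  sum so that its laws are inductions on n with \<open>h\<close> arbitrary.\<close>

fun iexp :: "'z set \<Rightarrow> ('z \<Rightarrow> real) \<Rightarrow> ('z \<Rightarrow> real) \<Rightarrow> nat \<Rightarrow> (real \<Rightarrow> real) \<Rightarrow> real" where
  "iexp Z P X 0 h = h 0"
| "iexp Z P X (Suc n) h = (\<Sum>z\<in>Z. P z * iexp Z P X n (\<lambda>s. h (X z + s)))"

text \<open>An overlap is the squared modulus of an entry of F^* U, and products of tensor powers
  are tensor powers of products.\<close>

lemma overlap_tpow_Suc:
  assumes U: "unitary d U" and F: "unitary d F" and lt: "a < d" "a' < d" "b < d ^ n" "b' < d ^ n"
  shows "overlap (tpow U (Suc n)) (tpow F (Suc n)) (a * d ^ n + b) (a' * d ^ n + b') =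
    overlap U F a a' * overlap (tpow U n) (tpow F n) b b'"
proof -
  have Uc: "U \<in> carrier_mat d d" and Fc: "F \<in> carrier_mat d d" using U F by auto
  have ov: "ip (col F' j) (col U' i) = (adj F' * U') $$ (j, i)"
    if "U' \<in> carrier_mat N N" "F' \<in> carrier_mat N N" "i < N" "j < N" for U' F' N i j
    using that by (simp add: mult_mat_index[of "adj F'" N N U' N] ip_def carrier_matD[OF that(2)] carrier_matD[OF that(1)] del: index_mult_mat(1))
  have t: "adj (tpow F m) * tpow U m = tpow (adj F * U) m" for m
    unfolding adj_tpow by (rule tpow_mult) (use Uc Fc in auto)
  have W: "adj F * U \<in> carrier_mat d d" using Uc Fc by (auto simp: mult_carrier_sq)
  have lts: "a * d ^ n + b < d ^ Suc n" "a' * d ^ n + b' < d ^ Suc n" using lt by (auto simp: mult_add_less)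
  have "ip (col (tpow F (Suc n)) (a' * d ^ n + b')) (col (tpow U (Suc n)) (a * d ^ n + b)) =
     tpow (adj F * U) (Suc n) $$ (a' * d ^ n + b', a * d ^ n + b)"
    unfolding ov[OF tpow_carrier[OF Uc] tpow_carrier[OF Fc] lts] t ..
  also have "\<dots> = (adj F * U) $$ (a', a) * tpow (adj F * U) n $$ (b', b)"
    using lts lt by (simp add: kron_index[OF W tpow_carrier[OF W]] div_mult_add)
  also have "\<dots> = ip (col F a') (col U a) * ip (col (tpow F n) b') (col (tpow U n) b)"
    unfolding ov[OF Uc Fc lt(1,2)] ov[OF tpow_carrier[OF Uc] tpow_carrier[OF Fc] lt(3,4)] t ..
  finally show ?thesis by (simp only: overlap_def norm_mult power_mult_distrib)
qed

text \<open>Eigenvalues and overlaps of powers are products, so the log-likelihood ratio becomes an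
  independent sum. Positivity on the support is proved in the same induction because the step splits
  logarithms of products.\<close>

lemma iexp_overlap:
  assumes U: "unitary d U" and F: "unitary d F"
    and supp: "\<And>i j. i < d \<Longrightarrow> j < d \<Longrightarrow> p i * overlap U F i j \<noteq> 0 \<Longrightarrow> 0 < p i \<and> 0 < q j"
  defines "w \<equiv> \<lambda>n i j. pw d p n i * overlap (tpow U n) (tpow F n) i j"
  shows "(\<forall>i<d ^ n. \<forall>j<d ^ n. w n i j \<noteq> 0 \<longrightarrow> 0 < pw d p n i \<and> 0 < pw d q n j) \<and>
    (\<forall>h. (\<Sum>i<d ^ n. \<Sum>j<d ^ n. w n i j * h (ln (pw d p n i) - ln (pw d q n j))) =
      iexp ({..<d} \<times> {..<d}) (\<lambda>(i, j). p i * overlap U F i j) (\<lambda>(i, j). ln (p i) - ln (q j)) n h)"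
proof (induction n)
  case 0
  have "ip (col (1\<^sub>m (Suc 0)) 0) (col (1\<^sub>m (Suc 0)) 0) = 1" by (simp add: ip_def)
  then have "overlap (1\<^sub>m (Suc 0)) (1\<^sub>m (Suc 0)) 0 0 = 1" by (simp add: overlap_def)
  then show ?case by (simp add: w_def)
next
  case (Suc n)
  let ?Z = "{..<d} \<times> {..<d}"
  let ?P = "\<lambda>(i, j). p i * overlap U F i j" and ?X = "\<lambda>(i, j). ln (p i) - ln (q j)"
  have split: "w (Suc n) (a * d ^ n + b) (a' * d ^ n + b') = (p a * overlap U F a a') * w n b b'"
    "pw d p (Suc n) (a * d ^ n + b) = p a * pw d p n b" "pw d q (Suc n) (a' * d ^ n + b') = q a' * pw d q n b'"
    if "a < d" "a' < d" "b < d ^ n" "b' < d ^ n" for a a' b b'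
    using that unfolding w_def overlap_tpow_Suc[OF U F that] by (simp_all add: div_mult_add)
  have S: "0 < pw d p n b \<and> 0 < pw d q n b'" if "b < d ^ n" "b' < d ^ n" "w n b b' \<noteq> 0" for b b'
    using Suc.IH that by blast
  have "0 < pw d p (Suc n) i \<and> 0 < pw d q (Suc n) j" if ij: "i < d ^ Suc n" "j < d ^ Suc n" "w (Suc n) i j \<noteq> 0" for i j
  proof -
    define a b a' b' where ab: "a = i div d ^ n" "b = i mod d ^ n" "a' = j div d ^ n" "b' = j mod d ^ n"
    have lt: "a < d" "a' < d" "b < d ^ n" "b' < d ^ n"
      using ij unfolding ab by (auto intro: mod_mult_less[of _ d] div_mult_less)
    have eq: "i = a * d ^ n + b" "j = a' * d ^ n + b'" by (simp_all only: ab div_mult_mod_eq)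
    show ?thesis using ij(3) supp[OF lt(1,2)] S[OF lt(3,4)] unfolding eq split[OF lt] by auto
  qed
  moreover have "(\<Sum>i<d ^ Suc n. \<Sum>j<d ^ Suc n. w (Suc n) i j * h (ln (pw d p (Suc n) i) - ln (pw d q (Suc n) j))) =
      iexp ?Z ?P ?X (Suc n) h" for h
  proof -
    have "(\<Sum>i<d ^ Suc n. \<Sum>j<d ^ Suc n. w (Suc n) i j * h (ln (pw d p (Suc n) i) - ln (pw d q (Suc n) j))) =
      (\<Sum>a<d. \<Sum>b<d ^ n. \<Sum>a'<d. \<Sum>b'<d ^ n. w (Suc n) (a * d ^ n + b) (a' * d ^ n + b') *
         h (ln (pw d p (Suc n) (a * d ^ n + b)) - ln (pw d q (Suc n) (a' * d ^ n + b'))))"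
      unfolding power_Suc sum_lessThan_mult ..
    also have "\<dots> = (\<Sum>a<d. \<Sum>b<d ^ n. \<Sum>a'<d. \<Sum>b'<d ^ n. (p a * overlap U F a a') * (w n b b' *
         h ((ln (p a) - ln (q a')) + (ln (pw d p n b) - ln (pw d q n b')))))"
    proof (intro sum.cong refl)
      fix a b a' b' assume "a \<in> {..<d}" "b \<in> {..<d ^ n}" "a' \<in> {..<d}" "b' \<in> {..<d ^ n}"
      then have lt: "a < d" "a' < d" "b < d ^ n" "b' < d ^ n" by auto
      show "w (Suc n) (a * d ^ n + b) (a' * d ^ n + b') *
         h (ln (pw d p (Suc n) (a * d ^ n + b)) - ln (pw d q (Suc n) (a' * d ^ n + b'))) =
         (p a * overlap U F a a') * (w n b b' * h ((ln (p a) - ln (q a')) + (ln (pw d p n b) - ln (pw d q n b'))))"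
      \<comment> \<open>Terms of zero weight are set apart, as their logarithms may be taken at
        0.\<close>
      proof (cases "p a * overlap U F a a' = 0 \<or> w n b b' = 0")
        case False
        then have "0 < p a" "0 < q a'" "0 < pw d p n b" "0 < pw d q n b'"
          using supp[OF lt(1,2)] S[OF lt(3,4)] by auto
        then show ?thesis unfolding split[OF lt] by (simp add: ln_mult algebra_simps)
      qed (auto simp: split[OF lt] simp del: pw.simps)
    qed
    also have "\<dots> = (\<Sum>a<d. \<Sum>a'<d. (p a * overlap U F a a') * (\<Sum>b<d ^ n. \<Sum>b'<d ^ n. w n b b' *
         h ((ln (p a) - ln (q a')) + (ln (pw d p n b) - ln (pw d q n b')))))"
      by (rule sum.cong[OF refl], subst sum.swap) (simp add: sum_distrib_left)
    also have "\<dots> = (\<Sum>a<d. \<Sum>a'<d. (p a * overlap U F a a') * iexp ?Z ?P ?X n (\<lambda>s. h ((ln (p a) - ln (q a')) + s)))"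
      by (intro sum.cong refl arg_cong2[of _ _ _ _ "(*)"])
         (rule Suc.IH[THEN conjunct2, rule_format, of "\<lambda>s. h (_ + s)"])
    also have "\<dots> = iexp ?Z ?P ?X (Suc n) h" by (simp add: sum.cartesian_product case_prod_beta)
    finally show ?thesis .
  qed
  ultimately show ?case by blast
qed

section \<open>Moderate deviations of independent sums\<close>

lemma iexp_mono:
  assumes "\<And>z. z \<in> Z \<Longrightarrow> 0 \<le> P z" "\<And>s. h s \<le> g s"
  shows "iexp Z P X n h \<le> iexp Z P X n g"
  using assms(2) by (induction n arbitrary: h g) (auto intro!: sum_mono mult_left_mono assms(1))

lemma iexp_cmult: "iexp Z P X n (\<lambda>s. c * h s) = c * iexp Z P X n h"
  by (induction n arbitrary: h) (simp_all add: sum_distrib_left mult_ac)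

lemma iexp_diff: "iexp Z P X n (\<lambda>s. h s - g s) = iexp Z P X n h - iexp Z P X n g"
  by (induction n arbitrary: h g) (simp_all add: sum_subtractf right_diff_distrib)

lemma iexp_const: "sum P Z = 1 \<Longrightarrow> iexp Z P X n (\<lambda>_. c) = c"
  by (induction n) (simp_all flip: sum_distrib_right)

lemma iexp_center: "iexp Z P X n h = iexp Z P (\<lambda>z. X z - m) n (\<lambda>s. h (s + real n * m))"
proof (induction n arbitrary: h)
  case (Suc n)
  show ?case unfolding iexp.simps Suc.IH by (simp add: algebra_simps)
qed simp

text \<open>Change of measure: exp (\<theta> s) factors over the summands, and each factor is
  absorbed into the weights. With M the moment generating function at \<theta> the new weights sum
  to 1.\<close>

lemma iexp_tilt:
  assumes "M \<noteq> 0"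
  shows "iexp Z P X n (\<lambda>s. exp (\<theta> * s) * h s) = M ^ n * iexp Z (\<lambda>z. P z * exp (\<theta> * X z) / M) X n h"
proof (induction n arbitrary: h)
  case (Suc n)
  have "iexp Z P X (Suc n) (\<lambda>s. exp (\<theta> * s) * h s) =
      (\<Sum>z\<in>Z. P z * iexp Z P X n (\<lambda>s. exp (\<theta> * X z) * (exp (\<theta> * s) * h (X z + s))))"
    by (simp add: distrib_left exp_add mult_ac)
  also have "\<dots> = (\<Sum>z\<in>Z. P z * exp (\<theta> * X z) * M ^ n * iexp Z (\<lambda>z. P z * exp (\<theta> * X z) / M) X n (\<lambda>s. h (X z + s)))"
    unfolding iexp_cmult Suc.IH by (simp only: mult_ac)
  also have "\<dots> = M ^ Suc n * iexp Z (\<lambda>z. P z * exp (\<theta> * X z) / M) X (Suc n) h"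
    using assms by (simp add: sum_distrib_left field_simps)
  finally show ?case .
qed simp

text \<open>Additivity of the variance; the shift \<open>c\<close> is arbitrary because fixing the
  first summand moves the centre.\<close>

lemma iexp_square:
  assumes P1: "sum P Z = 1" and m: "(\<Sum>z\<in>Z. P z * X z) = m"
  shows "iexp Z P X n (\<lambda>s. (s - real n * m + c)\<^sup>2) = real n * (\<Sum>z\<in>Z. P z * (X z - m)\<^sup>2) + c\<^sup>2"
proof (induction n arbitrary: c)
  case (Suc n)
  let ?v = "\<Sum>z\<in>Z. P z * (X z - m)\<^sup>2"
  have lin: "(\<Sum>z\<in>Z. P z * (X z - m)) = 0"
    using P1 m by (simp add: right_diff_distrib sum_subtractf flip: sum_distrib_right)
  have "iexp Z P X (Suc n) (\<lambda>s. (s - real (Suc n) * m + c)\<^sup>2) =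
      (\<Sum>z\<in>Z. P z * iexp Z P X n (\<lambda>s. (s - real n * m + (X z - m + c))\<^sup>2))"
    by (simp add: algebra_simps)
  also have "\<dots> = (\<Sum>z\<in>Z. P z * (real n * ?v + (X z - m + c)\<^sup>2))" by (simp only: Suc.IH)
  also have "\<dots> = (\<Sum>z\<in>Z. P z * (real n * ?v + c\<^sup>2) + P z * (X z - m)\<^sup>2 + 2 * c * (P z * (X z - m)))"
    by (intro sum.cong refl) (simp add: power2_eq_square algebra_simps)
  also have "\<dots> = (real n * ?v + c\<^sup>2) + ?v + 2 * c * 0"
    unfolding sum.distrib sum_distrib_right[symmetric] sum_distrib_left[symmetric] P1 lin by simp
  finally show ?case by (simp add: algebra_simps)
qed simp

lemma exp_second_order: "((\<lambda>\<theta>::real. (exp (\<theta> * y) - 1 - \<theta> * y) / \<theta>\<^sup>2) \<longlongrightarrow> y\<^sup>2 / 2) (at_right 0)"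
proof -
  consider "y > 0" | "y = 0" | "y < 0" by linarith
  then show ?thesis
  proof cases
    case 1 then show ?thesis by real_asymp (simp add: power2_eq_square)
  next
    case 3 then show ?thesis by real_asymp (simp add: power2_eq_square)
  qed simp
qed

lemma exp_first_order: "((\<lambda>\<theta>::real. (exp (\<theta> * y) - 1) / \<theta>) \<longlongrightarrow> y) (at_right 0)"
proof -
  consider "y > 0" | "y = 0" | "y < 0" by linarith
  then show ?thesis
  proof cases
    case 1 then show ?thesis by real_asymp
  next
    case 3 then show ?thesis by real_asymp
  qed simp
qed

context
  fixes Z :: "'z set" and P X :: "'z \<Rightarrow> real" and m V :: real and b :: "nat \<Rightarrow> real"
  assumes Z: "finite Z" and P0: "\<And>z. z \<in> Z \<Longrightarrow> 0 \<le> P z" and P1: "sum P Z = 1"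
    and m: "m = (\<Sum>z\<in>Z. P z * X z)" and V: "V = (\<Sum>z\<in>Z. P z * (X z - m)\<^sup>2)" and Vpos: "V > 0"
    and b: "\<And>n. b n > 0" "b \<longlonglongrightarrow> 0"
begin

definition Yc :: "'z \<Rightarrow> real" where "Yc z = X z - m"

definition mgf :: "real \<Rightarrow> real" where "mgf \<theta> = (\<Sum>z\<in>Z. P z * exp (\<theta> * Yc z))"

lemma sum_Yc: "(\<Sum>z\<in>Z. P z * Yc z) = 0"
  using P1 m unfolding Yc_def by (simp add: right_diff_distrib sum_subtractf flip: sum_distrib_right)

lemma mgf_pos: "mgf \<theta> > 0"
proof -
  have "0 \<le> mgf \<theta>" unfolding mgf_def by (intro sum_nonneg mult_nonneg_nonneg P0) auto
  moreover have "mgf \<theta> \<noteq> 0"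
  proof
    assume "mgf \<theta> = 0"
    then have "\<forall>z\<in>Z. P z * exp (\<theta> * Yc z) = 0"
      unfolding mgf_def using Z P0 by (subst (asm) sum_nonneg_eq_0_iff) auto
    then have "sum P Z = 0" by simp
    then show False using P1 by simp
  qed
  ultimately show ?thesis by linarith
qed

text \<open>Centring removes the first-order term, so the expansion of \<open>mgf\<close> at 0 is 1
  + V \<theta>^2 / 2 + ....\<close>

lemma mgf_second_order: "((\<lambda>\<theta>. (mgf \<theta> - 1) / \<theta>\<^sup>2) \<longlongrightarrow> V / 2) (at_right 0)"
proof -
  have "((\<lambda>\<theta>. \<Sum>z\<in>Z. P z * ((exp (\<theta> * Yc z) - 1 - \<theta> * Yc z) / \<theta>\<^sup>2)) \<longlongrightarrow> (\<Sum>z\<in>Z. P z * ((Yc z)\<^sup>2 / 2))) (at_right 0)"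
    by (intro tendsto_sum tendsto_mult tendsto_const exp_second_order)
  moreover have "(\<Sum>z\<in>Z. P z * ((exp (\<theta> * Yc z) - 1 - \<theta> * Yc z) / \<theta>\<^sup>2)) = (mgf \<theta> - 1) / \<theta>\<^sup>2" for \<theta>
  proof -
    have "(\<Sum>z\<in>Z. P z * ((exp (\<theta> * Yc z) - 1 - \<theta> * Yc z) / \<theta>\<^sup>2)) =
       (\<Sum>z\<in>Z. P z * exp (\<theta> * Yc z) - P z - \<theta> * (P z * Yc z)) / \<theta>\<^sup>2"
      unfolding sum_divide_distrib by (intro sum.cong refl) (simp add: algebra_simps)
    then show ?thesis
      by (simp add: sum_subtractf mgf_def P1 sum_Yc flip: sum_distrib_left)
  qed
  moreover have "(\<Sum>z\<in>Z. P z * ((Yc z)\<^sup>2 / 2)) = V / 2"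
    unfolding V Yc_def by (simp add: sum_divide_distrib)
  ultimately show ?thesis by (simp only:)
qed

lemma mgf_tendsto: "(mgf \<longlongrightarrow> 1) (at_right 0)"
proof -
  have "((\<lambda>\<theta>. \<Sum>z\<in>Z. P z * exp (\<theta> * Yc z)) \<longlongrightarrow> (\<Sum>z\<in>Z. P z * exp (0 * Yc z))) (at_right 0)"
    by (intro tendsto_intros)
  then show ?thesis using P1 by (simp add: mgf_def[abs_def])
qed

text \<open>Mean of the centred summand under the tilted law, which is the derivative of the
  logarithm of \<open>mgf\<close>.\<close>

definition tmean :: "real \<Rightarrow> real" where "tmean \<theta> = (\<Sum>z\<in>Z. P z * exp (\<theta> * Yc z) / mgf \<theta> * Yc z)"

lemma tmean_first_order: "((\<lambda>\<theta>. tmean \<theta> / \<theta>) \<longlongrightarrow> V) (at_right 0)"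
proof -
  have "((\<lambda>\<theta>. (\<Sum>z\<in>Z. P z * Yc z * ((exp (\<theta> * Yc z) - 1) / \<theta>)) / mgf \<theta>) \<longlongrightarrow> (\<Sum>z\<in>Z. P z * Yc z * Yc z) / 1) (at_right 0)"
    by (intro tendsto_divide tendsto_sum tendsto_mult tendsto_const exp_first_order mgf_tendsto) simp
  moreover have "(\<Sum>z\<in>Z. P z * Yc z * ((exp (\<theta> * Yc z) - 1) / \<theta>)) / mgf \<theta> = tmean \<theta> / \<theta>" for \<theta>
  proof -
    have "(\<Sum>z\<in>Z. P z * Yc z * ((exp (\<theta> * Yc z) - 1) / \<theta>)) = (\<Sum>z\<in>Z. P z * exp (\<theta> * Yc z) * Yc z - P z * Yc z) / \<theta>"
      unfolding sum_divide_distrib by (intro sum.cong refl) (simp add: algebra_simps)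
    also have "\<dots> = (\<Sum>z\<in>Z. P z * exp (\<theta> * Yc z) * Yc z) / \<theta>" by (simp add: sum_subtractf sum_Yc)
    finally show ?thesis by (simp add: tmean_def sum_divide_distrib mult_ac)
  qed
  moreover have "(\<Sum>z\<in>Z. P z * Yc z * Yc z) / 1 = V"
    unfolding V Yc_def by (simp add: power2_eq_square mult_ac)
  ultimately show ?thesis by simp
qed

lemma filterlim_scaled: "c > 0 \<Longrightarrow> filterlim (\<lambda>n. c * b n) (at_right 0) sequentially"
proof -
  assume c: "c > 0"
  have "(\<lambda>n. c * b n) \<longlonglongrightarrow> 0" using tendsto_mult_left[OF b(2), of c] by simp
  moreover have "\<forall>n. c * b n \<in> {0<..} \<and> c * b n \<noteq> 0" using b(1) c by (auto simp: less_imp_neq[symmetric])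
  ultimately show ?thesis by (simp add: filterlim_at always_eventually)
qed

text \<open>Chernoff's bound with the tilt b_n / V, the minimiser of V \<theta>^2 / 2 - \<theta>
  b_n. This quadratic replaces the logarithm of the bound per summand, because the tilt tends to
  0.\<close>

theorem moderate_deviation_upper:
  assumes \<kappa>: "\<kappa> < 1 / (2 * V)"
  shows "\<forall>\<^sub>F n in sequentially. iexp Z P X n (\<lambda>s. of_bool (real n * (m + b n) < s)) \<le> exp (- \<kappa> * (real n * (b n)\<^sup>2))"
proof -
  define \<theta> where "\<theta> n = 1 / V * b n" for n
  have \<theta>: "filterlim \<theta> (at_right 0) sequentially" unfolding \<theta>_def using Vpos by (intro filterlim_scaled) simp
  have "(\<lambda>n. 1 / V - (mgf (\<theta> n) - 1) / (\<theta> n)\<^sup>2 / V\<^sup>2) \<longlonglongrightarrow> 1 / V - V / 2 / V\<^sup>2"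
    using Vpos by (intro tendsto_intros filterlim_compose[OF mgf_second_order \<theta>]) auto
  also have "1 / V - V / 2 / V\<^sup>2 = 1 / (2 * V)" using Vpos by (simp add: field_simps power2_eq_square)
  finally have "\<forall>\<^sub>F n in sequentially. \<kappa> < 1 / V - (mgf (\<theta> n) - 1) / (\<theta> n)\<^sup>2 / V\<^sup>2"
    using \<kappa> by (rule order_tendstoD(1))
  then show ?thesis
  proof eventually_elim
    case (elim n)
    have \<theta>n: "0 < \<theta> n" using b(1)[of n] Vpos by (simp add: \<theta>_def)
    have "iexp Z P X n (\<lambda>s. of_bool (real n * (m + b n) < s)) = iexp Z P Yc n (\<lambda>s. of_bool (real n * b n < s))"
      unfolding Yc_def[abs_def] by (subst iexp_center[where m = m]) (simp add: algebra_simps)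
    also have "\<dots> \<le> iexp Z P Yc n (\<lambda>s. exp (- \<theta> n * (real n * b n)) * (exp (\<theta> n * s) * 1))"
      by (rule iexp_mono[OF P0]) (use \<theta>n in \<open>auto simp flip: exp_add\<close>)
    also have "\<dots> = exp (- \<theta> n * (real n * b n)) * mgf (\<theta> n) ^ n * iexp Z (\<lambda>z. P z * exp (\<theta> n * Yc z) / mgf (\<theta> n)) Yc n (\<lambda>_. 1)"
      using mgf_pos[of "\<theta> n"] by (simp only: iexp_cmult) (subst iexp_tilt[of "mgf (\<theta> n)"], simp_all)
    also have "\<dots> = exp (- \<theta> n * (real n * b n)) * mgf (\<theta> n) ^ n"
      using mgf_pos[of "\<theta> n"] by (subst iexp_const) (simp_all add: mgf_def flip: sum_divide_distrib)
    \<comment> \<open>M <= exp (M - 1) puts \<open>mgf\<close> into the exponent in the form whose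
      second-order limit is known.\<close>
    also have "\<dots> \<le> exp (- \<theta> n * (real n * b n)) * exp (mgf (\<theta> n) - 1) ^ n"
      using mgf_pos[of "\<theta> n"] exp_ge_add_one_self[of "mgf (\<theta> n) - 1"] by (intro mult_left_mono power_mono) auto
    also have "\<dots> = exp (- (1 / V - (mgf (\<theta> n) - 1) / (\<theta> n)\<^sup>2 / V\<^sup>2) * (real n * (b n)\<^sup>2))"
    proof -
      have "(b n)\<^sup>2 = (\<theta> n)\<^sup>2 * V\<^sup>2" "\<theta> n * b n = (b n)\<^sup>2 / V" using Vpos by (simp_all add: \<theta>_def power_divide power2_eq_square)
      then have "(mgf (\<theta> n) - 1) / (\<theta> n)\<^sup>2 / V\<^sup>2 * (b n)\<^sup>2 = mgf (\<theta> n) - 1" "1 / V * (b n)\<^sup>2 = \<theta> n * b n"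
        using \<theta>n Vpos by simp_all
      then have "(1 / V - (mgf (\<theta> n) - 1) / (\<theta> n)\<^sup>2 / V\<^sup>2) * (b n)\<^sup>2 = \<theta> n * b n - (mgf (\<theta> n) - 1)"
        unfolding left_diff_distrib by presburger
      then have "- (1 / V - (mgf (\<theta> n) - 1) / (\<theta> n)\<^sup>2 / V\<^sup>2) * (real n * (b n)\<^sup>2) = - real n * (\<theta> n * b n - (mgf (\<theta> n) - 1))"
      proof -
        assume a: "(1 / V - (mgf (\<theta> n) - 1) / (\<theta> n)\<^sup>2 / V\<^sup>2) * (b n)\<^sup>2 = \<theta> n * b n - (mgf (\<theta> n) - 1)"
        have "- r * (real n * (b n)\<^sup>2) = - real n * (r * (b n)\<^sup>2)" for r by simp
        then show ?thesis using a by (simp only:)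
      qed
      then show ?thesis by (simp add: exp_of_nat_mult[symmetric] exp_add[symmetric] algebra_simps)
    qed
    also have "\<dots> \<le> exp (- \<kappa> * (real n * (b n)\<^sup>2))"
      unfolding exp_le_cancel_iff using elim by (intro mult_right_mono) auto
    finally show ?case .
  qed
qed

text \<open>The tilt (1 + \<delta>) b_n / V overshoots: the tilted mean is close to (1 + \<delta>)
  b_n, so by Chebyshev at least half of the tilted mass has its sum between n b_n and (1 + 2
  \<delta>) n b_n. On that window the price of undoing the tilt is largest at the upper end.\<close>

theorem moderate_deviation_lower:
  assumes \<kappa>: "\<kappa> > 1 / (2 * V)" and nb: "filterlim (\<lambda>n. real n * (b n)\<^sup>2) at_top sequentially"
  shows "\<forall>\<^sub>F n in sequentially. exp (- \<kappa> * (real n * (b n)\<^sup>2)) \<le> iexp Z P X n (\<lambda>s. of_bool (real n * (m + b n) \<le> s))"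
proof -
  \<comment> \<open>The exponent for a fixed overshoot, in units of n b_n^2: tilt times upper end of
    the window, minus the quadratic approximation of log \<open>mgf\<close>. It tends to 1 / (2 V),
    so some small \<delta> > 0 keeps it below \<kappa>.\<close>
  define rate where "rate \<delta> = (1 + \<delta>) * (1 + 2 * \<delta>) / V - (1 + \<delta>)\<^sup>2 / (2 * V)" for \<delta> :: real
  have "(rate \<longlongrightarrow> (1 + 0) * (1 + 2 * 0) / V - (1 + 0)\<^sup>2 / (2 * V)) (at_right 0)"
    unfolding rate_def[abs_def] by (intro tendsto_intros) (use Vpos in auto)
  also have "(1 + 0) * (1 + 2 * 0) / V - (1 + 0)\<^sup>2 / (2 * V) = 1 / (2 * V)" by (simp add: field_simps)
  finally have "\<forall>\<^sub>F \<delta> in at_right 0. rate \<delta> < \<kappa>" using \<kappa> by (rule order_tendstoD(2))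
  moreover have "\<forall>\<^sub>F \<delta> in at_right (0::real). 0 < \<delta>" by (rule eventually_at_right_less)
  ultimately have "\<forall>\<^sub>F \<delta> in at_right 0. rate \<delta> < \<kappa> \<and> 0 < \<delta>" by (rule eventually_conj)
  then obtain \<delta> where \<delta>: "rate \<delta> < \<kappa>" "0 < \<delta>" using eventually_happens[of _ "at_right (0::real)"] by auto
  obtain \<kappa>' where \<kappa>': "rate \<delta> < \<kappa>'" "\<kappa>' < \<kappa>" using dense[OF \<delta>(1)] by blast
  define c where "c = (1 + \<delta>) / V"
  have c: "c > 0" using \<delta> Vpos by (simp add: c_def)
  define \<theta> where "\<theta> n = c * b n" for n
  have \<theta>: "filterlim \<theta> (at_right 0) sequentially" unfolding \<theta>_def by (intro filterlim_scaled c)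
  \<comment> \<open>Bounds the tilted variance uniformly in n: a variance is at most the second
    moment, whatever the weights are.\<close>
  define B where "B = (\<Sum>z\<in>Z. (Yc z)\<^sup>2)"
  have B: "(Yc z)\<^sup>2 \<le> B" if "z \<in> Z" for z unfolding B_def using that Z by (intro member_le_sum) auto
  have "(\<lambda>n. (1 + \<delta>) * (1 + 2 * \<delta>) / V - (mgf (\<theta> n) - 1) / (\<theta> n)\<^sup>2 / mgf (\<theta> n) * c\<^sup>2) \<longlonglongrightarrow>
     (1 + \<delta>) * (1 + 2 * \<delta>) / V - V / 2 / 1 * c\<^sup>2"
    by (intro tendsto_intros filterlim_compose[OF mgf_second_order \<theta>] filterlim_compose[OF mgf_tendsto \<theta>]) auto
  also have "(1 + \<delta>) * (1 + 2 * \<delta>) / V - V / 2 / 1 * c\<^sup>2 = rate \<delta>"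
    using Vpos by (simp add: rate_def c_def power_divide power2_eq_square)
  finally have e1: "\<forall>\<^sub>F n in sequentially. (1 + \<delta>) * (1 + 2 * \<delta>) / V - (mgf (\<theta> n) - 1) / (\<theta> n)\<^sup>2 / mgf (\<theta> n) * c\<^sup>2 < \<kappa>'"
    using \<kappa>'(1) by (rule order_tendstoD(2))
  have "(\<lambda>n. tmean (\<theta> n) / \<theta> n * c) \<longlonglongrightarrow> V * c"
    by (intro tendsto_intros filterlim_compose[OF tmean_first_order \<theta>])
  then have lim2: "(\<lambda>n. tmean (\<theta> n) / \<theta> n * c) \<longlonglongrightarrow> 1 + \<delta>" using Vpos by (simp add: c_def)
  have e2: "\<forall>\<^sub>F n in sequentially. 1 + \<delta> / 2 < tmean (\<theta> n) / \<theta> n * c"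
    using \<delta> by (intro order_tendstoD(1)[OF lim2]) simp
  have e3: "\<forall>\<^sub>F n in sequentially. tmean (\<theta> n) / \<theta> n * c < 1 + 3 / 2 * \<delta>"
    using \<delta> by (intro order_tendstoD(2)[OF lim2]) simp
  \<comment> \<open>Sized so that Chebyshev's n v / t^2 with t = n \<delta> b_n / 2 is at most 1 /
    2; the summand 1 also excludes n = 0.\<close>
  have e4: "\<forall>\<^sub>F n in sequentially. 8 * B / \<delta>\<^sup>2 + 1 \<le> real n * (b n)\<^sup>2"
    using nb unfolding filterlim_at_top by blast
  \<comment> \<open>Lets the gap between \<kappa>' and \<kappa> pay for the factor 1 / 2 lost to
    Chebyshev.\<close>
  have e5: "\<forall>\<^sub>F n in sequentially. ln 2 / (\<kappa> - \<kappa>') \<le> real n * (b n)\<^sup>2"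
    using nb unfolding filterlim_at_top by blast
  show ?thesis using e1 e2 e3 e4 e5
  proof eventually_elim
    case (elim n)
    let ?\<theta> = "\<theta> n" and ?b = "b n"
    have bn: "0 < ?b" by (rule b(1))
    have \<theta>n: "0 < ?\<theta>" using bn c by (simp add: \<theta>_def)
    define M where "M = mgf ?\<theta>"
    have M: "M > 0" unfolding M_def by (rule mgf_pos)
    define P' where "P' z = P z * exp (?\<theta> * Yc z) / M" for z
    have P'0: "0 \<le> P' z" if "z \<in> Z" for z using P0[OF that] M by (simp add: P'_def)
    have P'1: "sum P' Z = 1" using M by (simp add: P'_def M_def mgf_def flip: sum_divide_distrib)
    define \<mu> where "\<mu> = tmean ?\<theta>"
    have \<mu>: "(\<Sum>z\<in>Z. P' z * Yc z) = \<mu>" by (simp add: \<mu>_def tmean_def P'_def M_def)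
    have "tmean ?\<theta> / ?\<theta> * c = \<mu> / ?b" using c by (simp add: \<mu>_def \<theta>_def)
    note eq = this
    have \<mu>1: "(1 + \<delta> / 2) * ?b < \<mu>" and \<mu>2: "\<mu> < (1 + 3 / 2 * \<delta>) * ?b"
      using elim(2,3) bn unfolding eq by (simp_all add: pos_less_divide_eq pos_divide_less_eq)
    define v where "v = (\<Sum>z\<in>Z. P' z * (Yc z - \<mu>)\<^sup>2)"
    have "v \<le> B"
    proof -
      have "v = (\<Sum>z\<in>Z. P' z * (Yc z)\<^sup>2 - 2 * \<mu> * (P' z * Yc z) + \<mu>\<^sup>2 * P' z)"
        unfolding v_def by (intro sum.cong refl) (simp add: power2_eq_square algebra_simps)
      also have "\<dots> = (\<Sum>z\<in>Z. P' z * (Yc z)\<^sup>2) - 2 * \<mu> * \<mu> + \<mu>\<^sup>2 * 1"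
        unfolding sum.distrib sum_subtractf sum_distrib_left[symmetric] \<mu> P'1 ..
      also have "\<dots> \<le> (\<Sum>z\<in>Z. P' z * (Yc z)\<^sup>2)" by (simp add: power2_eq_square)
      also have "\<dots> \<le> (\<Sum>z\<in>Z. P' z * B)" by (intro sum_mono mult_left_mono B P'0)
      also have "\<dots> = B" using P'1 by (simp flip: sum_distrib_right)
      finally show ?thesis .
    qed
    have B0: "0 \<le> B" unfolding B_def by (intro sum_nonneg) auto
    have npos: "real n > 0"
    proof (rule ccontr)
      assume "\<not> 0 < real n"
      then have "8 * B / \<delta>\<^sup>2 + 1 \<le> 0" using elim(4) by simp
      then show False using B0 by (smt (verit) divide_nonneg_nonneg zero_le_power2)
    qed
    define t where "t = real n * (\<delta> / 2 * ?b)"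
    have t: "t > 0" using npos \<delta> bn by (simp add: t_def)
    \<comment> \<open>Chebyshev in pointwise form: this parabola lies below the indicator of the
      window around the tilted mean, and its expectation is computed by
      \<open>iexp_square\<close>.\<close>
    have cheb: "1 / 2 \<le> iexp Z P' Yc n (\<lambda>s. 1 - (1 / t\<^sup>2) * (s - real n * \<mu> + 0)\<^sup>2)"
    proof -
      have "iexp Z P' Yc n (\<lambda>s. 1 - (1 / t\<^sup>2) * (s - real n * \<mu> + 0)\<^sup>2) = 1 - 1 / t\<^sup>2 * (real n * v)"
        unfolding iexp_diff iexp_cmult iexp_const[OF P'1] iexp_square[OF P'1 \<mu>] by (simp add: v_def)
      moreover have "1 / t\<^sup>2 * (real n * v) \<le> 1 / 2"
      proof -
        have "8 * B / \<delta>\<^sup>2 \<le> real n * ?b\<^sup>2" using elim(4) by simp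
        then have "8 * B \<le> real n * ?b\<^sup>2 * \<delta>\<^sup>2" using \<delta> by (simp add: field_simps)
        then have "8 * v \<le> real n * ?b\<^sup>2 * \<delta>\<^sup>2" using \<open>v \<le> B\<close> by linarith
        then have "real n * (8 * v) \<le> real n * (real n * ?b\<^sup>2 * \<delta>\<^sup>2)" using npos by (intro mult_left_mono) auto
        then have "real n * v \<le> t\<^sup>2 / 2" by (simp add: t_def power2_eq_square algebra_simps)
        then show ?thesis using t by (simp add: field_simps)
      qed
      ultimately show ?thesis by simp
    qed
    have "exp (- \<kappa> * (real n * ?b\<^sup>2)) \<le> exp (- \<kappa>' * (real n * ?b\<^sup>2)) * (1 / 2)"
    proof -
      have "ln 2 \<le> (\<kappa> - \<kappa>') * (real n * ?b\<^sup>2)" using elim(5) \<kappa>'(2) by (simp add: field_simps)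
      then have "- \<kappa> * (real n * ?b\<^sup>2) \<le> - \<kappa>' * (real n * ?b\<^sup>2) - ln 2" by (simp add: algebra_simps)
      then have "exp (- \<kappa> * (real n * ?b\<^sup>2)) \<le> exp (- \<kappa>' * (real n * ?b\<^sup>2) - ln 2)" by simp
      then show ?thesis by (simp add: exp_diff)
    qed
    also have "\<dots> \<le> exp (- ?\<theta> * (real n * (1 + 2 * \<delta>) * ?b)) * M ^ n * (1 / 2)"
    proof -
      \<comment> \<open>The lower counterpart of M <= exp (M - 1), obtained from that inequality at
        1 / M.\<close>
      have "exp (1 - 1 / M) \<le> M"
      proof -
        have "1 + (1 / M - 1) \<le> exp (1 / M - 1)" by (rule exp_ge_add_one_self)
        then have "1 / exp (1 / M - 1) \<le> M" using M by (simp add: field_simps)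
        moreover have "exp (1 - 1 / M) = 1 / exp (1 / M - 1)" by (simp add: exp_diff)
        ultimately show ?thesis by (simp only:)
      qed
      then have 1: "exp (1 - 1 / M) ^ n \<le> M ^ n" by (intro power_mono) auto
      have "\<kappa>' * ?b\<^sup>2 \<ge> ((1 + \<delta>) * (1 + 2 * \<delta>) / V - (M - 1) / ?\<theta>\<^sup>2 / M * c\<^sup>2) * ?b\<^sup>2"
        using elim(1) unfolding M_def by (intro mult_right_mono) auto
      also have "((1 + \<delta>) * (1 + 2 * \<delta>) / V - (M - 1) / ?\<theta>\<^sup>2 / M * c\<^sup>2) * ?b\<^sup>2 =
          ?\<theta> * ((1 + 2 * \<delta>) * ?b) - (1 - 1 / M)"
      proof -
        have "(M - 1) / ?\<theta>\<^sup>2 / M * c\<^sup>2 * ?b\<^sup>2 = (1 - 1 / M) * (?\<theta>\<^sup>2 / ?\<theta>\<^sup>2)"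
          using M by (simp add: \<theta>_def power_mult_distrib field_simps)
        also have "\<dots> = 1 - 1 / M" using \<theta>n by simp
        finally show ?thesis unfolding left_diff_distrib by (simp add: \<theta>_def c_def power2_eq_square)
      qed
      finally have "- \<kappa>' * ?b\<^sup>2 \<le> - ?\<theta> * ((1 + 2 * \<delta>) * ?b) + (1 - 1 / M)" by simp
      from mult_left_mono[OF this, of "real n"]
      have "- \<kappa>' * (real n * ?b\<^sup>2) \<le> - ?\<theta> * (real n * (1 + 2 * \<delta>) * ?b) + real n * (1 - 1 / M)"
        by (simp add: algebra_simps)
      then have "exp (- \<kappa>' * (real n * ?b\<^sup>2)) \<le> exp (- ?\<theta> * (real n * (1 + 2 * \<delta>) * ?b)) * exp (1 - 1 / M) ^ n"
        by (simp add: exp_of_nat_mult[symmetric] flip: exp_add)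
      also have "\<dots> \<le> exp (- ?\<theta> * (real n * (1 + 2 * \<delta>) * ?b)) * M ^ n" using 1 by (intro mult_left_mono) auto
      finally show ?thesis by simp
    qed
    also have "\<dots> \<le> exp (- ?\<theta> * (real n * (1 + 2 * \<delta>) * ?b)) * M ^ n * iexp Z P' Yc n (\<lambda>s. 1 - (1 / t\<^sup>2) * (s - real n * \<mu> + 0)\<^sup>2)"
      using cheb M by (intro mult_left_mono) auto
    also have "\<dots> \<le> exp (- ?\<theta> * (real n * (1 + 2 * \<delta>) * ?b)) * M ^ n * iexp Z P' Yc n (\<lambda>s. of_bool (\<bar>s - real n * \<mu>\<bar> \<le> t))"
    proof (intro mult_left_mono iexp_mono P'0)
      fix s
      show "1 - (1 / t\<^sup>2) * (s - real n * \<mu> + 0)\<^sup>2 \<le> of_bool (\<bar>s - real n * \<mu>\<bar> \<le> t)"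
      proof (cases "\<bar>s - real n * \<mu>\<bar> \<le> t")
        case False
        then have "t\<^sup>2 \<le> \<bar>s - real n * \<mu>\<bar>\<^sup>2" using t by (intro power_mono) auto
        then show ?thesis using False t by (simp add: field_simps)
      qed simp
    qed (use M in auto)
    also have "\<dots> = iexp Z P Yc n (\<lambda>s. exp (- ?\<theta> * (real n * (1 + 2 * \<delta>) * ?b)) * (exp (?\<theta> * s) * of_bool (\<bar>s - real n * \<mu>\<bar> \<le> t)))"
      using M unfolding iexp_cmult P'_def[abs_def] by (subst iexp_tilt[of M]) simp_all
    also have "\<dots> \<le> iexp Z P Yc n (\<lambda>s. of_bool (real n * ?b \<le> s))"
    proof (rule iexp_mono[OF P0])
      fix s
      show "exp (- ?\<theta> * (real n * (1 + 2 * \<delta>) * ?b)) * (exp (?\<theta> * s) * of_bool (\<bar>s - real n * \<mu>\<bar> \<le> t)) \<le> of_bool (real n * ?b \<le> s)"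
      proof (cases "\<bar>s - real n * \<mu>\<bar> \<le> t")
        case True
        have "real n * ((1 + \<delta> / 2) * ?b) \<le> real n * \<mu>" "real n * \<mu> \<le> real n * ((1 + 3 / 2 * \<delta>) * ?b)"
          using \<mu>1 \<mu>2 npos by (auto intro!: mult_left_mono)
        moreover have "real n * ((1 + \<delta> / 2) * ?b) = real n * ?b + t" "real n * ((1 + 3 / 2 * \<delta>) * ?b) = real n * (1 + 2 * \<delta>) * ?b - t"
          by (simp_all add: t_def algebra_simps)
        ultimately have s: "real n * ?b \<le> s" "s \<le> real n * (1 + 2 * \<delta>) * ?b" using True by linarith+
        then have "?\<theta> * s \<le> ?\<theta> * (real n * (1 + 2 * \<delta>) * ?b)" using \<theta>n by (intro mult_left_mono) auto
        then show ?thesis using s(1) True by (simp flip: exp_add)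
      qed simp
    qed auto
    also have "\<dots> = iexp Z P X n (\<lambda>s. of_bool (real n * (m + ?b) \<le> s))"
      unfolding Yc_def[abs_def] by (subst (2) iexp_center[where m = m]) (simp add: algebra_simps)
    finally show ?case .
  qed
qed

end

section \<open>Moderate deviations for the composite tests\<close>


lemma sym_density_tpow:
  assumes "density d \<sigma>" shows "sym_density d n (tpow \<sigma> n)"
  unfolding sym_density_def
proof (intro conjI allI impI)
  show "density (d ^ n) (tpow \<sigma> n)" by (rule density_tpow[OF assms])
  fix \<pi> :: "nat \<Rightarrow> nat" assume \<pi>: "\<pi> permutes {..<n}"
  let ?P = "perm_op d n \<pi>"
  have \<sigma>: "\<sigma> \<in> carrier_mat d d" using assms by (simp add: density_def)
  have Pc: "?P \<in> carrier_mat (d ^ n) (d ^ n)" by (rule perm_op_carrier[OF \<pi>])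
  have "?P * tpow \<sigma> n * adj ?P = tpow \<sigma> n * (?P * adj ?P)"
    unfolding perm_op_tpow[OF \<pi> \<sigma>] by (rule assoc_sq[OF tpow_carrier[OF \<sigma>] Pc adj_carrier[OF Pc]])
  also have "\<dots> = tpow \<sigma> n"
    using unitary_perm_op[OF \<pi>, of d] right_mult_one_mat[OF tpow_carrier[OF \<sigma>]] by (simp add: unitary_def)
  finally show "?P * tpow \<sigma> n * adj ?P = tpow \<sigma> n" .
qed

lemma error_eq:
  assumes "density N \<rho>" "T \<in> carrier_mat N N"
  shows "Re (mtrace (\<rho> * (1\<^sub>m N - T))) = 1 - Re (mtrace (\<rho> * T))"
proof -
  have c: "\<rho> \<in> carrier_mat N N" using assms by (simp add: density_def)
  have "mtrace (\<rho> * (1\<^sub>m N - T)) = mtrace \<rho> - mtrace (\<rho> * T)"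
    unfolding mult_minus_distrib_mat[OF c one_carrier_mat assms(2)] right_mult_one_mat[OF c]
    by (rule mtrace_minus[OF c mult_carrier_sq[OF c assms(2)]])
  then show ?thesis using assms by (simp add: density_def)
qed

lemma test_op_carrier: "test_op N T \<Longrightarrow> T \<in> carrier_mat N N"
  by (simp add: test_op_def)

lemma test_op_zero: "test_op N (0\<^sub>m N N)"
proof -
  have "proj N (0\<^sub>m N N)" by (auto simp: proj_def hermitian_def intro!: eq_matI)
  then show ?thesis by (rule test_op_proj)
qed

context
  fixes dA dB n :: nat and \<rho> :: "complex mat" and \<mu> :: real
  assumes \<rho>: "density (dA * dB) \<rho>" and \<mu>: "0 \<le> \<mu>"
begin

lemma error_nonneg: "test_op ((dA * dB) ^ n) T \<Longrightarrow> 0 \<le> Re (mtrace (tpow \<rho> n * (1\<^sub>m ((dA * dB) ^ n) - T)))"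
  using psd_trace_mult_nonneg[of "(dA * dB) ^ n" "tpow \<rho> n"] density_tpow[OF \<rho>, of n]
  by (auto simp: test_op_def density_def)

text \<open>The zero test meets every constraint, so both infima range over nonempty sets.\<close>

lemma mult_zero_le: "Re (mtrace (regroup dA dB n X * 0\<^sub>m ((dA * dB) ^ n) ((dA * dB) ^ n))) \<le> \<mu>"
  using \<mu> right_mult_zero_mat[OF regroup_carrier, of dA dB n X "(dA * dB) ^ n"] by (simp add: mtrace_def)

lemma alpha_hat_achieves:
  assumes T: "test_op ((dA * dB) ^ n) T"
    and "\<And>\<sigma> \<tau>. sym_density dA n \<sigma> \<Longrightarrow> sym_density dB n \<tau> \<Longrightarrow> Re (mtrace (regroup dA dB n (kron \<sigma> \<tau>) * T)) \<le> \<mu>"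
  shows "Re (mtrace (tpow \<rho> n * T)) \<le> 1 - alpha_hat dA dB \<rho> n \<mu>"
proof -
  have "alpha_hat dA dB \<rho> n \<mu> \<le> Re (mtrace (tpow \<rho> n * (1\<^sub>m ((dA * dB) ^ n) - T)))"
    unfolding alpha_hat_def
    by (rule cInf_lower) (use assms error_nonneg in \<open>auto intro!: bdd_belowI[of _ 0]\<close>)
  then show ?thesis using error_eq[OF density_tpow[OF \<rho>] test_op_carrier[OF T]] by simp
qed

lemma alpha_hat_iid_bound:
  assumes "\<And>T. test_op ((dA * dB) ^ n) T \<Longrightarrow>
      (\<And>\<sigma> \<tau>. density dA \<sigma> \<Longrightarrow> density dB \<tau> \<Longrightarrow> Re (mtrace (regroup dA dB n (kron (tpow \<sigma> n) (tpow \<tau> n)) * T)) \<le> \<mu>) \<Longrightarrow>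
      Re (mtrace (tpow \<rho> n * T)) \<le> B"
  shows "1 - alpha_hat_iid dA dB \<rho> n \<mu> \<le> B"
proof -
  have "1 - B \<le> alpha_hat_iid dA dB \<rho> n \<mu>"
    unfolding alpha_hat_iid_def
  proof (rule cInf_greatest)
    show "{Re (mtrace (tpow \<rho> n * (1\<^sub>m ((dA * dB) ^ n) - T))) | T. test_op ((dA * dB) ^ n) T \<and>
       (\<forall>\<sigma> \<tau>. density dA \<sigma> \<longrightarrow> density dB \<tau> \<longrightarrow>
        Re (mtrace (regroup dA dB n (kron (tpow \<sigma> n) (tpow \<tau> n)) * T)) \<le> \<mu>)} \<noteq> {}"
      using test_op_zero mult_zero_le by blast
    fix x assume "x \<in> {Re (mtrace (tpow \<rho> n * (1\<^sub>m ((dA * dB) ^ n) - T))) | T. test_op ((dA * dB) ^ n) T \<and>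
       (\<forall>\<sigma> \<tau>. density dA \<sigma> \<longrightarrow> density dB \<tau> \<longrightarrow>
        Re (mtrace (regroup dA dB n (kron (tpow \<sigma> n) (tpow \<tau> n)) * T)) \<le> \<mu>)}"
    then obtain T where T: "x = Re (mtrace (tpow \<rho> n * (1\<^sub>m ((dA * dB) ^ n) - T)))" "test_op ((dA * dB) ^ n) T"
      "Re (mtrace (tpow \<rho> n * T)) \<le> B" using assms by blast
    then show "1 - B \<le> x" using error_eq[OF density_tpow[OF \<rho>] test_op_carrier[OF T(2)]] by simp
  qed
  then show ?thesis by simp
qed

text \<open>Powers of states are symmetric by \<open>sym_density_tpow\<close>, so a test that meets
  the symmetric constraints also meets the i.i.d. ones.\<close>

lemma alpha_hat_iid_le: "alpha_hat_iid dA dB \<rho> n \<mu> \<le> alpha_hat dA dB \<rho> n \<mu>"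
  unfolding alpha_hat_def alpha_hat_iid_def
proof (rule cInf_superset_mono)
  show "{Re (mtrace (tpow \<rho> n * (1\<^sub>m ((dA * dB) ^ n) - T))) | T. test_op ((dA * dB) ^ n) T \<and>
       (\<forall>\<sigma> \<tau>. sym_density dA n \<sigma> \<longrightarrow> sym_density dB n \<tau> \<longrightarrow>
        Re (mtrace (regroup dA dB n (kron \<sigma> \<tau>) * T)) \<le> \<mu>)} \<noteq> {}"
    using test_op_zero mult_zero_le by blast
  show "bdd_below {Re (mtrace (tpow \<rho> n * (1\<^sub>m ((dA * dB) ^ n) - T))) | T. test_op ((dA * dB) ^ n) T \<and>
       (\<forall>\<sigma> \<tau>. density dA \<sigma> \<longrightarrow> density dB \<tau> \<longrightarrow>
        Re (mtrace (regroup dA dB n (kron (tpow \<sigma> n) (tpow \<tau> n)) * T)) \<le> \<mu>)}"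
    using error_nonneg by (auto intro!: bdd_belowI[of _ 0])
qed (use sym_density_tpow in blast)

end

text \<open>One choice of the data provided by \<open>information_spectral_data\<close>, kept fixed
  for all n.\<close>

locale spectral_data =
  fixes dA dB :: nat and \<rho> U F UA UB :: "complex mat" and p q \<alpha> \<beta> :: "nat \<Rightarrow> real"
  assumes \<rho>: "density (dA * dB) \<rho>"
    and U: "unitary (dA * dB) U" and p: "\<And>i. i < dA * dB \<Longrightarrow> 0 \<le> p i" and \<rho>_spec: "\<rho> = spec (dA * dB) U p"
    and F: "unitary (dA * dB) F" and q: "\<And>j. j < dA * dB \<Longrightarrow> 0 \<le> q j"
    and prod_spec: "kron (ptrB dA dB \<rho>) (ptrA dA dB \<rho>) = spec (dA * dB) F q"
    and UA: "unitary dA UA" and A_spec: "ptrB dA dB \<rho> = spec dA UA \<alpha>" and A: "density dA (ptrB dA dB \<rho>)"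
    and UB: "unitary dB UB" and B_spec: "ptrA dA dB \<rho> = spec dB UB \<beta>" and B: "density dB (ptrA dA dB \<rho>)"
    and supp: "\<And>i j. i < dA * dB \<Longrightarrow> j < dA * dB \<Longrightarrow> p i * overlap U F i j \<noteq> 0 \<Longrightarrow> 0 < p i \<and> 0 < q j"
begin

abbreviation d where "d \<equiv> dA * dB"
abbreviation E where "E \<equiv> iexp ({..<d} \<times> {..<d}) (\<lambda>(i, j). p i * overlap U F i j) (\<lambda>(i, j). ln (p i) - ln (q j))"

lemma tpow_\<rho>: "tpow \<rho> n = spec (d ^ n) (tpow U n) (pw d p n)"
  unfolding \<rho>_spec by (rule tpow_spec[OF U])

lemma tpow_prod: "tpow (kron (ptrB dA dB \<rho>) (ptrA dA dB \<rho>)) n = spec (d ^ n) (tpow F n) (pw d q n)"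
  unfolding prod_spec by (rule tpow_spec[OF F])

lemma pw_nonneg: "(\<And>i. i < d \<Longrightarrow> 0 \<le> f i) \<Longrightarrow> i < d ^ n \<Longrightarrow> 0 \<le> pw d f n i"
  by (auto simp: pw_digit intro!: prod_nonneg digit_less')

lemma pw_p: "i < d ^ n \<Longrightarrow> 0 \<le> pw d p n i" by (rule pw_nonneg[OF p])
lemma pw_q: "i < d ^ n \<Longrightarrow> 0 \<le> pw d q n i" by (rule pw_nonneg[OF q])

lemma A_carrier: "ptrB dA dB \<rho> \<in> carrier_mat dA dA" by (simp add: ptrB_def)
lemma B_carrier: "ptrA dA dB \<rho> \<in> carrier_mat dB dB" by (simp add: ptrA_def)
lemma \<rho>_carrier: "\<rho> \<in> carrier_mat d d" using \<rho> by (simp add: density_def)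

text \<open>Where both eigenvalues are positive, q < exp (-l) p means l < ln p - ln q; all other
  pairs have weight 0. The strict form serves the converse, the other one the achievability.\<close>

lemma likelihood_sum:
  "(\<Sum>i<d ^ n. \<Sum>j<d ^ n. pw d p n i * (cmod (ip (col (tpow F n) j) (col (tpow U n) i)))\<^sup>2 * of_bool (pw d q n j < exp (- l) * pw d p n i))
    = E n (\<lambda>s. of_bool (l < s))" (is ?th1)
  "(\<Sum>i<d ^ n. \<Sum>j<d ^ n. pw d p n i * (cmod (ip (col (tpow F n) j) (col (tpow U n) i)))\<^sup>2 * of_bool (pw d q n j \<le> exp (- l) * pw d p n i))
    = E n (\<lambda>s. of_bool (l \<le> s))" (is ?th2)
proof -
  let ?w = "\<lambda>i j. pw d p n i * overlap (tpow U n) (tpow F n) i j"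
  note ov = iexp_overlap[where p = p and q = q and n = n, OF U F supp]
  have s: "0 < pw d p n i \<and> 0 < pw d q n j" if "i < d ^ n" "j < d ^ n" "?w i j \<noteq> 0" for i j
    using ov that by blast
  have e: "(\<Sum>i<d ^ n. \<Sum>j<d ^ n. ?w i j * h (ln (pw d p n i) - ln (pw d q n j))) = E n h" for h
    using ov by blast
  have lt: "y < exp (- l) * x \<longleftrightarrow> l < ln x - ln y" "y \<le> exp (- l) * x \<longleftrightarrow> l \<le> ln x - ln y" if "0 < x" "0 < y" for x y :: real
  proof -
    have "exp (- l) * x = exp (ln x - l)" using that by (simp add: exp_diff exp_minus field_simps)
    moreover have "y = exp (ln y)" using that by simp
    ultimately have "y < exp (- l) * x \<longleftrightarrow> exp (ln y) < exp (ln x - l)" "y \<le> exp (- l) * x \<longleftrightarrow> exp (ln y) \<le> exp (ln x - l)" by simp_all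
    then show "y < exp (- l) * x \<longleftrightarrow> l < ln x - ln y" "y \<le> exp (- l) * x \<longleftrightarrow> l \<le> ln x - ln y"
      unfolding exp_less_cancel_iff exp_le_cancel_iff by linarith+
  qed
  show ?th1 unfolding e[symmetric] overlap_def[symmetric]
  proof (intro sum.cong refl)
    fix i j assume "i \<in> {..<d ^ n}" "j \<in> {..<d ^ n}"
    then show "?w i j * of_bool (pw d q n j < exp (- l) * pw d p n i) = ?w i j * of_bool (l < ln (pw d p n i) - ln (pw d q n j))"
      using s[of i j] lt(1)[of "pw d p n i" "pw d q n j"] by (cases "?w i j = 0") auto
  qed
  show ?th2 unfolding e[symmetric] overlap_def[symmetric]
  proof (intro sum.cong refl)
    fix i j assume "i \<in> {..<d ^ n}" "j \<in> {..<d ^ n}"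
    then show "?w i j * of_bool (pw d q n j \<le> exp (- l) * pw d p n i) = ?w i j * of_bool (l \<le> ln (pw d p n i) - ln (pw d q n j))"
      using s[of i j] lt(2)[of "pw d p n i" "pw d q n j"] by (cases "?w i j = 0") auto
  qed
qed

text \<open>The product of the marginals is itself an i.i.d. alternative, so the constraint bounds
  the second trace in \<open>test_converse\<close>, taken with L = exp (-l).\<close>

lemma converse_step:
  assumes \<mu>: "0 \<le> \<mu>"
  shows "1 - alpha_hat_iid dA dB \<rho> n \<mu> \<le> 2 * real ((n + 1) ^ (d * d)) * exp l * \<mu> + 2 * E n (\<lambda>s. of_bool (l < s))"
proof (rule alpha_hat_iid_bound[OF \<rho> \<mu>])
  fix T assume T: "test_op (d ^ n) T"
    and con: "\<And>\<sigma> \<tau>. density dA \<sigma> \<Longrightarrow> density dB \<tau> \<Longrightarrow> Re (mtrace (regroup dA dB n (kron (tpow \<sigma> n) (tpow \<tau> n)) * T)) \<le> \<mu>"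
  have "Re (mtrace (spec (d ^ n) (tpow F n) (pw d q n) * T)) \<le> \<mu>"
    using con[OF A B] unfolding regroup_tpow[OF A_carrier B_carrier] tpow_prod .
  then have "2 * real (card (pw d p n ` {..<d ^ n})) / exp (- l) * Re (mtrace (spec (d ^ n) (tpow F n) (pw d q n) * T))
    \<le> 2 * real (card (pw d p n ` {..<d ^ n})) / exp (- l) * \<mu>" by (intro mult_left_mono) auto
  also have "\<dots> \<le> 2 * real ((n + 1) ^ (d * d)) / exp (- l) * \<mu>"
    by (intro mult_right_mono divide_right_mono mult_left_mono \<mu> of_nat_mono card_pw) auto
  also have "\<dots> = 2 * real ((n + 1) ^ (d * d)) * exp l * \<mu>" by (simp add: exp_minus field_simps)
  finally show "Re (mtrace (tpow \<rho> n * T)) \<le> 2 * real ((n + 1) ^ (d * d)) * exp l * \<mu> + 2 * E n (\<lambda>s. of_bool (l < s))"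
    using test_converse[where p = "pw d p n" and q = "pw d q n" and L = "exp (- l)",
        OF unitary_tpow[OF U] unitary_tpow[OF F] pw_p pw_q T]
    unfolding tpow_\<rho> likelihood_sum by simp
qed

text \<open>Under the truncations \<open>KA\<close> and \<open>KB\<close> each universal operator is
  at most exp x times the power of a marginal, which together loses exp (2 x). Raising the
  likelihood threshold to l + 2 x compensates and leaves the error exp (-l); the subtracted term
  bounds the weight lost by truncation.\<close>

lemma achievability_step:
  "E n (\<lambda>s. of_bool (l + 2 * x \<le> s)) - exp (- x) * real ((n + 1) ^ (dA * dA) + (n + 1) ^ (dB * dB))
    \<le> 1 - alpha_hat dA dB \<rho> n (exp (- l))"
proof -
  let ?N = "d ^ n" and ?NA = "dA ^ n" and ?NB = "dB ^ n"
  let ?R = "regroup dA dB n"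
  define SA where "SA = tpow (ptrB dA dB \<rho>) n"
  define SB where "SB = tpow (ptrA dA dB \<rho>) n"
  have SA: "psd ?NA SA" "SA \<in> carrier_mat ?NA ?NA" using density_tpow[OF A, of n] by (auto simp: density_def SA_def)
  have SB: "psd ?NB SB" "SB \<in> carrier_mat ?NB ?NB" using density_tpow[OF B, of n] by (auto simp: density_def SB_def)
  obtain OA where OA: "psd ?NA OA" "OA * SA = SA * OA" "Re (mtrace OA) \<le> real ((n + 1) ^ (dA * dA))"
    "\<And>\<sigma>. sym_density dA n \<sigma> \<Longrightarrow> psd ?NA (OA - \<sigma>)"
    using universal_symmetric_operator[OF UA, of n \<alpha>] unfolding SA_def A_spec by blast
  obtain OB where OB: "psd ?NB OB" "OB * SB = SB * OB" "Re (mtrace OB) \<le> real ((n + 1) ^ (dB * dB))"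
    "\<And>\<sigma>. sym_density dB n \<sigma> \<Longrightarrow> psd ?NB (OB - \<sigma>)"
    using universal_symmetric_operator[OF UB, of n \<beta>] unfolding SB_def B_spec by blast
  have OAc: "OA \<in> carrier_mat ?NA ?NA" and OBc: "OB \<in> carrier_mat ?NB ?NB" using OA OB by auto
  obtain KA where KA: "proj ?NA KA" "KA * SA = SA * KA" "psd ?NA (complex_of_real (exp x) \<cdot>\<^sub>m (KA * SA * KA) - KA * OA * KA)"
    "exp x * Re (mtrace (SA * (1\<^sub>m ?NA - KA))) \<le> Re (mtrace OA)"
    using threshold_projection[OF OA(1) SA(1) OA(2), of "exp x"] by blast
  obtain KB where KB: "proj ?NB KB" "KB * SB = SB * KB" "psd ?NB (complex_of_real (exp x) \<cdot>\<^sub>m (KB * SB * KB) - KB * OB * KB)"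
    "exp x * Re (mtrace (SB * (1\<^sub>m ?NB - KB))) \<le> Re (mtrace OB)"
    using threshold_projection[OF OB(1) SB(1) OB(2), of "exp x"] by blast
  have KAc: "KA \<in> carrier_mat ?NA ?NA" and KBc: "KB \<in> carrier_mat ?NB ?NB" using KA KB by auto
  define K where "K = ?R (kron KA KB)"
  define \<omega> where "\<omega> = ?R (kron OA OB)"
  have S: "tpow (kron (ptrB dA dB \<rho>) (ptrA dA dB \<rho>)) n = ?R (kron SA SB)"
    unfolding SA_def SB_def by (rule regroup_tpow[OF A_carrier B_carrier, symmetric])
  have K: "proj ?N K" unfolding K_def by (rule proj_regroup[OF proj_kron[OF KA(1) KB(1)]])
  have Kc: "K \<in> carrier_mat ?N ?N" using K by simp
  have mult: "?R (kron X Y) * ?R (kron X' Y') = ?R (kron (X * X') (Y * Y'))"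
    if "X \<in> carrier_mat ?NA ?NA" "X' \<in> carrier_mat ?NA ?NA" "Y \<in> carrier_mat ?NB ?NB" "Y' \<in> carrier_mat ?NB ?NB" for X X' Y Y'
    unfolding kron_mult[OF that(1,3,2,4), symmetric] by (rule regroup_mult[symmetric]) (use that in auto)
  have KS: "K * ?R (kron SA SB) = ?R (kron SA SB) * K"
    unfolding K_def mult[OF KAc SA(2) KBc SB(2)] mult[OF SA(2) KAc SB(2) KBc] KA(2) KB(2) ..
  have sand: "K * ?R (kron X Y) * K = ?R (kron (KA * X * KA) (KB * Y * KB))"
    if "X \<in> carrier_mat ?NA ?NA" "Y \<in> carrier_mat ?NB ?NB" for X Y
    unfolding K_def mult[OF KAc that(1) KBc that(2)]
    by (rule mult) (use KAc KBc that in \<open>auto simp: mult_carrier_sq\<close>)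
  have KAX: "KA * X * KA \<in> carrier_mat ?NA ?NA" if "X \<in> carrier_mat ?NA ?NA" for X
    by (intro mult_carrier_sq KAc that)
  have KBX: "KB * X * KB \<in> carrier_mat ?NB ?NB" if "X \<in> carrier_mat ?NB ?NB" for X
    by (intro mult_carrier_sq KBc that)
  have le: "psd ?N (complex_of_real (exp (2 * x)) \<cdot>\<^sub>m (K * ?R (kron SA SB) * K) - K * \<omega> * K)"
  proof -
    let ?A' = "complex_of_real (exp x) \<cdot>\<^sub>m (KA * SA * KA)" and ?B' = "complex_of_real (exp x) \<cdot>\<^sub>m (KB * SB * KB)"
    have "psd (?NA * ?NB) (kron ?A' ?B' - kron (KA * OA * KA) (KB * OB * KB))"
    proof (rule psd_kron_mono)
      show "psd ?NA (KA * OA * KA)" using psd_sandwich[OF OA(1) KAc] by (simp add: proj_adj[OF KA(1)])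
      show "psd ?NB (KB * OB * KB)" using psd_sandwich[OF OB(1) KBc] by (simp add: proj_adj[OF KB(1)])
    qed (use KA KB KAX[OF SA(2)] KBX[OF SB(2)] in auto)
    moreover have "kron ?A' ?B' = complex_of_real (exp (2 * x)) \<cdot>\<^sub>m kron (KA * SA * KA) (KB * SB * KB)"
    proof -
      have "complex_of_real a \<cdot>\<^sub>m (complex_of_real a \<cdot>\<^sub>m X) = complex_of_real (a * a) \<cdot>\<^sub>m X" for a X
        by (rule eq_matI) auto
      then show ?thesis unfolding kron_smult_left kron_smult_right mult_2 exp_add .
    qed
    ultimately have "psd (?NA * ?NB) (complex_of_real (exp (2 * x)) \<cdot>\<^sub>m kron (KA * SA * KA) (KB * SB * KB) - kron (KA * OA * KA) (KB * OB * KB))"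
      by simp
    from psd_regroup[OF this] show ?thesis
      unfolding \<omega>_def sand[OF SA(2) SB(2)] sand[OF OAc OBc]
      by (subst (asm) regroup_minus)
        (use kron_carrier[OF KAX[OF SA(2)] KBX[OF SB(2)]] kron_carrier[OF KAX[OF OAc] KBX[OF OBc]] in \<open>auto simp: regroup_smult\<close>)
  qed
  have \<omega>c: "\<omega> \<in> carrier_mat ?N ?N" by (simp add: \<omega>_def)
  have S': "?R (kron SA SB) = spec ?N (tpow F n) (pw d q n)" using S tpow_prod by simp
  obtain T where T: "proj ?N T" "Re (mtrace (\<omega> * T)) \<le> exp (2 * x) * exp (- (l + 2 * x)) * (\<Sum>i<?N. pw d p n i)"
    "E n (\<lambda>s. of_bool (l + 2 * x \<le> s)) - Re (mtrace (tpow \<rho> n * (1\<^sub>m ?N - K))) \<le> Re (mtrace (tpow \<rho> n * T))"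
    using test_achievability[where p = "pw d p n" and L = "exp (- (l + 2 * x))",
        OF unitary_tpow[OF U] unitary_tpow[OF F] pw_p \<omega>c K KS[unfolded S'] le[unfolded S']]
    unfolding likelihood_sum(2) tpow_\<rho>[symmetric] by auto
  have "complex_of_real (\<Sum>i<?N. pw d p n i) = mtrace (tpow \<rho> n)"
    unfolding tpow_\<rho> by (rule mtrace_spec[OF unitary_tpow[OF U], symmetric])
  then have "complex_of_real (\<Sum>i<?N. pw d p n i) = complex_of_real 1" using density_tpow[OF \<rho>, of n] by (simp add: density_def)
  then have "(\<Sum>i<?N. pw d p n i) = 1" by (metis of_real_eq_iff)
  then have T\<omega>: "Re (mtrace (\<omega> * T)) \<le> exp (- l)" using T(2) by (simp flip: exp_add)
  have "Re (mtrace (tpow \<rho> n * T)) \<le> 1 - alpha_hat dA dB \<rho> n (exp (- l))"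
  \<comment> \<open>Every product of symmetric states lies below \<omega>, so the single bound on
    \<omega> settles the composite alternative.\<close>
  proof (rule alpha_hat_achieves[OF \<rho> _ test_op_proj[OF T(1)]])
    fix \<sigma> \<tau> assume \<sigma>: "sym_density dA n \<sigma>" and \<tau>: "sym_density dB n \<tau>"
    have s: "psd ?NA \<sigma>" "psd ?NB \<tau>" using \<sigma> \<tau> by (auto simp: sym_density_def density_def)
    have "psd (?NA * ?NB) (kron OA OB - kron \<sigma> \<tau>)"
      by (rule psd_kron_mono[OF s OA(4)[OF \<sigma>] OB(4)[OF \<tau>] OAc OBc])
    from psd_regroup[OF this] have "psd ?N (\<omega> - ?R (kron \<sigma> \<tau>))"
      unfolding \<omega>_def by (subst (asm) regroup_minus) (use OAc OBc s in auto)
    from psd_trace_mono[OF this proj_psd[OF T(1)] regroup_carrier \<omega>c]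
    show "Re (mtrace (?R (kron \<sigma> \<tau>) * T)) \<le> exp (- l)" using T\<omega> by simp
  qed simp
  moreover have "Re (mtrace (tpow \<rho> n * (1\<^sub>m ?N - K))) \<le> exp (- x) * real ((n + 1) ^ (dA * dA) + (n + 1) ^ (dB * dB))"
  proof -
    have c1: "1\<^sub>m ?NA - KA \<in> carrier_mat ?NA ?NA" "1\<^sub>m ?NB - KB \<in> carrier_mat ?NB ?NB"
      by (intro minus_carrier_mat KAc KBc)+
    have \<rho>n: "psd ?N (tpow \<rho> n)" "tpow \<rho> n \<in> carrier_mat ?N ?N" using density_tpow[OF \<rho>, of n] by (auto simp: density_def)
    have k1: "kron (1\<^sub>m ?NA - KA) (1\<^sub>m ?NB) = 1\<^sub>m (?NA * ?NB) - kron KA (1\<^sub>m ?NB)"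
      unfolding kron_minus_left[OF one_carrier_mat KAc one_carrier_mat] kron_one ..
    have k2: "kron KA (1\<^sub>m ?NB - KB) = kron KA (1\<^sub>m ?NB) - kron KA KB"
      by (rule kron_minus_right[OF KAc KBc one_carrier_mat])
    have k3: "kron (1\<^sub>m ?NA - KA) (1\<^sub>m ?NB - KB) = kron (1\<^sub>m ?NA) (1\<^sub>m ?NB - KB) - kron KA (1\<^sub>m ?NB - KB)"
      by (rule kron_minus_left[OF one_carrier_mat KAc c1(2)])
    have kc: "kron KA (1\<^sub>m ?NB) \<in> carrier_mat (?NA * ?NB) (?NA * ?NB)" "kron KA KB \<in> carrier_mat (?NA * ?NB) (?NA * ?NB)"
      using KAc KBc by auto
    \<comment> \<open>A union bound: the second summand is at most 1 (x) (1 - KB), after which each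
      trace involves one marginal.\<close>
    have "1\<^sub>m ?N - K = ?R (kron (1\<^sub>m ?NA - KA) (1\<^sub>m ?NB)) + ?R (kron KA (1\<^sub>m ?NB - KB))"
      unfolding k1 k2 K_def regroup_minus[OF one_carrier_mat kc(1)] regroup_minus[OF kc] regroup_one
      by (rule eq_matI) (auto simp: carrier_matD[OF regroup_carrier])
    then have "mtrace (tpow \<rho> n * (1\<^sub>m ?N - K)) = mtrace (tpow \<rho> n * ?R (kron (1\<^sub>m ?NA - KA) (1\<^sub>m ?NB))) + mtrace (tpow \<rho> n * ?R (kron KA (1\<^sub>m ?NB - KB)))"
      using mult_add_distrib_mat[OF \<rho>n(2) regroup_carrier regroup_carrier]
        mtrace_add[OF mult_carrier_sq[OF \<rho>n(2) regroup_carrier] mult_carrier_sq[OF \<rho>n(2) regroup_carrier]] by simp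
    also have "mtrace (tpow \<rho> n * ?R (kron (1\<^sub>m ?NA - KA) (1\<^sub>m ?NB))) = mtrace (SA * (1\<^sub>m ?NA - KA))"
      unfolding SA_def by (rule tpow_trace_regroup_A[OF \<rho>_carrier c1(1)])
    finally have 1: "Re (mtrace (tpow \<rho> n * (1\<^sub>m ?N - K))) = Re (mtrace (SA * (1\<^sub>m ?NA - KA))) + Re (mtrace (tpow \<rho> n * ?R (kron KA (1\<^sub>m ?NB - KB))))"
      by simp
    have "psd (?NA * ?NB) (kron (1\<^sub>m ?NA) (1\<^sub>m ?NB - KB) - kron KA (1\<^sub>m ?NB - KB))"
      unfolding k3[symmetric] by (intro psd_kron proj_psd proj_compl KA(1) KB(1))
    from psd_regroup[OF this] have "psd ?N (?R (kron (1\<^sub>m ?NA) (1\<^sub>m ?NB - KB)) - ?R (kron KA (1\<^sub>m ?NB - KB)))"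
      by (subst (asm) regroup_minus) (use KAc c1 in auto)
    from psd_trace_mono[OF this \<rho>n(1) regroup_carrier regroup_carrier]
    have "Re (mtrace (tpow \<rho> n * ?R (kron KA (1\<^sub>m ?NB - KB)))) \<le> Re (mtrace (tpow \<rho> n * ?R (kron (1\<^sub>m ?NA) (1\<^sub>m ?NB - KB))))"
      unfolding mtrace_comm[OF \<rho>n(2) regroup_carrier] .
    also have "mtrace (tpow \<rho> n * ?R (kron (1\<^sub>m ?NA) (1\<^sub>m ?NB - KB))) = mtrace (SB * (1\<^sub>m ?NB - KB))"
      unfolding SB_def by (rule tpow_trace_regroup_B[OF \<rho>_carrier c1(2)])
    finally have 2: "Re (mtrace (tpow \<rho> n * (1\<^sub>m ?N - K))) \<le> Re (mtrace (SA * (1\<^sub>m ?NA - KA))) + Re (mtrace (SB * (1\<^sub>m ?NB - KB)))"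
      using 1 by simp
    have "exp x * Re (mtrace (tpow \<rho> n * (1\<^sub>m ?N - K))) \<le> exp x * (Re (mtrace (SA * (1\<^sub>m ?NA - KA))) + Re (mtrace (SB * (1\<^sub>m ?NB - KB))))"
      using 2 by (intro mult_left_mono) auto
    also have "\<dots> \<le> real ((n + 1) ^ (dA * dA)) + real ((n + 1) ^ (dB * dB))"
      using KA(4) KB(4) OA(3) OB(3) by (simp add: distrib_left)
    finally show ?thesis by (simp add: exp_minus field_simps)
  qed
  ultimately show ?thesis using T(3) by linarith
qed

end

text \<open>The exponent c n a_n is split in halves. Eventually n a_n >= sqrt n, so one half beats
  the polynomial; eventually \<kappa> a_n < c / 2, so the other half beats \<kappa> n a_n^2.\<close>

lemma poly_exp_negligible:
  fixes a :: "nat \<Rightarrow> real" and k :: nat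
  assumes apos: "\<And>n. a n > 0" and alim: "a \<longlonglongrightarrow> 0"
    and asqrt: "filterlim (\<lambda>n. sqrt (real n) * a n) at_top sequentially" and c: "c > 0"
  shows "\<forall>\<^sub>F n in sequentially. C * real (n + 1) ^ k * exp (- c * (real n * a n)) \<le> 1 / 2 * exp (- \<kappa> * (real n * (a n)\<^sup>2))"
proof -
  have "((\<lambda>n. C * (real n + 1) powr real k * exp (- (c / 2) * sqrt (real n))) \<longlonglongrightarrow> 0)"
    using c by real_asymp
  then have "\<forall>\<^sub>F n in sequentially. C * (real n + 1) powr real k * exp (- (c / 2) * sqrt (real n)) < 1 / 2"
    by (rule order_tendstoD(2)) simp
  moreover have "\<forall>\<^sub>F n in sequentially. 1 \<le> sqrt (real n) * a n" using asqrt unfolding filterlim_at_top by blast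
  moreover have "\<forall>\<^sub>F n in sequentially. \<kappa> * a n < c / 2"
    using tendsto_mult_left[OF alim, of \<kappa>] c by (intro order_tendstoD(2)) auto
  moreover have "\<forall>\<^sub>F n in sequentially. C * (real n + 1) powr real k * exp (- (c / 2) * sqrt (real n)) < 1 / 2"
    by fact
  ultimately show ?thesis
  proof eventually_elim
    case (elim n)
    have sq: "sqrt (real n) \<le> real n * a n"
    proof -
      have "sqrt (real n) * 1 \<le> sqrt (real n) * (sqrt (real n) * a n)" using elim(2) by (intro mult_left_mono) auto
      then show ?thesis by (simp flip: mult.assoc)
    qed
    have na: "0 \<le> real n * a n" using apos[of n] by simp
    have "\<kappa> * (real n * (a n)\<^sup>2) = (\<kappa> * a n) * (real n * a n)" by (simp add: power2_eq_square)
    also have "\<dots> \<le> c / 2 * (real n * a n)" using elim(3) na by (intro mult_right_mono) auto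
    finally have "- c * (real n * a n) \<le> - (c / 2) * (real n * a n) - \<kappa> * (real n * (a n)\<^sup>2)" by (simp add: algebra_simps)
    moreover have "- (c / 2) * (real n * a n) \<le> - (c / 2) * sqrt (real n)" using sq c by simp
    ultimately have e: "exp (- c * (real n * a n)) \<le> exp (- (c / 2) * sqrt (real n)) * exp (- \<kappa> * (real n * (a n)\<^sup>2))"
      unfolding exp_add[symmetric] exp_le_cancel_iff by linarith
    show ?case
    proof (cases "C \<le> 0")
      case True
      then have "C * real (n + 1) ^ k * exp (- c * (real n * a n)) \<le> 0"
        by (intro mult_nonpos_nonneg) auto
      also have "0 \<le> 1 / 2 * exp (- \<kappa> * (real n * (a n)\<^sup>2))" by simp
      finally show ?thesis .
    next
      case False
      have pw: "(real n + 1) powr real k = real (n + 1) ^ k" by (subst powr_realpow) (simp_all add: add.commute)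
      have "C * real (n + 1) ^ k * exp (- c * (real n * a n)) \<le> C * real (n + 1) ^ k * (exp (- (c / 2) * sqrt (real n)) * exp (- \<kappa> * (real n * (a n)\<^sup>2)))"
        using False e by (intro mult_left_mono) auto
      also have "\<dots> = (C * real (n + 1) ^ k * exp (- (c / 2) * sqrt (real n))) * exp (- \<kappa> * (real n * (a n)\<^sup>2))" by simp
      also have "\<dots> \<le> 1 / 2 * exp (- \<kappa> * (real n * (a n)\<^sup>2))"
        using elim(1) unfolding pw by (intro mult_right_mono) auto
      finally show ?thesis .
    qed
  qed
qed

text \<open>A gap between the rates absorbs any constant once the exponent is large.\<close>

lemma exp_gap:
  fixes f :: "nat \<Rightarrow> real"
  assumes f: "filterlim f at_top sequentially" and lt: "\<kappa> < \<kappa>'" and C: "C > 0"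
  shows "\<forall>\<^sub>F n in sequentially. C * exp (- \<kappa>' * f n) \<le> exp (- \<kappa> * f n)"
proof -
  have "\<forall>\<^sub>F n in sequentially. ln C / (\<kappa>' - \<kappa>) \<le> f n" using f unfolding filterlim_at_top by blast
  then show ?thesis
  proof eventually_elim
    case (elim n)
    then have "ln C \<le> (\<kappa>' - \<kappa>) * f n" using lt by (simp add: field_simps)
    then have "ln C + - \<kappa>' * f n \<le> - \<kappa> * f n" by (simp add: algebra_simps)
    then have "exp (ln C + - \<kappa>' * f n) \<le> exp (- \<kappa> * f n)" by (simp only: exp_le_cancel_iff)
    then show ?case using C unfolding exp_add by simp
  qed
qed

lemma exists_small_perturbation:
  fixes g :: "real \<Rightarrow> real"
  assumes "isCont g 0" "g 0 < u"
  shows "\<exists>\<delta>>0. \<delta> < 1 \<and> g \<delta> < u"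
proof -
  have "(g \<longlongrightarrow> g 0) (at_right 0)" using assms(1) unfolding isCont_def by (rule filterlim_mono) (auto simp: at_within_le_at)
  then have "\<forall>\<^sub>F \<delta> in at_right 0. g \<delta> < u" using assms(2) by (rule order_tendstoD(2))
  moreover have "\<forall>\<^sub>F \<delta> in at_right (0::real). \<delta> \<in> {0<..<1}" by (rule eventually_at_right_real) simp
  ultimately have "\<forall>\<^sub>F \<delta> in at_right 0. g \<delta> < u \<and> \<delta> \<in> {0<..<1}" by (rule eventually_conj)
  then show ?thesis using eventually_happens[of _ "at_right (0::real)"] by force
qed

theorem mainTheorem11:
  fixes a :: "nat \<Rightarrow> real" and dA dB :: nat and \<rho> :: "complex mat"
  assumes apos: "\<And>n. a n > 0"
    and alim: "a \<longlonglongrightarrow> 0"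
    and asqrt: "filterlim (\<lambda>n. sqrt (real n) * a n) at_top sequentially"
    and rho: "density (dA * dB) \<rho>"
    and V: "mutual_info_var dA dB \<rho> > 0"
  defines "R \<equiv> \<lambda>n. mutual_info dA dB \<rho> + a n"
  shows "(\<lambda>n. - (1 / (real n * (a n)\<^sup>2)) * ln (1 - alpha_hat dA dB \<rho> n (exp (- real n * R n))))
           \<longlonglongrightarrow> 1 / (2 * mutual_info_var dA dB \<rho>)
       \<and> (\<lambda>n. - (1 / (real n * (a n)\<^sup>2)) * ln (1 - alpha_hat_iid dA dB \<rho> n (exp (- real n * R n))))
           \<longlonglongrightarrow> 1 / (2 * mutual_info_var dA dB \<rho>)"
proof -
  let ?d = "dA * dB"
  obtain U p F q UA UB \<alpha> \<beta> where
    U: "unitary ?d U" and p: "\<And>i. i < ?d \<Longrightarrow> 0 \<le> p i" and p1: "(\<Sum>i<?d. p i) = 1" and \<rho>s: "\<rho> = spec ?d U p"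
    and F: "unitary ?d F" and q: "\<And>j. j < ?d \<Longrightarrow> 0 \<le> q j" and qs: "kron (ptrB dA dB \<rho>) (ptrA dA dB \<rho>) = spec ?d F q"
    and A: "unitary dA UA" "ptrB dA dB \<rho> = spec dA UA \<alpha>" "density dA (ptrB dA dB \<rho>)"
    and B: "unitary dB UB" "ptrA dA dB \<rho> = spec dB UB \<beta>" "density dB (ptrA dA dB \<rho>)"
    and supp: "\<And>i j. i < ?d \<Longrightarrow> j < ?d \<Longrightarrow> p i * overlap U F i j \<noteq> 0 \<Longrightarrow> 0 < p i \<and> 0 < q j"
    and I: "mutual_info dA dB \<rho> = (\<Sum>i<?d. \<Sum>j<?d. p i * overlap U F i j * (ln (p i) - ln (q j)))"
    and Var: "mutual_info_var dA dB \<rho> = (\<Sum>i<?d. \<Sum>j<?d. p i * overlap U F i j * (ln (p i) - ln (q j) - mutual_info dA dB \<rho>)\<^sup>2)"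
    by (rule information_spectral_data[OF rho], rule that) assumption+
  interpret spectral_data dA dB \<rho> U F UA UB p q \<alpha> \<beta>
    by unfold_locales (use rho U p \<rho>s F q qs A B supp in blast)+
  define I0 where "I0 = mutual_info dA dB \<rho>"
  define V0 where "V0 = mutual_info_var dA dB \<rho>"
  let ?Z = "{..<?d} \<times> {..<?d}" and ?P = "\<lambda>(i, j). p i * overlap U F i j" and ?X = "\<lambda>(i, j). ln (p i) - ln (q j)"
  have cZ: "finite ?Z" by simp
  have cP0: "\<And>z. z \<in> ?Z \<Longrightarrow> 0 \<le> ?P z" using p overlap_nonneg by auto
  have "sum ?P ?Z = (\<Sum>i<?d. p i * (\<Sum>j<?d. overlap U F i j))"
    by (simp add: sum.cartesian_product[symmetric] sum_distrib_left)
  also have "\<dots> = 1" using p1 by (simp add: sum_overlap[OF U F])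
  finally have cP1: "sum ?P ?Z = 1" .
  have cm: "I0 = (\<Sum>z\<in>?Z. ?P z * ?X z)"
    unfolding I0_def I sum.cartesian_product by (intro sum.cong refl) auto
  have cV: "V0 = (\<Sum>z\<in>?Z. ?P z * (?X z - I0)\<^sup>2)"
    unfolding V0_def Var sum.cartesian_product I0_def by (intro sum.cong refl) auto
  have V0: "V0 > 0" using V by (simp add: V0_def)
  have na: "filterlim (\<lambda>n. real n * (a n)\<^sup>2) at_top sequentially"
  proof -
    have "filterlim (\<lambda>n. (sqrt (real n) * a n) * (sqrt (real n) * a n)) at_top sequentially"
      by (rule filterlim_at_top_mult_at_top[OF asqrt asqrt])
    moreover have "(sqrt (real n) * a n) * (sqrt (real n) * a n) = real n * (a n)\<^sup>2" for n
      unfolding power2_eq_square[symmetric] power_mult_distrib by simp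
    ultimately show ?thesis by (simp only:)
  qed
  have scaled: "\<And>n. 0 < c * a n" "(\<lambda>n. c * a n) \<longlonglongrightarrow> 0" "filterlim (\<lambda>n. real n * (c * a n)\<^sup>2) at_top sequentially" if "c > 0" for c
  proof -
    show "\<And>n. 0 < c * a n" using that apos by simp
    show "(\<lambda>n. c * a n) \<longlonglongrightarrow> 0" using tendsto_mult_left[OF alim, of c] by simp
    have "filterlim (\<lambda>n. c\<^sup>2 * (real n * (a n)\<^sup>2)) at_top sequentially"
      by (rule filterlim_tendsto_pos_mult_at_top[OF tendsto_const _ na]) (use that in simp)
    moreover have "c\<^sup>2 * (real n * (a n)\<^sup>2) = real n * (c * a n)\<^sup>2" for n by (simp add: power_mult_distrib)
    ultimately show "filterlim (\<lambda>n. real n * (c * a n)\<^sup>2) at_top sequentially" by (simp only:)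
  qed
  define s where "s n = 1 - alpha_hat dA dB \<rho> n (exp (- real n * R n))" for n
  define t where "t n = 1 - alpha_hat_iid dA dB \<rho> n (exp (- real n * R n))" for n
  \<comment> \<open>Success probabilities are ordered opposite to errors, so it is enough to bound
    \<open>t\<close> from above and \<open>s\<close> from below.\<close>
  have st: "s n \<le> t n" for n unfolding s_def t_def using alpha_hat_iid_le[OF rho, of "exp (- real n * R n)" n] by simp
  have upper: "\<forall>\<^sub>F n in sequentially. t n \<le> exp (- \<kappa> * (real n * (a n)\<^sup>2))" if \<kappa>: "\<kappa> < 1 / (2 * V0)" for \<kappa>
  proof -
    obtain \<kappa>' where \<kappa>': "\<kappa> < \<kappa>'" "\<kappa>' < 1 / (2 * V0)" using dense[OF \<kappa>] by blast
    \<comment> \<open>The threshold will use (1 - \<delta>) a_n, which scales the rate by (1 -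
      \<delta>)^2; \<delta> is small enough for the result to stay above \<kappa>.\<close>
    obtain \<delta> where \<delta>: "0 < \<delta>" "\<delta> < 1" "- (\<kappa>' * (1 - \<delta>)\<^sup>2) < - \<kappa>"
      using exists_small_perturbation[of "\<lambda>\<delta>. - (\<kappa>' * (1 - \<delta>)\<^sup>2)" "- \<kappa>"] \<kappa>' by (auto intro!: continuous_intros)
    have \<delta>1: "0 < 1 - \<delta>" using \<delta> by simp
    have 1: "\<forall>\<^sub>F n in sequentially. E n (\<lambda>x. of_bool (real n * (I0 + (1 - \<delta>) * a n) < x)) \<le> exp (- \<kappa>' * (real n * ((1 - \<delta>) * a n)\<^sup>2))"
      by (rule moderate_deviation_upper[OF cZ cP0 cP1 cm cV V0 scaled(1,2)[OF \<delta>1] \<kappa>'(2)])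
    have 2: "\<forall>\<^sub>F n in sequentially. 2 * real (n + 1) ^ (?d * ?d) * exp (- \<delta> * (real n * a n)) \<le> 1 / 2 * exp (- \<kappa> * (real n * (a n)\<^sup>2))"
      by (rule poly_exp_negligible[OF apos alim asqrt \<delta>(1)])
    \<comment> \<open>The 4 offsets the factor 2 of the converse: each of the two contributions to
      \<open>t n\<close> is at most half of the target.\<close>
    have 3: "\<forall>\<^sub>F n in sequentially. 4 * exp (- (\<kappa>' * (1 - \<delta>)\<^sup>2) * (real n * (a n)\<^sup>2)) \<le> exp (- \<kappa> * (real n * (a n)\<^sup>2))"
      by (rule exp_gap[OF na]) (use \<delta> in auto)
    show ?thesis using 1 2 3
    proof eventually_elim
      case (elim n)
      let ?l = "real n * (I0 + (1 - \<delta>) * a n)"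
      have "t n \<le> 2 * real ((n + 1) ^ (?d * ?d)) * exp ?l * exp (- real n * R n) + 2 * E n (\<lambda>x. of_bool (?l < x))"
        unfolding t_def by (rule converse_step) simp
      \<comment> \<open>The mutual information cancels, since the threshold lies \<delta> n a_n
        below n R_n.\<close>
      also have "2 * real ((n + 1) ^ (?d * ?d)) * exp ?l * exp (- real n * R n) = 2 * real (n + 1) ^ (?d * ?d) * exp (- \<delta> * (real n * a n))"
        by (simp add: R_def I0_def algebra_simps flip: exp_add)
      finally have "t n \<le> 2 * real (n + 1) ^ (?d * ?d) * exp (- \<delta> * (real n * a n)) + 2 * E n (\<lambda>x. of_bool (?l < x))" .
      moreover have "exp (- \<kappa>' * (real n * ((1 - \<delta>) * a n)\<^sup>2)) = exp (- (\<kappa>' * (1 - \<delta>)\<^sup>2) * (real n * (a n)\<^sup>2))"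
        by (simp add: power_mult_distrib mult_ac)
      ultimately show ?case using elim by linarith
    qed
  qed
  have lower: "\<forall>\<^sub>F n in sequentially. exp (- \<kappa> * (real n * (a n)\<^sup>2)) \<le> s n" if \<kappa>: "\<kappa> > 1 / (2 * V0)" for \<kappa>
  proof -
    obtain \<kappa>' where \<kappa>': "1 / (2 * V0) < \<kappa>'" "\<kappa>' < \<kappa>" using dense[OF \<kappa>] by blast
    obtain \<delta> where \<delta>: "0 < \<delta>" "\<delta> < 1" "\<kappa>' * (1 + 2 * \<delta>)\<^sup>2 < \<kappa>"
      using exists_small_perturbation[of "\<lambda>\<delta>. \<kappa>' * (1 + 2 * \<delta>)\<^sup>2" "\<kappa>"] \<kappa>' by (auto intro!: continuous_intros)
    have \<delta>1: "0 < 1 + 2 * \<delta>" using \<delta> by simp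
    let ?D = "dA * dA + dB * dB"
    have 1: "\<forall>\<^sub>F n in sequentially. exp (- \<kappa>' * (real n * ((1 + 2 * \<delta>) * a n)\<^sup>2)) \<le> E n (\<lambda>x. of_bool (real n * (I0 + (1 + 2 * \<delta>) * a n) \<le> x))"
      by (rule moderate_deviation_lower[OF cZ cP0 cP1 cm cV V0 scaled(1,2)[OF \<delta>1] \<kappa>'(1) scaled(3)[OF \<delta>1]])
    have 2: "\<forall>\<^sub>F n in sequentially. 2 * real (n + 1) ^ ?D * exp (- \<delta> * (real n * a n)) \<le> 1 / 2 * exp (- \<kappa> * (real n * (a n)\<^sup>2))"
      by (rule poly_exp_negligible[OF apos alim asqrt \<delta>(1)])
    \<comment> \<open>The tail probability is at least twice the target, and the truncation loss
      takes away at most half of the target.\<close>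
    have 3: "\<forall>\<^sub>F n in sequentially. 2 * exp (- \<kappa> * (real n * (a n)\<^sup>2)) \<le> exp (- (\<kappa>' * (1 + 2 * \<delta>)\<^sup>2) * (real n * (a n)\<^sup>2))"
      by (rule exp_gap[OF na]) (use \<delta> in auto)
    show ?thesis using 1 2 3
    proof eventually_elim
      case (elim n)
      \<comment> \<open>With this \<open>x\<close> the threshold n R_n + 2 x becomes n (I + (1 + 2
        \<delta>) a_n), whence the factor 1 + 2 \<delta>.\<close>
      let ?x = "\<delta> * (real n * a n)"
      have l: "real n * R n + 2 * ?x = real n * (I0 + (1 + 2 * \<delta>) * a n)"
        by (simp add: R_def I0_def algebra_simps)
      have a1: "E n (\<lambda>y. of_bool (real n * (I0 + (1 + 2 * \<delta>) * a n) \<le> y)) - exp (- ?x) * real ((n + 1) ^ (dA * dA) + (n + 1) ^ (dB * dB)) \<le> s n"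
        using achievability_step[of n "real n * R n" ?x] unfolding l s_def by simp
      have "real ((n + 1) ^ (dA * dA) + (n + 1) ^ (dB * dB)) \<le> 2 * real (n + 1) ^ ?D"
      proof -
        have "(n + 1) ^ (dA * dA) \<le> (n + 1) ^ ?D" "(n + 1) ^ (dB * dB) \<le> (n + 1) ^ ?D" by (rule power_increasing; simp)+
        then have "(n + 1) ^ (dA * dA) + (n + 1) ^ (dB * dB) \<le> 2 * (n + 1) ^ ?D" by linarith
        then have "real ((n + 1) ^ (dA * dA) + (n + 1) ^ (dB * dB)) \<le> real (2 * (n + 1) ^ ?D)" by (rule of_nat_mono)
        then show ?thesis by simp
      qed
      then have "exp (- ?x) * real ((n + 1) ^ (dA * dA) + (n + 1) ^ (dB * dB)) \<le> exp (- ?x) * (2 * real (n + 1) ^ ?D)"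
        by (rule mult_left_mono) simp
      also have "\<dots> = 2 * real (n + 1) ^ ?D * exp (- \<delta> * (real n * a n))" by simp
      finally have a2: "exp (- ?x) * real ((n + 1) ^ (dA * dA) + (n + 1) ^ (dB * dB)) \<le> 2 * real (n + 1) ^ ?D * exp (- \<delta> * (real n * a n))" .
      have a3: "exp (- \<kappa>' * (real n * ((1 + 2 * \<delta>) * a n)\<^sup>2)) = exp (- (\<kappa>' * (1 + 2 * \<delta>)\<^sup>2) * (real n * (a n)\<^sup>2))"
        by (simp add: power_mult_distrib mult_ac)
      show ?case using elim a1 a2 a3 exp_ge_zero[of "- \<kappa> * (real n * (a n)\<^sup>2)"] by linarith
    qed
  qed
  \<comment> \<open>Stated for any sequence between \<open>s\<close> and \<open>t\<close>; the two
    claims are the extreme cases.\<close>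
  have lim: "(\<lambda>n. - (1 / (real n * (a n)\<^sup>2)) * ln (u n)) \<longlonglongrightarrow> 1 / (2 * V0)" if u: "\<And>n. s n \<le> u n" "\<And>n. u n \<le> t n" for u
  proof (rule order_tendstoI)
    have pos: "\<forall>\<^sub>F n in sequentially. 1 \<le> real n * (a n)\<^sup>2" using na unfolding filterlim_at_top by blast
    \<comment> \<open>Monotonicity of the logarithm is used below and would fail at 0, where
      \<open>ln\<close> has the default value 0.\<close>
    have upos: "\<forall>\<^sub>F n in sequentially. 0 < u n"
    proof -
      have "\<forall>\<^sub>F n in sequentially. exp (- (1 / (2 * V0) + 1) * (real n * (a n)\<^sup>2)) \<le> s n" by (rule lower) simp
      then show ?thesis
      proof eventually_elim
        case (elim n)
        show ?case by (rule less_le_trans[OF exp_gt_zero order_trans[OF elim u(1)]])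
      qed
    qed
    {
      fix x assume "x < 1 / (2 * V0)"
      then obtain \<kappa> where \<kappa>: "x < \<kappa>" "\<kappa> < 1 / (2 * V0)" using dense by blast
      show "\<forall>\<^sub>F n in sequentially. x < - (1 / (real n * (a n)\<^sup>2)) * ln (u n)"
        using pos upos upper[OF \<kappa>(2)]
      proof eventually_elim
        case (elim n)
        have "ln (u n) \<le> ln (exp (- \<kappa> * (real n * (a n)\<^sup>2)))"
          using elim u(2)[of n] by (intro ln_mono) auto
        then have "ln (u n) \<le> - \<kappa> * (real n * (a n)\<^sup>2)" by simp
        then have "\<kappa> \<le> - (1 / (real n * (a n)\<^sup>2)) * ln (u n)" using elim(1) by (simp add: field_simps)
        then show ?case using \<kappa>(1) by linarith
      qed
    next
      fix x assume "1 / (2 * V0) < x"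
      then obtain \<kappa> where \<kappa>: "1 / (2 * V0) < \<kappa>" "\<kappa> < x" using dense by blast
      show "\<forall>\<^sub>F n in sequentially. - (1 / (real n * (a n)\<^sup>2)) * ln (u n) < x"
        using pos upos lower[OF \<kappa>(1)]
      proof eventually_elim
        case (elim n)
        have "ln (exp (- \<kappa> * (real n * (a n)\<^sup>2))) \<le> ln (u n)"
          using elim u(1)[of n] by (intro ln_mono) auto
        then have "- \<kappa> * (real n * (a n)\<^sup>2) \<le> ln (u n)" by simp
        then have "- (1 / (real n * (a n)\<^sup>2)) * ln (u n) \<le> \<kappa>" using elim(1) by (simp add: field_simps)
        then show ?case using \<kappa>(2) by linarith
      qed
    }
  qed
  show ?thesis
    using lim[of s] lim[of t] st unfolding s_def t_def V0_def by auto
qed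

end
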